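(* Under the setting and assumptions described in the context, $$\mathcal L^{*}=\sup\Big\{\mathcal L(f_1,\dots,f_K)\;:\; f_1,\dots,f_K\in\mathcal C(\mathcal Y),\ \textstyle\sum_{k=1}^K\lambda_k f_k\equiv 0 \text{ on } \mathcal Y\Big\}.$$
   Context: Let $K\ge 1$. For $k=1,\dots,K$ let $\mathcal X_k\subset\mathbb R^{D_k}$ be compact, and let $\mathcal Y\subset\mathbb R^{D}$ be compact with positive Lebesgue measure. Let $\mathbb P_k$ be an absolutely continuous Borel probability measure on $\mathcal X_k$. Let $c_k:\mathcal X_k\times\mathcal Y\to\mathbb R$ be continuous. Fix weights $\lambda_k>0$ with $\sum_k\lambda_k=1$ and fix $\epsilon>0$. $\mathcal P(\mathcal Y)$ denotes the Borel probability measures on $\mathcal Y$, and $\mathcal C(\mathcal Y)$ the continuous real functions on $\mathcal Y$. For $\mu\in\mathcal P(\mathcal Y)$, the differential entropy is $H(\mu)=-\int_{\mathcal Y}\log\frac{d\mu}{dy}(y)\,d\mu(y)$ if $\mu$ is absolutely continuous, and $H(\mu)=-\infty$ otherwise. For $\mathbb P$ on $\mathcal X$, $\mathbb Q\in\mathcal P(\mathcal Y)$ and a continuous cost $c$, let $\Pi(\mathbb P,\mathbb Q)$ be the set of couplings. Define $$\mathrm{EOT}_{c,\epsilon}(\mathbb P,\mathbb Q)=\min_{\pi\in\Pi(\mathbb P,\mathbb Q)}\Big\{\int c\,d\pi-\epsilon\int_{\mathcal X}H(\pi(\cdot\mid x))\,d\mathbb P(x)\Big\},$$ where $\pi(\cdot\mid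 x)$ is the conditional distribution of $\pi$ given the first coordinate. The barycenter value is $$\mathcal L^*=\inf_{\mathbb Q\in\mathcal P(\mathcal Y)}\sum_{k=1}^K\lambda_k\,\mathrm{EOT}_{c_k,\epsilon}(\mathbb P_k,\mathbb Q).$$ It is assumed that this infimum is finite for at least one $\mathbb Q$. For $f\in\mathcal C(\mathcal Y)$, the weak entropic $c_k$-transform is $$f^{C_k}(x)=\inf_{\mu\in\mathcal P(\mathcal Y)}\Big\{\int c_k(x,y)\,d\mu(y)-\epsilon H(\mu)-\int f\,d\mu\Big\}.$$ This equals $-\epsilon\log Z_{c_k}(f,x)$, where $$Z_{c_k}(f,x)=\int_{\mathcal Y}\exp\Big(\frac{f(y)-c_k(x,y)}{\epsilon}\Big)\,dy.$$ Define $$\mathcal L(f_1,\dots,f_K)=\sum_{k=1}^K\lambda_k\int_{\mathcal X_k}f_k^{C_k}(x_k)\,d\mathbb P_k(x_k).$$ *)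

theory Defs
  imports "HOL-Probability.Probability"
begin

text \<open>Lebesgue measure on R^n, realised on the extensional functions {..<n} -> real
  (so that spaces of different dimensions share the type nat => real).\<close>
definition leb_fin :: "nat \<Rightarrow> (nat \<Rightarrow> real) measure" where
  "leb_fin n = PiM {..<n} (\<lambda>_. lborel)"

definition probs :: "'y::euclidean_space set \<Rightarrow> 'y measure set" where
  "probs Y = {\<mu>. sets \<mu> = sets (restrict_space lborel Y) \<and> prob_space \<mu>}"

definition ereal_integral :: "'a measure \<Rightarrow> ('a \<Rightarrow> ereal) \<Rightarrow> ereal" where
  "ereal_integral M g =
     enn2ereal (\<integral>\<^sup>+ x. e2ennreal (g x) \<partial>M) - enn2ereal (\<integral>\<^sup>+ x. e2ennreal (- g x) \<partial>M)"

definition diff_entropy :: "'y::euclidean_space set \<Rightarrow> 'y measure \<Rightarrow> ereal" where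
  "diff_entropy Y \<mu> =
     (if absolutely_continuous (restrict_space lborel Y) \<mu>
      then ereal_integral \<mu> (\<lambda>y. ereal (- ln (enn2real (RN_deriv (restrict_space lborel Y) \<mu> y))))
      else - \<infinity>)"

definition couplings :: "'x measure \<Rightarrow> 'y measure \<Rightarrow> ('x \<times> 'y) measure set" where
  "couplings P Q = {\<pi>. sets \<pi> = sets (P \<Otimes>\<^sub>M Q) \<and> prob_space \<pi> \<and>
                       distr \<pi> P fst = P \<and> distr \<pi> Q snd = Q}"

definition cond_kernel :: "'x measure \<Rightarrow> 'y measure \<Rightarrow> ('x \<times> 'y) measure \<Rightarrow> ('x \<Rightarrow> 'y measure) \<Rightarrow> bool" where
  "cond_kernel P Q \<pi> \<kappa> \<longleftrightarrow>
     \<kappa> \<in> P \<rightarrow>\<^sub>M prob_algebra Q \<and>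
     \<pi> = P \<bind> (\<lambda>x. distr (\<kappa> x) (P \<Otimes>\<^sub>M Q) (\<lambda>y. (x, y)))"

definition eot_obj :: "('x \<Rightarrow> 'y::euclidean_space \<Rightarrow> real) \<Rightarrow> real \<Rightarrow> 'y set \<Rightarrow>
    'x measure \<Rightarrow> 'y measure \<Rightarrow> ('x \<times> 'y) measure \<Rightarrow> ereal" where
  "eot_obj c \<epsilon> Y P Q \<pi> =
     (let \<kappa> = (SOME \<kappa>. cond_kernel P Q \<pi> \<kappa>) in
      ereal (\<integral>z. c (fst z) (snd z) \<partial>\<pi>) - ereal \<epsilon> * ereal_integral P (\<lambda>x. diff_entropy Y (\<kappa> x)))"

definition EOT :: "('x \<Rightarrow> 'y::euclidean_space \<Rightarrow> real) \<Rightarrow> real \<Rightarrow> 'y set \<Rightarrow>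
    'x measure \<Rightarrow> 'y measure \<Rightarrow> ereal" where
  "EOT c \<epsilon> Y P Q = (INF \<pi> \<in> couplings P Q. eot_obj c \<epsilon> Y P Q \<pi>)"

definition ctrans :: "('x \<Rightarrow> 'y::euclidean_space \<Rightarrow> real) \<Rightarrow> real \<Rightarrow> 'y set \<Rightarrow>
    ('y \<Rightarrow> real) \<Rightarrow> 'x \<Rightarrow> ereal" where
  "ctrans c \<epsilon> Y f x = (INF \<mu> \<in> probs Y.
      ereal (\<integral>y. c x y \<partial>\<mu>) - ereal \<epsilon> * diff_entropy Y \<mu> - ereal (\<integral>y. f y \<partial>\<mu>))"

definition barycenter_value :: "nat \<Rightarrow> (nat \<Rightarrow> real) \<Rightarrow> (nat \<Rightarrow> 'x \<Rightarrow> 'y::euclidean_space \<Rightarrow> real) \<Rightarrow>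
    real \<Rightarrow> 'y set \<Rightarrow> (nat \<Rightarrow> 'x measure) \<Rightarrow> ereal" where
  "barycenter_value K lam c \<epsilon> Y P =
     (INF Q \<in> probs Y. \<Sum>k<K. ereal (lam k) * EOT (c k) \<epsilon> Y (P k) Q)"

definition dual_L :: "nat \<Rightarrow> (nat \<Rightarrow> real) \<Rightarrow> (nat \<Rightarrow> 'x \<Rightarrow> 'y::euclidean_space \<Rightarrow> real) \<Rightarrow>
    real \<Rightarrow> 'y set \<Rightarrow> (nat \<Rightarrow> 'x measure) \<Rightarrow> (nat \<Rightarrow> 'y \<Rightarrow> real) \<Rightarrow> real" where
  "dual_L K lam c \<epsilon> Y P f =
     (\<Sum>k<K. lam k * (\<integral>x. real_of_ereal (ctrans (c k) \<epsilon> Y (f k) x) \<partial>(P k)))"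

end

theory Submission
  imports Defs "HOL-Complex_Analysis.Great_Picard"
begin

text \<open>
  Weak duality is Gibbs' variational principle applied to the conditional distributions of a
  coupling and integrated over the first marginal. Since a coupling enters the primal objective
  only through a choice of its disintegration, this requires that every coupling has one; to
  evaluate the objective one also needs that it is unique almost everywhere.

  For the converse write \<open>\<phi> k = f k / \<epsilon>\<close>. The dual problem is to minimise the sum \<open>G \<phi>\<close> of
  \<open>lam k * \<integral>ln (Z k (\<phi> k)) dP k\<close> over \<open>k\<close>, subject to \<open>(\<Sum>k. lam k * \<phi> k) = 0\<close>.
  Let \<open>q k\<close> be the density of the second marginal of the Gibbs coupling with potential \<open>\<phi> k\<close>.
  A Sinkhorn step replaces all \<open>q k\<close> by their weighted geometric mean \<open>q\<close> and changes \<open>G\<close> by at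
  most \<open>\<integral>q - 1\<close>, which is nonpositive by the AM-GM inequality and zero only if all \<open>q k\<close> agree
  almost everywhere. The potentials produced by a step inherit the modulus of continuity of the
  costs, so by Arzela-Ascoli a minimiser exists; there all \<open>q k\<close> agree, hence the Gibbs couplings
  share their second marginal and form a primal solution with the same value.
\<close>

subsection \<open>Disintegration of couplings\<close>

text \<open>The Sinkhorn iteration is never run to convergence; a single step is used in two ways.
  Applied to each member of a minimising sequence, it supplies equicontinuity without increasing
  \<open>G\<close>. Applied to the limit, it is one competitor, and minimality against it alone
  forces equality in AM-GM. A modulus of continuity controls oscillations but not sizes. Adding
  constants with weighted sum zero to the potentials preserves feasibility and \<open>G\<close>, so
  every potential can also be made to vanish at a base point; the bound on the costs then bounds all
  potentials uniformly. Disintegration has its own obstacle: conditional probabilities exist set by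
  set, each up to its own null set, and must be assembled into a kernel. This is done on the real
  line, where countably many rational levels determine a distribution. Points of the Euclidean space
  are coded by reals to reach that case.\<close>

lemma AE_le_of_nn_integral_le:
  fixes f g :: "'a \<Rightarrow> ennreal"
  assumes [measurable]: "f \<in> borel_measurable M" "g \<in> borel_measurable M"
    and fin: "(\<integral>\<^sup>+x. f x \<partial>M) < \<infinity>"
    and le: "\<And>A. A \<in> sets M \<Longrightarrow> (\<integral>\<^sup>+x. f x * indicator A x \<partial>M)
        \<le> (\<integral>\<^sup>+x. g x * indicator A x \<partial>M)"
  shows "AE x in M. f x \<le> g x"
proof -
  \<comment> \<open>On the set where \<open>f\<close> exceeds \<open>g\<close> the hypothesis forces
    equal finite integrals, so the nonnegative difference vanishes almost everywhere there.\<close>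
  define A where "A = {x \<in> space M. g x < f x}"
  have A[measurable]: "A \<in> sets M" unfolding A_def by measurable
  let ?f = "\<lambda>x. f x * indicator A x" and ?g = "\<lambda>x. g x * indicator A x"
  have gf: "?g x \<le> ?f x" for x by (auto simp: A_def indicator_def)
  have "(\<integral>\<^sup>+x. ?f x \<partial>M) \<le> (\<integral>\<^sup>+x. f x \<partial>M)"
    by (intro nn_integral_mono) (auto simp: indicator_def)
  then have ffin: "(\<integral>\<^sup>+x. ?f x \<partial>M) < \<infinity>" using fin by (rule le_less_trans)
  have eq: "(\<integral>\<^sup>+x. ?f x \<partial>M) = (\<integral>\<^sup>+x. ?g x \<partial>M)"
    by (intro antisym le A nn_integral_mono gf)
  have "(\<integral>\<^sup>+x. ?f x - ?g x \<partial>M) = (\<integral>\<^sup>+x. ?f x \<partial>M) -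
      (\<integral>\<^sup>+x. ?g x \<partial>M)"
    using ffin eq gf by (intro nn_integral_diff) auto
  also have "\<dots> = 0" using eq ffin by simp
  finally have "AE x in M. ?f x - ?g x = 0"
    by (subst (asm) nn_integral_0_iff_AE) auto
  moreover have "AE x in M. x \<in> space M" by (rule AE_space)
  moreover have "AE x in M. ?f x \<noteq> \<infinity>"
    using ffin by (intro nn_integral_PInf_AE) auto
  ultimately show ?thesis
  proof eventually_elim
    case (elim x)
    show ?case
    proof (rule ccontr)
      assume "\<not> f x \<le> g x"
      then have "g x < f x" by simp
      with elim show False
        by (cases "x \<in> A") (auto simp: A_def indicator_def diff_eq_0_iff_ennreal split: if_splits)
    qed
  qed
qed

text \<open>With digits 0 and 1 only, the tail behind any digit is at most 1/3, so no carry can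
  occur. After a shift by \<open>Suc m\<close> places all digits before the \<open>m\<close>-th
  carry a positive power of 4, and the parity of the floor is the \<open>m\<close>-th bit.\<close>

lemma floor_base4_digits:
  fixes b :: "nat \<Rightarrow> bool"
  defines "s \<equiv> (\<lambda>j. of_bool (b j) * (1/4::real) ^ Suc j)"
  shows "summable s" "0 \<le> suminf s" "suminf s \<le> 1" "odd \<lfloor>4 ^ Suc m * suminf s\<rfloor>
      \<longleftrightarrow> b m"
proof -
  have bnd: "norm (s j) \<le> (1/4) ^ Suc j" for j by (simp add: s_def)
  have geo: "(\<lambda>j. (1/4::real) ^ Suc j) sums (1/3)"
    using sums_mult[OF geometric_sums[of "1/4::real"], of "1/4"] by simp
  have sm: "summable s"
    by (rule summable_comparison_test'[OF sums_summable[OF geo], of 0]) (use bnd in auto)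
  have s0: "0 \<le> s j" for j by (simp add: s_def)
  show "summable s" by (rule sm)
  show "0 \<le> suminf s" by (intro suminf_nonneg sm s0)
  have third: "suminf s \<le> 1/3"
    if "\<And>j. 0 \<le> s j" "\<And>j. s j \<le> (1/4) ^ Suc j" "summable s" for s :: "nat \<Rightarrow> real"
    using suminf_le[OF that(2,3) sums_summable[OF geo]] sums_unique[OF geo] by simp
  show "suminf s \<le> 1" using third[OF s0 _ sm] bnd by (force simp: s_def)
  define t where "t = (\<Sum>j. 4 ^ Suc m * s (j + Suc m))"
  have t_eq: "t = (\<Sum>j. of_bool (b (j + Suc m)) * (1/4::real) ^ Suc j)"
    unfolding t_def s_def by (intro suminf_cong) (simp add: power_add power_divide field_simps)
  have sm': "summable (\<lambda>j. of_bool (b (j + Suc m)) * (1/4::real) ^ Suc j)"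
    by (rule summable_comparison_test'[OF sums_summable[OF geo], of 0]) auto
  have t: "0 \<le> t" "t < 1"
    using third[OF _ _ sm'] suminf_nonneg[OF sm'] by (auto simp: t_eq)
  define h where "h = (\<Sum>j<m. of_bool (b j) * (4::int) ^ (m - j))"
  have hd: "4 ^ Suc m * (\<Sum>j<Suc m. s j) = real_of_int (h + of_bool (b m))"
  proof -
    have "4 ^ Suc m * s j = of_bool (b j) * 4 ^ (m - j)" if "j < m" for j
      using that by (simp add: s_def power_divide power_diff)
    then have "4 ^ Suc m * (\<Sum>j<m. s j) = (\<Sum>j<m. of_bool (b j) * 4 ^ (m - j))"
      by (simp only: sum_distrib_left) (auto intro!: sum.cong)
    also have "\<dots> = real_of_int h" unfolding h_def by (simp del: sum_of_bool_mult_eq)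
    finally show ?thesis
      by (simp only: sum.lessThan_Suc distrib_left) (simp add: s_def power_divide)
  qed
  have "4 ^ Suc m * suminf s = real_of_int (h + of_bool (b m)) + t"
    unfolding t_def using suminf_split_initial_segment[OF sm, of "Suc m"] hd
      suminf_mult[OF summable_ignore_initial_segment[OF sm, of "Suc m"], of "4 ^ Suc m"]
    by (simp add: algebra_simps)
  then have "\<lfloor>4 ^ Suc m * suminf s\<rfloor> = h + of_bool (b m)"
    using t by linarith
  moreover have "even h"
    unfolding h_def by (intro dvd_sum) (auto intro: dvd_mult)
  ultimately show "odd \<lfloor>4 ^ Suc m * suminf s\<rfloor> \<longleftrightarrow> b m" by simp
qed

text \<open>A point is coded by the bits \<open>dist y (d i) < 2\<^sup>-\<^sup>n\<close> for a dense sequence \<open>d\<close>,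
  written as a number in base 4 so that the digits can be recovered unambiguously.\<close>

lemma unit_interval_code:
  obtains \<phi> :: "'y::euclidean_space \<Rightarrow> real" and \<psi> :: "real \<Rightarrow> 'y"
  where "\<phi> \<in> borel_measurable borel" "\<psi> \<in> borel_measurable borel"
    "\<And>y. \<phi> y \<in> {0..1}" "\<And>y. \<psi> (\<phi> y) = y"
proof -
  obtain D :: "'y set" where D: "countable D" "\<And>X. open X \<Longrightarrow> X \<noteq> {} \<Longrightarrow>
      \<exists>d\<in>D. d \<in> X"
    by (rule countable_dense_setE) blast
  have Dne: "D \<noteq> {}" using D(2)[of UNIV] by auto
  define d where "d = from_nat_into D"
  define bit where "bit y m = (case prod_decode m of (n, i) \<Rightarrow> dist y (d i) < (1/2) ^ n)" for y :: 'y and m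
  define \<phi> where "\<phi> y = (\<Sum>m. of_bool (bit y m) * (1/4::real) ^ Suc m)" for y
  \<comment> \<open>Decoding from the bits alone: an index whose bit is set at level
    \<open>n\<close> names a dense point within \<open>(1/2) ^ n\<close> of the coded point, so the
    selected points converge to it.\<close>
  define sel where "sel r n = (LEAST i. odd \<lfloor>4 ^ Suc (prod_encode (n, i)) * r\<rfloor>)" for r :: real and n
  define \<psi> where "\<psi> r = lim (\<lambda>n. d (sel r n))" for r
  have [measurable]: "Measurable.pred borel (\<lambda>y. bit y m)" for m
    unfolding bit_def by (cases "prod_decode m") simp
  have m1: "\<phi> \<in> borel_measurable borel"
    unfolding \<phi>_def by measurable
  have [measurable]: "(\<lambda>r. sel r n) \<in> borel \<rightarrow>\<^sub>M count_space UNIV" for n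
    unfolding sel_def by measurable
  have m2: "\<psi> \<in> borel_measurable borel"
    unfolding \<psi>_def by measurable
  have "\<psi> (\<phi> y) = y" for y
  proof -
    have "dist (d (sel (\<phi> y) n)) y < (1/2) ^ n" for n
    proof -
      have odd_iff: "odd \<lfloor>4 ^ Suc (prod_encode (n, i)) * \<phi> y\<rfloor> \<longleftrightarrow> dist y (d
          i) < (1/2) ^ n" for i
        unfolding \<phi>_def floor_base4_digits(4) by (simp add: bit_def)
      obtain e where "e \<in> D" "e \<in> ball y ((1/2) ^ n)"
        using D(2)[of "ball y ((1/2) ^ n)"] centre_in_ball[of y "(1/2) ^ n"] zero_less_power[of "1/2::real" n]
        by (metis empty_iff half_gt_zero open_ball zero_less_one)
      then have "\<exists>i. dist y (d i) < (1/2) ^ n"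
        using from_nat_into_surj[OF D(1)] by (auto simp: d_def)
      from LeastI_ex[OF this] show ?thesis
        unfolding sel_def odd_iff by (simp add: dist_commute)
    qed
    then have "\<forall>\<^sub>F n in sequentially. norm (dist (d (sel (\<phi> y) n)) y) \<le> (1/2) ^ n"
      by (auto intro!: always_eventually less_imp_le)
    then have "(\<lambda>n. dist (d (sel (\<phi> y) n)) y) \<longlonglongrightarrow> 0"
      by (rule Lim_null_comparison) (rule LIMSEQ_realpow_zero; simp)
    then have "(\<lambda>n. d (sel (\<phi> y) n)) \<longlonglongrightarrow> y"
      by (rule tendsto_dist_iff[THEN iffD2])
    then show ?thesis unfolding \<psi>_def by (rule limI)
  qed
  moreover have "\<phi> y \<in> {0..1}" for y
    unfolding \<phi>_def using floor_base4_digits(2,3) by auto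
  ultimately show thesis using m1 m2 that by blast
qed

section \<open>Disintegration over the unit interval\<close>

lemma finite_measure_eqI_rectangles:
  assumes M: "sets M = sets (A \<Otimes>\<^sub>M B)" and N: "sets N = sets (A \<Otimes>\<^sub>M B)"
    and fin: "emeasure M (space A \<times> space B) < \<infinity>"
    and eq: "\<And>a b. a \<in> sets A \<Longrightarrow> b \<in> sets B \<Longrightarrow> emeasure M (a \<times>
        b) = emeasure N (a \<times> b)"
  shows "M = N"
proof (rule measure_eqI_generator_eq[OF Int_stable_pair_measure_generator[of A B],
      where A = "\<lambda>_. space A \<times> space B" and \<Omega> = "space A \<times> space B"])
  show "{a \<times> b |a b. a \<in> sets A \<and> b \<in> sets B} \<subseteq> Pow (space A \<times> space B)"
    by (rule pair_measure_closed)
  show "sets M = sigma_sets (space A \<times> space B) {a \<times> b |a b. a \<in> sets A \<and> b \<in> sets B}"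
    "sets N = sigma_sets (space A \<times> space B) {a \<times> b |a b. a \<in> sets A \<and> b \<in> sets B}"
    using M N by (simp_all only: sets_pair_measure)
  show "range (\<lambda>_. space A \<times> space B) \<subseteq> {a \<times> b |a b. a \<in> sets A \<and> b \<in> sets B}"
    by blast
qed (use fin eq in auto)

text \<open>\<open>F\<close> is the conditional probability of \<open>B\<close> given the first
  coordinate. It is the Radon-Nikodym density of the slice measure sending \<open>A\<close> to the
  mass of \<open>A \<times> B\<close>, which is dominated by the marginal \<open>P\<close>.\<close>

lemma marginal_section_density:
  assumes "prob_space P" and N: "sets N = sets (P \<Otimes>\<^sub>M M)" and marg: "distr N P fst = P"
    and B[measurable]: "B \<in> sets M"
  obtains F where "F \<in> borel_measurable P"
    "\<And>A. A \<in> sets P \<Longrightarrow> (\<integral>\<^sup>+x. F x * indicator A x \<partial>P) = emeasure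
        N (A \<times> B)"
proof -
  interpret P: prob_space P by fact
  note [measurable_cong] = N
  have B': "space P \<times> B \<in> sets N" by measurable
  define \<nu> where "\<nu> = distr (density N (indicator (space P \<times> B))) P fst"
  have \<nu>: "emeasure \<nu> A = emeasure N (A \<times> B)" if A[measurable]: "A \<in> sets P" for A
  proof -
    have "emeasure \<nu> A = (\<integral>\<^sup>+z. indicator (space P \<times> B) z * indicator (fst -` A
        \<inter> space N) z \<partial>N)"
      unfolding \<nu>_def using B' by (subst emeasure_distr) (auto simp: emeasure_density)
    also have "\<dots> = (\<integral>\<^sup>+z. indicator (A \<times> B) z \<partial>N)"
      using sets.sets_into_space[OF A] sets_eq_imp_space_eq[OF N]
      by (intro nn_integral_cong) (auto simp: indicator_def space_pair_measure)
    finally show ?thesis by simp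
  qed
  have ac: "absolutely_continuous P \<nu>"
    unfolding absolutely_continuous_def
  proof
    fix A assume A: "A \<in> null_sets P"
    then have [measurable]: "A \<in> sets P" by auto
    have "emeasure N (A \<times> B) \<le> emeasure N (fst -` A \<inter> space N)"
      using sets.sets_into_space[of A P] sets.sets_into_space[OF B] sets_eq_imp_space_eq[OF N]
      by (intro emeasure_mono) (auto simp: space_pair_measure)
    also have "\<dots> = emeasure (distr N P fst) A" by (subst emeasure_distr) auto
    also have "\<dots> = 0" using A marg by auto
    finally show "A \<in> null_sets \<nu>" using \<nu>[of A] by (auto simp: null_sets_def) (simp add: \<nu>_def)
  qed
  have D: "density P (RN_deriv P \<nu>) = \<nu>"
    by (rule P.density_RN_deriv[OF ac]) (simp add: \<nu>_def)
  show thesis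
  proof (rule that[of "RN_deriv P \<nu>"])
    fix A assume A: "A \<in> sets P"
    show "(\<integral>\<^sup>+x. RN_deriv P \<nu> x * indicator A x \<partial>P) = emeasure N (A \<times> B)"
      using A by (subst \<nu>[symmetric, OF A], subst D[symmetric]) (simp add: emeasure_density)
  qed simp
qed

lemma emeasure_uniform_below:
  assumes "0 \<le> s" "s \<le> (1::real)"
  shows "emeasure (uniform_measure lborel {0..1}) {..<s} = ennreal s"
    "emeasure (uniform_measure lborel {0..1}) {..s} = ennreal s"
proof -
  have "{0..1} \<inter> {..<s} = {0..<s}" "{0..1} \<inter> {..s} = {0..s}" using assms by auto
  then show "emeasure (uniform_measure lborel {0..1}) {..<s} = ennreal s"
    "emeasure (uniform_measure lborel {0..1}) {..s} = ennreal s"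
    using assms by (simp_all add: emeasure_uniform_measure divide_ennreal_def)
qed

text \<open>The union lies between the open and the closed half-line ending at the supremum, and
  these have the same measure; so it does not matter whether the supremum is attained.\<close>

lemma emeasure_uniform_UN_below:
  fixes G :: "'i \<Rightarrow> real"
  assumes I: "countable I" "I \<noteq> {}" and G: "\<And>q. q \<in> I \<Longrightarrow> G q \<in> {0..1}"
  shows "emeasure (uniform_measure lborel {0..1}) {u. \<exists>q\<in>I. u \<le> G q} = ennreal (SUP q\<in>I. G q)"
proof (rule antisym)
  let ?U = "uniform_measure lborel {0..1::real}"
  have bdd: "bdd_above (G ` I)" using G by (intro bdd_aboveI[of _ 1]) auto
  obtain q0 where q0: "q0 \<in> I" using I by auto
  have s: "0 \<le> (SUP q\<in>I. G q)" "(SUP q\<in>I. G q) \<le> 1"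
    using cSUP_upper2[OF bdd q0, of 0] G[OF q0] I G by (auto intro!: cSUP_least)
  have eq: "{u. \<exists>q\<in>I. u \<le> G q} = (\<Union>q\<in>I. {..G q})" by auto
  have meas: "{u. \<exists>q\<in>I. u \<le> G q} \<in> sets borel"
    unfolding eq using I by (intro sets.countable_UN') auto
  have "emeasure ?U {u. \<exists>q\<in>I. u \<le> G q} \<le> emeasure ?U {..(SUP q\<in>I. G q)}"
    using bdd by (intro emeasure_mono) (auto intro: order_trans cSUP_upper)
  then show "emeasure ?U {u. \<exists>q\<in>I. u \<le> G q} \<le> ennreal (SUP q\<in>I. G q)"
    using emeasure_uniform_below(2)[OF s] by simp
  have "emeasure ?U {..<(SUP q\<in>I. G q)} \<le> emeasure ?U {u. \<exists>q\<in>I. u \<le> G q}"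
    using meas less_cSUP_iff[OF I(2) bdd] by (intro emeasure_mono) (auto intro: less_imp_le)
  then show "ennreal (SUP q\<in>I. G q) \<le> emeasure ?U {u. \<exists>q\<in>I. u \<le> G q}"
    using emeasure_uniform_below(1)[OF s] by simp
qed

lemma emeasure_bind_Pair:
  assumes "space P \<noteq> {}" and k[measurable]: "\<kappa> \<in> P \<rightarrow>\<^sub>M subprob_algebra Q"
    and [measurable]: "A \<in> sets P" "B \<in> sets Q"
  shows "emeasure (P \<bind> (\<lambda>x. distr (\<kappa> x) (P \<Otimes>\<^sub>M Q) (\<lambda>y. (x, y)))) (A \<times> B)
    = (\<integral>\<^sup>+x. emeasure (\<kappa> x) B * indicator A x \<partial>P)"
proof -
  have [measurable]: "(\<lambda>x. distr (\<kappa> x) (P \<Otimes>\<^sub>M Q) (\<lambda>y. (x, y))) \<in> P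
      \<rightarrow>\<^sub>M subprob_algebra (P \<Otimes>\<^sub>M Q)"
    by (rule measurable_distr2[OF _ k]) measurable
  have "emeasure (P \<bind> (\<lambda>x. distr (\<kappa> x) (P \<Otimes>\<^sub>M Q) (\<lambda>y. (x, y)))) (A \<times> B) =
      (\<integral>\<^sup>+x. emeasure (distr (\<kappa> x) (P \<Otimes>\<^sub>M Q) (\<lambda>y. (x, y))) (A
          \<times> B) \<partial>P)"
    using assms(1) by (intro emeasure_bind[where N = "P \<Otimes>\<^sub>M Q"]) measurable
  also have "\<dots> = (\<integral>\<^sup>+x. emeasure (\<kappa> x) B * indicator A x \<partial>P)"
  proof (intro nn_integral_cong)
    fix x assume x: "x \<in> space P"
    have S: "sets (\<kappa> x) = sets Q" using measurable_space[OF k x] by (simp add: space_subprob_algebra)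
    note [measurable_cong] = S
    have "emeasure (distr (\<kappa> x) (P \<Otimes>\<^sub>M Q) (\<lambda>y. (x, y))) (A \<times> B)
        = emeasure (\<kappa> x) ((\<lambda>y. (x, y)) -` (A \<times> B) \<inter> space (\<kappa> x))"
      using x by (intro emeasure_distr) measurable
    also have "(\<lambda>y. (x, y)) -` (A \<times> B) \<inter> space (\<kappa> x) = (if x \<in> A then B else {})"
      using sets.sets_into_space[OF \<open>B \<in> sets Q\<close>] sets_eq_imp_space_eq[OF S] by auto
    finally show "emeasure (distr (\<kappa> x) (P \<Otimes>\<^sub>M Q) (\<lambda>y. (x, y))) (A \<times> B)
        = emeasure (\<kappa> x) B * indicator A x" by (simp add: indicator_def)
  qed
  finally show ?thesis .
qed

text \<open>The kernel is realised by conditional quantile functions driven by a uniform variable.\<close>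

lemma unit_interval_disintegration:
  fixes N :: "('x \<times> real) measure"
  assumes P: "prob_space P" and N: "sets N = sets (P \<Otimes>\<^sub>M borel)" and marg: "distr N P fst = P"
    and supp: "AE z in N. snd z \<in> {0..1}"
  obtains \<kappa> where "\<kappa> \<in> P \<rightarrow>\<^sub>M prob_algebra borel"
    "N = P \<bind> (\<lambda>x. distr (\<kappa> x) (P \<Otimes>\<^sub>M borel) (\<lambda>y. (x, y)))"
proof -
  interpret P: prob_space P by fact
  note [measurable_cong] = N
  have "prob_space (distr N P fst)" using P marg by simp
  then interpret N: prob_space N by (rule prob_space_distrD[rotated]) measurable
  define U where "U = uniform_measure lborel {0..1::real}"
  interpret U: prob_space U unfolding U_def by (rule prob_space_uniform_measure) auto
  have [measurable_cong]: "sets U = sets borel" by (simp add: U_def)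
  have "\<exists>F. F \<in> borel_measurable P \<and>
      (\<forall>A\<in>sets P. (\<integral>\<^sup>+x. F x * indicator A x \<partial>P) = emeasure N (A \<times>
          {t<..}))" for t :: real
    by (rule marginal_section_density[OF P N marg, of "{t<..}"]) auto
  \<comment> \<open>\<open>F t x\<close> is a version of the conditional probability that the second
    coordinate exceeds \<open>t\<close>. Each \<open>t\<close> has its own exceptional null set,
    which is why only rational levels enter the construction of the kernel.\<close>
  then obtain F where Fm[measurable]: "\<And>t. F t \<in> borel_measurable P"
    and F: "\<And>t A. A \<in> sets P \<Longrightarrow> (\<integral>\<^sup>+x. F t x * indicator A x \<partial>P)
        = emeasure N (A \<times> {t<..})"
    by metis
  have NA: "emeasure N (A \<times> UNIV) = emeasure P A" if [measurable]: "A \<in> sets P" for A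
  proof -
    have "emeasure (distr N P fst) A = emeasure N (fst -` A \<inter> space N)"
      by (intro emeasure_distr) measurable
    also have "fst -` A \<inter> space N = A \<times> UNIV"
      using sets_eq_imp_space_eq[OF N] sets.sets_into_space[OF that] by (auto simp: space_pair_measure)
    finally show ?thesis using marg by simp
  qed
  have Fint: "(\<integral>\<^sup>+x. F t x \<partial>P) < \<infinity>" for t
  proof -
    have "(\<integral>\<^sup>+x. F t x \<partial>P) = (\<integral>\<^sup>+x. F t x * indicator (space P) x \<partial>P)"
      by (intro nn_integral_cong) auto
    then show ?thesis using F[of "space P" t] N.emeasure_finite[of "space P \<times> {t<..}"]
      by (simp add: less_top[symmetric])
  qed
  have F_mono: "AE x in P. F q x \<le> F t x" if "t \<le> q" for t q
    by (rule AE_le_of_nn_integral_le[OF _ _ Fint])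
      (use that in \<open>auto simp: F intro!: emeasure_mono\<close>)
  have F_le1: "AE x in P. F q x \<le> 1" for q
    by (rule AE_le_of_nn_integral_le[OF _ _ Fint])
      (auto simp: F NA[symmetric] intro!: emeasure_mono)
  \<comment> \<open>The truncation puts the values into the unit interval for every
    \<open>x\<close>; by \<open>F_le1\<close> it changes \<open>F q\<close> on a null set
    only.\<close>
  define G where "G q x = enn2real (min 1 (F q x))" for q x
  have Gm[measurable]: "G q \<in> borel_measurable P" for q unfolding G_def by measurable
  have G01: "G q x \<in> {0..1}" for q x
  proof -
    have "enn2real (min 1 (F q x)) \<le> enn2real 1" by (intro enn2real_mono) auto
    then show ?thesis by (simp add: G_def)
  qed
  have GF: "AE x in P. ennreal (G q x) = F q x" for q
    using F_le1[of q] by eventually_elim (simp add: G_def min_absorb2 order_le_less_trans)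
  define J where "J = \<rat> \<inter> {0..1::real}"
  have J: "countable J" "J \<noteq> {}" by (auto simp: J_def countable_rat intro!: exI[of _ 0])
  \<comment> \<open>A conditional quantile: the largest rational level whose tail probability is
    still at least \<open>u\<close>. The value 0 for the other levels keeps the supremum inside the
    unit interval. The description of its upper level sets in \<open>less_g\<close> holds for every
    \<open>x\<close>, also where \<open>G\<close> fails to be monotone in the level.\<close>
  define g where "g x u = (SUP q\<in>J. if u \<le> G q x then q else 0)" for x u
  have bdd: "bdd_above ((\<lambda>q. if u \<le> G q x then q else 0) ` J)" for u x
    by (intro bdd_aboveI[of _ 1]) (auto simp: J_def)
  have gm[measurable]: "case_prod g \<in> borel_measurable (P \<Otimes>\<^sub>M U)"
    unfolding g_def split_def
    by (rule borel_measurable_cSUP[OF J(1)]) (use bdd in \<open>simp_all, measurable\<close>)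
  have gx[measurable]: "g x \<in> borel_measurable U" if "x \<in> space P" for x
    using measurable_compose[OF measurable_Pair1'[OF that] gm] by simp
  have less_g: "t < g x u \<longleftrightarrow> t < 0 \<or> (\<exists>q\<in>{q\<in>J. t < q}. u \<le> G q x)" for t x u
  proof -
    have "t < g x u \<longleftrightarrow> (\<exists>q\<in>J. t < (if u \<le> G q x then q else 0))"
      unfolding g_def by (rule less_cSUP_iff[OF J(2) bdd])
    moreover have "0 \<in> J" by (auto simp: J_def)
    moreover have "0 \<le> q" if "q \<in> J" for q using that by (auto simp: J_def)
    ultimately show ?thesis by (auto split: if_splits intro: less_le_trans)
  qed
  define \<kappa> where "\<kappa> x = distr U borel (g x)" for x
  have k1: "\<kappa> \<in> P \<rightarrow>\<^sub>M subprob_algebra borel"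
    unfolding \<kappa>_def by (rule measurable_distr2[OF gm])
      (auto intro!: measurable_const simp: space_subprob_algebra U.prob_space_axioms prob_space_imp_subprob_space)
  have k2: "\<kappa> \<in> P \<rightarrow>\<^sub>M prob_algebra borel"
    by (rule measurable_prob_algebraI[OF _ k1]) (simp add: \<kappa>_def U.prob_space_distr gx)
  define N' where "N' = P \<bind> (\<lambda>x. distr (\<kappa> x) (P \<Otimes>\<^sub>M borel) (\<lambda>y. (x, y)))"
  have N's: "sets N' = sets (P \<Otimes>\<^sub>M borel)"
    unfolding N'_def using P.not_empty by (subst sets_bind) auto
  have N'e: "emeasure N' (A \<times> B) = (\<integral>\<^sup>+x. emeasure (\<kappa> x) B * indicator A x \<partial>P)"
    if "A \<in> sets P" "B \<in> sets borel" for A B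
    unfolding N'_def using that by (intro emeasure_bind_Pair P.not_empty k1)
  have k_gt: "emeasure (\<kappa> x) {t<..} = emeasure U {u. t < g x u}" if "x \<in> space P" for x t
    unfolding \<kappa>_def using that by (subst emeasure_distr) (auto simp: U_def vimage_def)
  \<comment> \<open>Only levels \<open>t\<close> in \<open>[0, 1)\<close> carry content. There the
    kernel gives the half-line above \<open>t\<close> the mass \<open>SUP q. G q x\<close> over
    rational \<open>q > t\<close>. It is at most \<open>F t x\<close> by monotonicity of the tails;
    the reverse bound is right continuity of the tails of \<open>N\<close>.\<close>
  have main: "emeasure N (A \<times> {t<..}) = emeasure N' (A \<times> {t<..})" if A[measurable]: "A \<in> sets P" for A t
  proof -
    consider "t < 0" | "1 \<le> t" | "0 \<le> t" "t < 1" by linarith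
    then show ?thesis
    proof cases
      case 1
      have "emeasure N' (A \<times> {t<..}) = (\<integral>\<^sup>+x. indicator A x \<partial>P)"
        unfolding N'e[OF A borel_open[OF open_greaterThan]]
        using U.emeasure_space_1 1 by (intro nn_integral_cong) (simp add: k_gt less_g U_def)
      also have "\<dots> = emeasure N (A \<times> UNIV)" by (simp add: NA)
      also have "\<dots> = emeasure N (A \<times> {t<..})"
      proof (rule emeasure_eq_AE)
        show "AE z in N. z \<in> A \<times> UNIV \<longleftrightarrow> z \<in> A \<times> {t<..}"
          using supp by eventually_elim (use 1 in auto)
      qed measurable
      finally show ?thesis ..
    next
      case 2
      have "emeasure N' (A \<times> {t<..}) = (\<integral>\<^sup>+x. 0 \<partial>P)"
        unfolding N'e[OF A borel_open[OF open_greaterThan]]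
      proof (intro nn_integral_cong)
        fix x assume x: "x \<in> space P"
        have "{u. t < g x u} = {}" using 2 by (auto simp: less_g J_def)
        then show "emeasure (\<kappa> x) {t<..} * indicator A x = 0" using x by (simp add: k_gt)
      qed
      moreover have "emeasure N (A \<times> {t<..}) = emeasure N {}"
      proof (rule emeasure_eq_AE)
        show "AE z in N. z \<in> A \<times> {t<..} \<longleftrightarrow> z \<in> {}"
          using supp by eventually_elim (use 2 in auto)
      qed measurable
      ultimately show ?thesis by simp
    next
      case 3
      define I where "I = {q\<in>J. t < q}"
      obtain q0 where "q0 \<in> \<rat>" "t < q0" "q0 < 1" using Rats_dense_in_real[OF 3(2)] by auto
      then have "q0 \<in> I" using 3 by (auto simp: I_def J_def)
      then have I: "countable I" "I \<noteq> {}"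
        using countable_subset[OF _ J(1), of I] by (auto simp: I_def)
      define s where "s x = (SUP q\<in>I. G q x)" for x
      have bG: "bdd_above ((\<lambda>q. G q x) ` I)" for x using G01 by (intro bdd_aboveI[of _ 1]) auto
      have [measurable]: "s \<in> borel_measurable P"
        unfolding s_def by (intro borel_measurable_cSUP I bG Gm)
      have "emeasure N' (A \<times> {t<..}) = (\<integral>\<^sup>+x. ennreal (s x) * indicator A x \<partial>P)"
        unfolding N'e[OF A borel_open[OF open_greaterThan]]
      proof (intro nn_integral_cong)
        fix x assume x: "x \<in> space P"
        have "{u. t < g x u} = {u. \<exists>q\<in>I. u \<le> G q x}" using 3 by (auto simp: less_g I_def)
        then show "emeasure (\<kappa> x) {t<..} * indicator A x = ennreal (s x) * indicator A x"
          using x emeasure_uniform_UN_below[OF I, of "\<lambda>q. G q x"] G01 by (simp add: k_gt s_def U_def)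
      qed
      moreover have "(\<integral>\<^sup>+x. ennreal (s x) * indicator A x \<partial>P) \<le> emeasure N (A \<times> {t<..})"
      proof -
        have "AE x in P. \<forall>q\<in>I. F q x \<le> F t x \<and> ennreal (G q x) = F q x"
          unfolding AE_ball_countable[OF I(1)]
        proof
          fix q assume "q \<in> I"
          then have "t \<le> q" by (simp add: I_def)
          from F_mono[OF this] GF[of q]
          show "AE x in P. F q x \<le> F t x \<and> ennreal (G q x) = F q x" by eventually_elim simp
        qed
        then have "AE x in P. ennreal (s x) * indicator A x \<le> F t x * indicator A x"
        proof eventually_elim
          case (elim x)
          have "ennreal (s x) \<le> F t x"
          proof (cases "F t x")
            case (real r)
            then have "G q x \<le> r" if "q \<in> I" for q
              using elim that by (metis ennreal_le_iff)
            then show ?thesis unfolding s_def using I real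
              by (auto intro!: cSUP_least ennreal_leI)
          qed simp
          then show ?case by (intro mult_right_mono) auto
        qed
        then show ?thesis unfolding F[OF A, symmetric] by (rule nn_integral_mono_AE)
      qed
      moreover have "emeasure N (A \<times> {t<..}) \<le> (\<integral>\<^sup>+x. ennreal (s x) * indicator A x \<partial>P)"
      proof -
        \<comment> \<open>A sequence decreasing to \<open>t\<close>, so the half-lines above
          \<open>h n\<close> increase to the one above \<open>t\<close>. Keeping
          \<open>h n \<le> 1\<close> ensures that a rational between \<open>t\<close> and
          \<open>h n\<close> belongs to \<open>J\<close>.\<close>
        define h where "h n = t + (1 - t) * inverse (real (Suc n))" for n
        have h: "t < h n" "h n \<le> 1" for n
        proof -
          have "h n \<le> t + (1 - t) * 1"
            unfolding h_def using 3 by (intro add_left_mono mult_left_mono) (auto simp: field_simps)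
          then show "h n \<le> 1" by simp
          show "t < h n" using 3 by (simp add: h_def)
        qed
        have hlim: "h \<longlonglongrightarrow> t"
          unfolding h_def using tendsto_add[OF tendsto_const tendsto_mult[OF tendsto_const
              LIMSEQ_inverse_real_of_nat], of t "1 - t"]
          by simp
        have hdec: "decseq h" unfolding h_def decseq_def using 3
          by (intro allI impI add_left_mono mult_left_mono) auto
        have UN: "A \<times> {t<..} = (\<Union>n. A \<times> {h n<..})"
        proof -
          have "\<exists>n. h n < y" if "t < y" for y
            using order_tendstoD(2)[OF hlim that] by (auto simp: eventually_sequentially)
          then show ?thesis using h(1) by (auto intro: less_trans)
        qed
        have "emeasure N (A \<times> {t<..}) = (SUP n. emeasure N (A \<times> {h n<..}))"
          unfolding UN using hdec
          by (intro SUP_emeasure_incseq[symmetric]) (auto simp: incseq_def decseq_def intro: le_less_trans)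
        also have "\<dots> \<le> (\<integral>\<^sup>+x. ennreal (s x) * indicator A x \<partial>P)"
        proof (rule SUP_least)
          fix n
          obtain q where q: "q \<in> \<rat>" "t < q" "q < h n" using Rats_dense_in_real[OF h(1)] by auto
          then have qI: "q \<in> I" using 3 h(2)[of n] by (auto simp: I_def J_def)
          have "emeasure N (A \<times> {h n<..}) \<le> emeasure N (A \<times> {q<..})"
            using q by (intro emeasure_mono) (auto, measurable)
          also have "\<dots> = (\<integral>\<^sup>+x. F q x * indicator A x \<partial>P)" by (simp add: F)
          also have "\<dots> \<le> (\<integral>\<^sup>+x. ennreal (s x) * indicator A x \<partial>P)"
          proof (rule nn_integral_mono_AE)
            show "AE x in P. F q x * indicator A x \<le> ennreal (s x) * indicator A x"
              using GF[of q]
            proof eventually_elim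
              case (elim x)
              have "F q x \<le> ennreal (s x)"
                unfolding elim[symmetric] s_def by (intro ennreal_leI cSUP_upper qI bG)
              then show ?case by (intro mult_right_mono) auto
            qed
          qed
          finally show "emeasure N (A \<times> {h n<..}) \<le> (\<integral>\<^sup>+x. ennreal (s x) * indicator A
              x \<partial>P)" .
        qed
        finally show ?thesis .
      qed
      ultimately show ?thesis by simp
    qed
  qed
  have "N = N'"
  proof (rule finite_measure_eqI_rectangles[OF N N's])
    show "emeasure N (space P \<times> space borel) < \<infinity>" by (simp add: less_top[symmetric])
    fix A and B :: "real set" assume A[measurable]: "A \<in> sets P" and B[measurable]: "B \<in> sets borel"
    \<comment> \<open>For fixed \<open>A\<close> the slice
      \<open>B \<mapsto> emeasure M (A \<times> B)\<close> is a finite Borel measure on the line,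
      hence determined by the half-lines treated in \<open>main\<close>.\<close>
    define S where "S M = distr (density M (indicator (A \<times> UNIV))) borel snd" for M :: "('x \<times> real) measure"
    have S: "emeasure (S M) B = emeasure M (A \<times> B)"
      if M: "sets M = sets (P \<Otimes>\<^sub>M borel)" and [measurable]: "B \<in> sets borel" for M B
    proof -
      note [measurable_cong] = M
      have "emeasure (S M) B = (\<integral>\<^sup>+z. indicator (A \<times> UNIV) z * indicator (snd -` B \<inter>
          space M) z \<partial>M)"
        unfolding S_def by (subst emeasure_distr) (auto simp: emeasure_density)
      also have "\<dots> = (\<integral>\<^sup>+z. indicator (A \<times> B) z \<partial>M)"
        using sets.sets_into_space[OF A] sets_eq_imp_space_eq[OF M]
        by (intro nn_integral_cong) (auto simp: indicator_def space_pair_measure)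
      finally show ?thesis by simp
    qed
    have "S N = S N'"
    proof (rule measure_eqI_lessThan)
      show "emeasure (S N) {x<..} < \<infinity>" for x using S[OF N] by (simp add: less_top[symmetric])
      show "emeasure (S N) {x<..} = emeasure (S N') {x<..}" for x using S[OF N] S[OF N's] main by simp
    qed (simp_all add: S_def)
    then show "emeasure N (A \<times> B) = emeasure N' (A \<times> B)" using S[OF N B] S[OF N's B] by simp
  qed
  then show thesis using k2 that unfolding N'_def by blast
qed

text \<open>The second coordinate is transported into the unit interval by an injective Borel code,
  the image measure is disintegrated there, and the kernel is pushed back along the decoder.\<close>

lemma coupling_kernel_exists:
  fixes Y :: "'y::euclidean_space set"
  assumes Y[measurable]: "Y \<in> sets borel" and P: "prob_space P"
    and Q: "sets Q = sets (restrict_space lborel Y)" and \<pi>: "\<pi> \<in> couplings P Q"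
  shows "\<exists>\<kappa>. cond_kernel P Q \<pi> \<kappa>"
proof -
  have s\<pi>[measurable_cong]: "sets \<pi> = sets (P \<Otimes>\<^sub>M Q)" and pr: "prob_space \<pi>" and marg:
      "distr \<pi> P fst = P"
    using \<pi> by (auto simp: couplings_def)
  interpret P: prob_space P by fact
  interpret \<pi>: prob_space \<pi> by fact
  have spQ: "space Q = Y" using sets_eq_imp_space_eq[OF Q] by (simp add: space_restrict_space)
  have sp\<pi>: "space \<pi> = space P \<times> Y"
    using sets_eq_imp_space_eq[OF s\<pi>] spQ by (simp add: space_pair_measure)
  obtain y0 where y0: "y0 \<in> Y"
    using \<pi>.not_empty unfolding sp\<pi> by blast
  obtain \<phi> :: "'y \<Rightarrow> real" and \<psi> where [measurable]: "\<phi> \<in> borel_measurable borel"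
    and \<psi>[measurable]: "\<psi> \<in> borel_measurable borel"
    and \<phi>01: "\<And>y. \<phi> y \<in> {0..1}" and inv: "\<And>y. \<psi> (\<phi> y) = y"
    by (rule unit_interval_code) blast
  have \<phi>Q[measurable]: "\<phi> \<in> borel_measurable Q"
    unfolding measurable_cong_sets[OF Q refl] by (intro measurable_restrict_space1) simp
  \<comment> \<open>The pushed-back kernel must live on \<open>Y\<close> for every real argument.
    Reals that decode outside \<open>Y\<close> are sent to \<open>y0\<close>, while codes of points
    of \<open>Y\<close> are still decoded correctly.\<close>
  define \<psi>' where "\<psi>' r = (if \<psi> r \<in> Y then \<psi> r else y0)" for r
  have \<psi>'Q[measurable]: "\<psi>' \<in> borel \<rightarrow>\<^sub>M Q"
    unfolding measurable_cong_sets[OF refl Q] \<psi>'_def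
    by (intro measurable_restrict_space2) (use y0 in \<open>auto simp: \<psi>'_def\<close>)
  define \<pi>' where "\<pi>' = distr \<pi> (P \<Otimes>\<^sub>M borel) (\<lambda>z. (fst z, \<phi> (snd z)))"
  have marg': "distr \<pi>' P fst = P"
    unfolding \<pi>'_def using marg by (subst distr_distr) (auto simp: comp_def)
  have supp': "AE z in \<pi>'. snd z \<in> {0..1}"
    unfolding \<pi>'_def using \<phi>01 by (subst AE_distr_iff) auto
  have sets': "sets \<pi>' = sets (P \<Otimes>\<^sub>M borel)" by (simp add: \<pi>'_def)
  obtain \<kappa> where k: "\<kappa> \<in> P \<rightarrow>\<^sub>M prob_algebra borel"
    and \<pi>'_eq: "\<pi>' = P \<bind> (\<lambda>x. distr (\<kappa> x) (P \<Otimes>\<^sub>M borel) (\<lambda>y. (x, y)))"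
    by (rule unit_interval_disintegration[OF P sets' marg' supp'])
  have k'[measurable]: "\<kappa> \<in> P \<rightarrow>\<^sub>M subprob_algebra borel"
    using k by (rule measurable_prob_algebraD)
  have [measurable]: "(\<lambda>x. distr (\<kappa> x) (P \<Otimes>\<^sub>M borel) (\<lambda>y. (x, y))) \<in> P
      \<rightarrow>\<^sub>M subprob_algebra (P \<Otimes>\<^sub>M borel)"
    by (rule measurable_distr2[OF _ k']) measurable
  have "\<pi> = distr \<pi>' (P \<Otimes>\<^sub>M Q) (\<lambda>z. (fst z, \<psi>' (snd z)))"
  proof -
    have comp: "(\<lambda>z. (fst z, \<psi>' (snd z))) \<circ> (\<lambda>z. (fst z, \<phi> (snd z))) =
        (\<lambda>z. (fst z, \<psi>' (\<phi> (snd z))))"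
      by (simp add: comp_def)
    have f: "(\<lambda>z. (fst z, \<psi>' (snd z))) \<in> P \<Otimes>\<^sub>M borel \<rightarrow>\<^sub>M P
        \<Otimes>\<^sub>M Q" by measurable
    have g: "(\<lambda>z. (fst z, \<phi> (snd z))) \<in> \<pi> \<rightarrow>\<^sub>M P \<Otimes>\<^sub>M borel" by measurable
    have "distr \<pi>' (P \<Otimes>\<^sub>M Q) (\<lambda>z. (fst z, \<psi>' (snd z))) = distr \<pi> (P
        \<Otimes>\<^sub>M Q) (\<lambda>z. (fst z, \<psi>' (\<phi> (snd z))))"
      unfolding \<pi>'_def distr_distr[OF f g] comp ..
    also have "\<dots> = distr \<pi> \<pi> (\<lambda>z. z)"
    proof (rule distr_cong)
      fix z assume "z \<in> space \<pi>"
      then have "snd z \<in> Y" unfolding sp\<pi> by (rule mem_Times_iff[THEN iffD1, THEN conjunct2])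
      then show "(fst z, \<psi>' (\<phi> (snd z))) = z"
        by (simp add: \<psi>'_def inv)
    qed (simp_all add: s\<pi>)
    finally show ?thesis by simp
  qed
  also have "\<dots> = P \<bind> (\<lambda>x. distr (distr (\<kappa> x) (P \<Otimes>\<^sub>M borel) (\<lambda>y.
      (x, y))) (P \<Otimes>\<^sub>M Q) (\<lambda>z. (fst z, \<psi>' (snd z))))"
    unfolding \<pi>'_eq using P.not_empty by (subst distr_bind[where K = "P \<Otimes>\<^sub>M borel"]) auto
  also have "\<dots> = P \<bind> (\<lambda>x. distr (distr (\<kappa> x) Q \<psi>') (P \<Otimes>\<^sub>M Q)
      (\<lambda>y. (x, y)))"
  proof (rule bind_cong[OF refl])
    fix x assume x: "x \<in> space P"
    have S[measurable_cong]: "sets (\<kappa> x) = sets borel"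
      using measurable_space[OF k' x] by (simp add: space_subprob_algebra)
    show "distr (distr (\<kappa> x) (P \<Otimes>\<^sub>M borel) (\<lambda>y. (x, y))) (P \<Otimes>\<^sub>M Q)
        (\<lambda>z. (fst z, \<psi>' (snd z)))
      = distr (distr (\<kappa> x) Q \<psi>') (P \<Otimes>\<^sub>M Q) (\<lambda>y. (x, y))"
      using x by (subst (1 2) distr_distr) (auto simp: comp_def)
  qed
  finally have "\<pi> = P \<bind> (\<lambda>x. distr (distr (\<kappa> x) Q \<psi>') (P \<Otimes>\<^sub>M Q)
      (\<lambda>y. (x, y)))" .
  moreover have "(\<lambda>x. distr (\<kappa> x) Q \<psi>') \<in> P \<rightarrow>\<^sub>M prob_algebra Q"
    using measurable_compose[OF k measurable_distr_prob_space[OF \<psi>'Q]] by simp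
  ultimately show ?thesis unfolding cond_kernel_def by blast
qed

section \<open>Almost everywhere uniqueness of disintegrations\<close>

lemma borel_countable_Int_stable_generator:
  obtains E :: "'y::second_countable_topology set set"
  where "countable E" "Int_stable E" "UNIV \<in> E" "sets borel = sigma_sets UNIV E"
proof -
  obtain B :: "'y set set" where B: "countable B" "topological_basis B"
    using ex_countable_basis by blast
  define E where "E = Inter ` {F. finite F \<and> F \<subseteq> B}"
  have cE: "countable E"
    unfolding E_def using B(1) by (intro countable_image countable_Collect_finite_subset)
  have "Inter {b} \<in> E" if "b \<in> B" for b
    unfolding E_def using that by (intro imageI) auto
  then have BE: "B \<subseteq> E" by auto
  have "open e" if "e \<in> E" for e
    using that topological_basis_open[OF B(2)] by (auto simp: E_def intro!: open_Inter)
  then have "topological_basis E"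
    using B(2) BE unfolding topological_basis_def by (meson subset_trans)
  then have "(borel :: 'y measure) = sigma UNIV E" by (intro borel_eq_countable_basis cE)
  then have "sets (borel :: 'y measure) = sigma_sets UNIV E"
    by (metis sets_measure_of subset_UNIV Pow_UNIV)
  moreover have "Int_stable E"
  proof (rule Int_stableI)
    fix a b assume "a \<in> E" "b \<in> E"
    then obtain F G where FG: "finite F" "F \<subseteq> B" "a = Inter F" "finite G" "G \<subseteq> B" "b = Inter G"
      by (auto simp: E_def)
    then have "a \<inter> b = Inter (F \<union> G)" "finite (F \<union> G)" "F \<union> G \<subseteq> B" by auto
    then show "a \<inter> b \<in> E" unfolding E_def by blast
  qed
  moreover have "Inter {} \<in> E" unfolding E_def by (intro imageI) auto
  ultimately show thesis using that cE by simp
qed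

text \<open>Testing against all \<open>A\<close> gives agreement on a fixed \<open>B\<close> outside
  a null set depending on \<open>B\<close>. A countable generator closed under intersection allows
  these null sets to be united, and agreement on it determines the conditional measures.\<close>

lemma kernel_AE_eqI:
  fixes Y :: "'y::euclidean_space set"
  assumes Y[measurable]: "Y \<in> sets borel" and P: "prob_space P"
    and Q: "sets Q = sets (restrict_space lborel Y)"
    and k1: "\<And>x. x \<in> space P \<Longrightarrow> prob_space (\<kappa> x) \<and> sets (\<kappa> x) = sets Q"
    and k2: "\<And>x. x \<in> space P \<Longrightarrow> prob_space (\<eta> x) \<and> sets (\<eta> x) = sets Q"
    and m: "\<And>B. B \<in> sets Q \<Longrightarrow> (\<lambda>x. emeasure (\<kappa> x) B) \<in> borel_measurable P"
      "\<And>B. B \<in> sets Q \<Longrightarrow> (\<lambda>x. emeasure (\<eta> x) B) \<in> borel_measurable P"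
    and eq: "\<And>A B. A \<in> sets P \<Longrightarrow> B \<in> sets Q \<Longrightarrow>
      (\<integral>\<^sup>+x. emeasure (\<kappa> x) B * indicator A x \<partial>P) = (\<integral>\<^sup>+x.
          emeasure (\<eta> x) B * indicator A x \<partial>P)"
  shows "AE x in P. \<kappa> x = \<eta> x"
proof -
  interpret P: prob_space P by fact
  have spQ: "space Q = Y" using sets_eq_imp_space_eq[OF Q] by (simp add: space_restrict_space)
  obtain E :: "'y set set" where E: "countable E" "Int_stable E" "UNIV \<in> E" "sets borel = sigma_sets UNIV E"
    by (rule borel_countable_Int_stable_generator)
  have EQ: "e \<inter> Y \<in> sets Q" if "e \<in> sets borel" for e
    unfolding Q using that by (auto simp: sets_restrict_space)
  have fin: "(\<integral>\<^sup>+x. emeasure (\<kappa> x) B \<partial>P) < \<infinity>" "(\<integral>\<^sup>+x.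
      emeasure (\<eta> x) B \<partial>P) < \<infinity>" for B
  proof -
    have "(\<integral>\<^sup>+x. emeasure (\<kappa> x) B \<partial>P) \<le> (\<integral>\<^sup>+x. 1 \<partial>P)"
        "(\<integral>\<^sup>+x. emeasure (\<eta> x) B \<partial>P) \<le> (\<integral>\<^sup>+x. 1 \<partial>P)"
      using k1 k2 by (intro nn_integral_mono prob_space.measure_le_1; blast)+
    then show "(\<integral>\<^sup>+x. emeasure (\<kappa> x) B \<partial>P) < \<infinity>" "(\<integral>\<^sup>+x.
        emeasure (\<eta> x) B \<partial>P) < \<infinity>"
      by (auto simp: P.emeasure_space_1 order_le_less_trans)
  qed
  have AEq: "AE x in P. emeasure (\<kappa> x) B = emeasure (\<eta> x) B" if "B \<in> sets Q" for B
  proof -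
    have "AE x in P. emeasure (\<kappa> x) B \<le> emeasure (\<eta> x) B"
      by (rule AE_le_of_nn_integral_le[OF m(1)[OF that] m(2)[OF that] fin(1)]) (use eq that in simp)
    moreover have "AE x in P. emeasure (\<eta> x) B \<le> emeasure (\<kappa> x) B"
      by (rule AE_le_of_nn_integral_le[OF m(2)[OF that] m(1)[OF that] fin(2)]) (use eq that in simp)
    ultimately show ?thesis by eventually_elim simp
  qed
  have Eb: "e \<in> sets borel" if "e \<in> E" for e using that unfolding E(4) by (rule sigma_sets.Basic)
  have "AE x in P. \<forall>e\<in>E. emeasure (\<kappa> x) (e \<inter> Y) = emeasure (\<eta> x) (e \<inter> Y)"
    unfolding AE_ball_countable[OF E(1)] using AEq EQ Eb by blast
  with AE_space show ?thesis
  proof eventually_elim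
    case (elim x)
    interpret k: prob_space "\<kappa> x" using k1 elim by simp
    have s: "sets (\<kappa> x) = sets Q" "sets (\<eta> x) = sets Q" using k1 k2 elim by auto
    \<comment> \<open>The generator consists of subsets of the whole space, whereas the kernels live
      on \<open>Y\<close>; they are compared after a push-forward along the inclusion.\<close>
    have D: "emeasure (distr M borel (\<lambda>y. y)) e = emeasure M (e \<inter> Y)"
      if M: "sets M = sets Q" and e: "e \<in> sets borel" for M e
    proof -
      have "(\<lambda>y. y) \<in> M \<rightarrow>\<^sub>M borel"
        unfolding measurable_cong_sets[OF M refl] measurable_cong_sets[OF Q refl]
        by (intro measurable_restrict_space1) simp
      then show ?thesis using e sets_eq_imp_space_eq[OF M] spQ by (simp add: emeasure_distr vimage_def Int_def)
    qed
    have "distr (\<kappa> x) borel (\<lambda>y. y) = distr (\<eta> x) borel (\<lambda>y. y)"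
    proof (rule measure_eqI_generator_eq[OF E(2), where \<Omega> = UNIV and A = "\<lambda>_. UNIV"])
      show "emeasure (distr (\<kappa> x) borel (\<lambda>y. y)) e = emeasure (distr (\<eta> x) borel (\<lambda>y. y)) e"
        if "e \<in> E" for e using that elim Eb by (simp add: D s)
      show "emeasure (distr (\<kappa> x) borel (\<lambda>y. y)) UNIV \<noteq> \<infinity>"
        by (simp add: D s)
    qed (use E in auto)
    show ?case
    proof (rule measure_eqI)
      fix A assume "A \<in> sets (\<kappa> x)"
      then have "A \<in> (\<inter>) Y ` sets borel" using s Q by (simp add: sets_restrict_space)
      then have A: "A \<in> sets borel" "A \<inter> Y = A" by auto
      have "emeasure (distr (\<kappa> x) borel (\<lambda>y. y)) A = emeasure (distr (\<eta> x) borel (\<lambda>y. y)) A"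
        using \<open>distr (\<kappa> x) borel (\<lambda>y. y) = distr (\<eta> x) borel (\<lambda>y. y)\<close> by simp
      then show "emeasure (\<kappa> x) A = emeasure (\<eta> x) A" using A by (simp add: D s)
    qed (simp add: s)
  qed
qed

section \<open>Integration against a disintegration\<close>

lemma cond_kernel_space:
  assumes "cond_kernel P Q \<pi> \<kappa>" "x \<in> space P"
  shows "prob_space (\<kappa> x)" "sets (\<kappa> x) = sets Q"
proof -
  have "\<kappa> x \<in> space (prob_algebra Q)"
    using assms unfolding cond_kernel_def by (blast intro: measurable_space)
  then show "prob_space (\<kappa> x)" "sets (\<kappa> x) = sets Q" by (simp_all add: space_prob_algebra)
qed

lemma cond_kernel_rectangle:
  assumes "prob_space P" "cond_kernel P Q \<pi> \<kappa>" "A \<in> sets P" "B \<in> sets Q"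
  shows "emeasure \<pi> (A \<times> B) = (\<integral>\<^sup>+x. emeasure (\<kappa> x) B * indicator A x \<partial>P)"
proof -
  have "\<kappa> \<in> P \<rightarrow>\<^sub>M subprob_algebra Q" "\<pi> = P \<bind> (\<lambda>x. distr (\<kappa>
      x) (P \<Otimes>\<^sub>M Q) (\<lambda>y. (x, y)))"
    using assms(2) by (auto simp: cond_kernel_def intro: measurable_prob_algebraD)
  then show ?thesis
    using emeasure_bind_Pair[OF prob_space.not_empty[OF assms(1)] _ assms(3,4)] by simp
qed

text \<open>The iterated integral formula for \<open>bind\<close> concerns nonnegative integrands,
  so \<open>h\<close> is shifted by its bound \<open>B\<close> and the shift is cancelled at the
  end. Cancelling under \<open>ennreal\<close> needs both integrals to be at least
  \<open>- B\<close>.\<close>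

lemma cond_kernel_integral:
  fixes h :: "'x \<times> 'y \<Rightarrow> real"
  assumes P: "prob_space P" and \<pi>: "prob_space \<pi>" and k: "cond_kernel P Q \<pi> \<kappa>"
    and h[measurable]: "h \<in> borel_measurable (P \<Otimes>\<^sub>M Q)"
    and B: "\<And>z. z \<in> space (P \<Otimes>\<^sub>M Q) \<Longrightarrow> \<bar>h z\<bar> \<le> B"
  shows "(\<lambda>x. \<integral>y. h (x, y) \<partial>\<kappa> x) \<in> borel_measurable P"
    "(\<integral>z. h z \<partial>\<pi>) = (\<integral>x. \<integral>y. h (x, y) \<partial>\<kappa> x \<partial>P)"
    "\<And>x. x \<in> space P \<Longrightarrow> \<bar>\<integral>y. h (x, y) \<partial>\<kappa> x\<bar> \<le> B"
proof -
  interpret P: prob_space P by fact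
  interpret \<pi>: prob_space \<pi> by fact
  have k'[measurable]: "\<kappa> \<in> P \<rightarrow>\<^sub>M subprob_algebra Q"
    using k unfolding cond_kernel_def by (auto intro: measurable_prob_algebraD)
  have D[measurable]: "(\<lambda>x. distr (\<kappa> x) (P \<Otimes>\<^sub>M Q) (\<lambda>y. (x, y))) \<in> P
      \<rightarrow>\<^sub>M subprob_algebra (P \<Otimes>\<^sub>M Q)"
    by (rule measurable_distr2[OF _ k']) measurable
  have \<pi>_eq: "\<pi> = P \<bind> (\<lambda>x. distr (\<kappa> x) (P \<Otimes>\<^sub>M Q) (\<lambda>y. (x, y)))"
      using k by (simp add: cond_kernel_def)
  have s\<pi>[measurable_cong]: "sets \<pi> = sets (P \<Otimes>\<^sub>M Q)"
    unfolding \<pi>_eq using P.not_empty by (subst sets_bind) auto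
  have hx: "(\<lambda>y. h (x, y)) \<in> borel_measurable (\<kappa> x)" if "x \<in> space P" for x
    unfolding measurable_cong_sets[OF cond_kernel_space(2)[OF k that] refl] using that by measurable
  have bx: "\<bar>h (x, y)\<bar> \<le> B" if "x \<in> space P" "y \<in> space (\<kappa> x)" for x y
    using that B sets_eq_imp_space_eq[OF cond_kernel_space(2)[OF k that(1)]] by (auto simp: space_pair_measure)
  have int: "integrable (\<kappa> x) (\<lambda>y. h (x, y))" if "x \<in> space P" for x
    using hx[OF that] bx[OF that] cond_kernel_space(1)[OF k that]
    by (intro finite_measure.integrable_const_bound[where B = B] AE_I2) (auto simp: prob_space_def)
  have "(\<lambda>x. integral\<^sup>L (distr (\<kappa> x) (P \<Otimes>\<^sub>M Q) (\<lambda>y. (x, y))) h) \<in>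
      borel_measurable P" by measurable
  moreover have "integral\<^sup>L (distr (\<kappa> x) (P \<Otimes>\<^sub>M Q) (\<lambda>y. (x, y))) h =
      (\<integral>y. h (x, y) \<partial>\<kappa> x)" if "x \<in> space P" for x
  proof -
    note [measurable_cong] = cond_kernel_space(2)[OF k that]
    show ?thesis using that by (intro integral_distr) measurable
  qed
  ultimately show m: "(\<lambda>x. \<integral>y. h (x, y) \<partial>\<kappa> x) \<in> borel_measurable P"
    by (rule measurable_cong[THEN iffD1, rotated])
  show b: "\<bar>\<integral>y. h (x, y) \<partial>\<kappa> x\<bar> \<le> B" if x: "x \<in> space P" for x
  proof -
    interpret k: prob_space "\<kappa> x" using cond_kernel_space(1)[OF k x] .
    have "\<bar>\<integral>y. h (x, y) \<partial>\<kappa> x\<bar> \<le> (\<integral>y. \<bar>h (x, y)\<bar>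
        \<partial>\<kappa> x)" by (rule integral_abs_bound)
    also have "\<dots> \<le> B" using int[OF x] bx[OF x] by (intro k.integral_le_const AE_I2) auto
    finally show ?thesis .
  qed
  have ih: "integrable \<pi> h" using B sets_eq_imp_space_eq[OF s\<pi>]
    by (intro \<pi>.integrable_const_bound[where B = B] AE_I2) auto
  have im: "integrable P (\<lambda>x. \<integral>y. h (x, y) \<partial>\<kappa> x)"
    using m b by (intro P.integrable_const_bound[where B = B] AE_I2) auto
  have nonneg: "0 \<le> t + B" if "\<bar>t\<bar> \<le> B" for t using that by linarith
  have "ennreal ((\<integral>z. h z \<partial>\<pi>) + B) = ennreal (\<integral>z. h z + B \<partial>\<pi>)"
    using ih by (simp add: \<pi>.prob_space)
  also have "\<dots> = (\<integral>\<^sup>+z. ennreal (h z + B) \<partial>\<pi>)"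
    using B nonneg sets_eq_imp_space_eq[OF s\<pi>] ih
    by (intro nn_integral_eq_integral[symmetric] AE_I2) auto
  also have "\<dots> = (\<integral>\<^sup>+x. \<integral>\<^sup>+z. ennreal (h z + B) \<partial>distr (\<kappa> x)
      (P \<Otimes>\<^sub>M Q) (\<lambda>y. (x, y)) \<partial>P)"
    unfolding \<pi>_eq by (rule nn_integral_bind[OF _ D]) measurable
  also have "\<dots> = (\<integral>\<^sup>+x. ennreal ((\<integral>y. h (x, y) \<partial>\<kappa> x) + B) \<partial>P)"
  proof (intro nn_integral_cong)
    fix x assume x: "x \<in> space P"
    interpret k: prob_space "\<kappa> x" using cond_kernel_space(1)[OF k x] .
    note [measurable_cong] = cond_kernel_space(2)[OF k x]
    have "(\<integral>\<^sup>+z. ennreal (h z + B) \<partial>distr (\<kappa> x) (P \<Otimes>\<^sub>M Q)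
        (\<lambda>y. (x, y))) = (\<integral>\<^sup>+y. ennreal (h (x, y) + B) \<partial>\<kappa> x)"
      using x by (intro nn_integral_distr) measurable
    also have "\<dots> = ennreal (\<integral>y. h (x, y) + B \<partial>\<kappa> x)"
      using int[OF x] bx[OF x] nonneg by (intro nn_integral_eq_integral AE_I2) auto
    finally show "(\<integral>\<^sup>+z. ennreal (h z + B) \<partial>distr (\<kappa> x) (P \<Otimes>\<^sub>M Q)
        (\<lambda>y. (x, y)))
      = ennreal ((\<integral>y. h (x, y) \<partial>\<kappa> x) + B)" using int[OF x] by (simp add: k.prob_space)
  qed
  also have "\<dots> = ennreal (\<integral>x. (\<integral>y. h (x, y) \<partial>\<kappa> x) + B \<partial>P)"
    using im b nonneg by (intro nn_integral_eq_integral AE_I2) auto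
  also have "(\<integral>x. (\<integral>y. h (x, y) \<partial>\<kappa> x) + B \<partial>P) = (\<integral>x.
      (\<integral>y. h (x, y) \<partial>\<kappa> x) \<partial>P) + B"
    using im by (simp add: P.prob_space)
  finally have e: "ennreal ((\<integral>z. h z \<partial>\<pi>) + B) = ennreal ((\<integral>x. (\<integral>y. h
      (x, y) \<partial>\<kappa> x) \<partial>P) + B)" .
  have lb: "- B \<le> t" if "\<bar>t\<bar> \<le> B" for t using that by linarith
  have "- B \<le> (\<integral>z. h z \<partial>\<pi>)"
    using B lb sets_eq_imp_space_eq[OF s\<pi>] by (intro \<pi>.integral_ge_const ih AE_I2) auto
  moreover have "- B \<le> (\<integral>x. (\<integral>y. h (x, y) \<partial>\<kappa> x) \<partial>P)"
    using b lb by (intro P.integral_ge_const im AE_I2) auto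
  ultimately show "(\<integral>z. h z \<partial>\<pi>) = (\<integral>x. \<integral>y. h (x, y) \<partial>\<kappa>
      x \<partial>P)" using e by simp
qed

subsection \<open>Gibbs' variational principle\<close>

lemma ereal_integral_cong_AE:
  "AE x in M. f x = g x \<Longrightarrow> ereal_integral M f = ereal_integral M g"
  unfolding ereal_integral_def
  by (intro arg_cong2[where f = "(-)"] arg_cong[where f = enn2ereal] nn_integral_cong_AE) auto

lemma ereal_integral_ereal:
  assumes "integrable M h"
  shows "ereal_integral M (\<lambda>x. ereal (h x)) = ereal (\<integral>x. h x \<partial>M)"
proof -
  have fin: "(\<integral>\<^sup>+x. ennreal (h x) \<partial>M) < \<infinity>" "(\<integral>\<^sup>+x. ennreal (- h
      x) \<partial>M) < \<infinity>"
    using assms by (auto simp: real_integrable_def less_top)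
  have "enn2ereal a = ereal (enn2real a)" if "a < \<infinity>" for a
    using that by (cases a) auto
  then show ?thesis
    using fin real_lebesgue_integral_def[OF assms]
    by (simp add: ereal_integral_def e2ennreal_ereal)
qed

text \<open>The entropy of a kernel need not be measurable in \<open>x\<close>, but the Lebesgue integral of
  nonnegative functions is monotone for arbitrary functions.\<close>

lemma ereal_integral_le:
  assumes h: "integrable M h" and le: "\<And>x. x \<in> space M \<Longrightarrow> f x \<le> ereal (h x)"
  shows "ereal_integral M f \<le> ereal (\<integral>x. h x \<partial>M)"
proof -
  have mono: "enn2ereal p \<le> enn2ereal q" if "p \<le> q" for p q
    using that by (simp add: less_eq_ennreal.rep_eq)
  have "ereal_integral M f \<le> ereal_integral M (\<lambda>x. ereal (h x))"
    unfolding ereal_integral_def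
    using le by (intro ereal_minus_mono mono nn_integral_mono e2ennreal_mono)
      (auto simp del: uminus_ereal.simps)
  then show ?thesis using ereal_integral_ereal[OF h] by simp
qed

lemma finite_measure_restrict_compact:
  fixes Y :: "'y::euclidean_space set"
  assumes "compact Y"
  shows "finite_measure (restrict_space lborel Y)"
  using emeasure_bounded_finite[OF compact_imp_bounded[OF assms]] borel_compact[OF assms]
  by (intro finite_measureI) (simp add: emeasure_restrict_space space_restrict_space)

lemma measure_restrict_compact_pos:
  fixes Y :: "'y::euclidean_space set"
  assumes "compact Y" "emeasure lborel Y > 0"
  shows "measure (restrict_space lborel Y) Y > 0"
  using emeasure_bounded_finite[OF compact_imp_bounded[OF assms(1)]] assms(2) borel_compact[OF assms(1)]
  by (simp add: measure_def enn2real_positive_iff emeasure_restrict_space)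

lemma integral_exp_bounded:
  fixes Y :: "'y::euclidean_space set" and w :: "'y \<Rightarrow> real"
  defines "m \<equiv> restrict_space lborel Y"
  assumes Y: "compact Y" and Ypos: "emeasure lborel Y > 0"
    and w[measurable]: "w \<in> borel_measurable m" and wB: "\<And>y. y \<in> Y \<Longrightarrow> \<bar>w y\<bar> \<le> B"
  shows "integrable m (\<lambda>y. exp (w y))" "0 < (\<integral>y. exp (w y) \<partial>m)"
proof -
  interpret m: finite_measure m unfolding m_def by (rule finite_measure_restrict_compact[OF Y])
  have sp: "space m = Y" by (simp add: m_def space_restrict_space)
  show ie: "integrable m (\<lambda>y. exp (w y))"
    using wB sp by (intro m.integrable_const_bound[where B = "exp B"] AE_I2) (auto simp: abs_le_iff)
  have "0 < exp (- B) * measure m Y"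
    using measure_restrict_compact_pos[OF Y Ypos] by (simp add: m_def)
  also have "\<dots> = (\<integral>y. exp (- B) \<partial>m)" using sp by simp
  also have "\<dots> \<le> (\<integral>y. exp (w y) \<partial>m)"
    using wB sp ie by (intro integral_mono) (auto simp: abs_le_iff minus_le_iff)
  finally show "0 < (\<integral>y. exp (w y) \<partial>m)" .
qed

lemma diff_entropy_density:
  fixes Y :: "'y::euclidean_space set"
  defines "m \<equiv> restrict_space lborel Y"
  assumes Y: "compact Y"
    and g[measurable]: "g \<in> borel_measurable m" and g0: "\<And>y. y \<in> Y \<Longrightarrow> 0 \<le> g y"
    and int: "integrable m (\<lambda>y. g y * ln (g y))"
  shows "diff_entropy Y (density m (\<lambda>y. ennreal (g y))) = ereal (- (\<integral>y. g y * ln (g y) \<partial>m))"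
proof -
  interpret m: finite_measure m unfolding m_def by (rule finite_measure_restrict_compact[OF Y])
  let ?\<mu> = "density m (\<lambda>y. ennreal (g y))"
  have sp: "space m = Y" by (simp add: m_def space_restrict_space)
  have ac: "absolutely_continuous m ?\<mu>"
    by (rule absolutely_continuousI_density) simp
  have "AE y in m. ennreal (g y) = RN_deriv m ?\<mu> y"
    by (rule m.RN_deriv_unique) auto
  then have "AE y in ?\<mu>. ereal (- ln (enn2real (RN_deriv m ?\<mu> y))) = ereal (- ln (g y))"
    using AE_space unfolding AE_density[OF measurable_compose[OF g measurable_ennreal]]
    by eventually_elim (metis enn2real_ennreal g0 sp)
  then have "ereal_integral ?\<mu> (\<lambda>y. ereal (- ln (enn2real (RN_deriv m ?\<mu> y)))) = ereal_integral
      ?\<mu> (\<lambda>y. ereal (- ln (g y)))"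
    by (rule ereal_integral_cong_AE)
  also have "\<dots> = ereal (\<integral>y. - ln (g y) \<partial>?\<mu>)"
    using g0 int sp by (intro ereal_integral_ereal) (subst integrable_density, auto)
  also have "(\<integral>y. - ln (g y) \<partial>?\<mu>) = - (\<integral>y. g y * ln (g y) \<partial>m)"
    using g0 sp by (subst integral_density) auto
  finally show ?thesis using ac by (simp add: diff_entropy_def m_def)
qed

text \<open>Integrate the pointwise inequality \<open>r * (ln h - ln r) \<le> h - r\<close> for the density \<open>r\<close> of \<open>\<mu>\<close>
  and \<open>h = exp w / Z\<close>.\<close>

lemma diff_entropy_le:
  fixes Y :: "'y::euclidean_space set"
  defines "m \<equiv> restrict_space lborel Y"
  assumes Y: "compact Y" and Ypos: "emeasure lborel Y > 0" and \<mu>: "\<mu> \<in> probs Y"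
    and w[measurable]: "w \<in> borel_measurable m" and wB: "\<And>y. y \<in> Y \<Longrightarrow> \<bar>w y\<bar> \<le> B"
  shows "diff_entropy Y \<mu> \<le> ereal (ln (\<integral>y. exp (w y) \<partial>m) - (\<integral>y. w y \<partial>\<mu>))"
proof (cases "absolutely_continuous m \<mu>")
  case False
  then show ?thesis by (simp add: diff_entropy_def m_def)
next
  case ac: True
  interpret m: finite_measure m unfolding m_def by (rule finite_measure_restrict_compact[OF Y])
  interpret \<mu>: prob_space \<mu> using \<mu> by (simp add: probs_def)
  have sp: "space m = Y" by (simp add: m_def space_restrict_space)
  have s\<mu>[measurable_cong]: "sets \<mu> = sets m" using \<mu> by (simp add: probs_def m_def)
  define r where "r y = enn2real (RN_deriv m \<mu> y)" for y
  have r[measurable]: "r \<in> borel_measurable m" unfolding r_def by measurable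
  have r0: "0 \<le> r y" for y by (simp add: r_def)
  have "AE y in m. RN_deriv m \<mu> y \<noteq> \<infinity>"
    by (rule m.RN_deriv_finite[OF _ ac s\<mu>]) unfold_locales
  then have "density m (\<lambda>y. ennreal (r y)) = density m (RN_deriv m \<mu>)"
    by (intro density_cong) (auto simp: r_def ennreal_enn2real_if top_unique)
  then have \<mu>_eq: "\<mu> = density m (\<lambda>y. ennreal (r y))" using m.density_RN_deriv[OF ac s\<mu>] by simp
  have H: "diff_entropy Y \<mu> = ereal_integral \<mu> (\<lambda>y. ereal (- ln (r y)))"
    using ac by (simp add: diff_entropy_def m_def r_def)
  \<comment> \<open>Since \<open>- r * ln r \<le> 1\<close> and \<open>Y\<close> has finite volume,
    the positive part of the entropy integrand is always integrable. Entropy is therefore finite or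
    \<open>- \<infinity>\<close>, and the difference in \<open>ereal_integral\<close> is never of
    the form \<open>\<infinity> - \<infinity>\<close>.\<close>
  have neg: "(\<integral>\<^sup>+y. ennreal (- ln (r y)) \<partial>\<mu>) < \<infinity>"
  proof -
    have "(\<integral>\<^sup>+y. ennreal (- ln (r y)) \<partial>\<mu>) = (\<integral>\<^sup>+y. ennreal (r y) *
        ennreal (- ln (r y)) \<partial>m)"
      unfolding \<mu>_eq by (subst nn_integral_density) auto
    also have "\<dots> \<le> (\<integral>\<^sup>+y. 1 \<partial>m)"
    proof (intro nn_integral_mono)
      fix y
      have "r y * - ln (r y) \<le> 1"
      proof (cases "r y = 0")
        case False
        then have "0 < r y" using r0[of y] by simp
        then have "ln (inverse (r y)) \<le> inverse (r y)" by (intro ln_bound) simp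
        then have "r y * - ln (r y) \<le> r y * inverse (r y)"
          using \<open>0 < r y\<close> by (intro mult_left_mono) (auto simp: ln_inverse)
        then show ?thesis using False by simp
      qed simp
      then show "ennreal (r y) * ennreal (- ln (r y)) \<le> 1"
        using r0[of y] by (simp add: ennreal_mult'[symmetric] del: mult_minus_right)
    qed
    also have "\<dots> < \<infinity>" by (simp add: m.emeasure_eq_measure)
    finally show ?thesis .
  qed
  show ?thesis
  proof (cases "(\<integral>\<^sup>+y. ennreal (ln (r y)) \<partial>\<mu>) < \<infinity>")
    case False
    then have "(\<integral>\<^sup>+y. ennreal (ln (r y)) \<partial>\<mu>) = \<infinity>" by (simp add: less_top[symmetric])
    moreover obtain a where "(\<integral>\<^sup>+y. ennreal (- ln (r y)) \<partial>\<mu>) = ennreal a" "0 \<le> a"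
      using neg by (cases "(\<integral>\<^sup>+y. ennreal (- ln (r y)) \<partial>\<mu>)") auto
    ultimately have "diff_entropy Y \<mu> = - \<infinity>"
      unfolding H ereal_integral_def by (simp add: e2ennreal_ereal)
    then show ?thesis by simp
  next
    case True
    have il: "integrable \<mu> (\<lambda>y. ln (r y))"
      using True neg by (auto simp: real_integrable_def)
    then have irl: "integrable m (\<lambda>y. r y * ln (r y))"
      unfolding \<mu>_eq using r0 by (subst (asm) integrable_density) auto
    have iw: "integrable \<mu> w"
      using wB sp sets_eq_imp_space_eq[OF s\<mu>] by (intro \<mu>.integrable_const_bound[where B = B] AE_I2) auto
    then have irw: "integrable m (\<lambda>y. r y * w y)"
      unfolding \<mu>_eq using r0 by (subst (asm) integrable_density) auto
    have "integrable \<mu> (\<lambda>_. 1::real)" by simp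
    then have ir: "integrable m r"
      unfolding \<mu>_eq using r0 by (subst (asm) integrable_density) auto
    have rint: "(\<integral>y. r y \<partial>m) = 1"
    proof -
      have "(\<integral>y. 1 \<partial>\<mu>) = (\<integral>y. r y *\<^sub>R (1::real) \<partial>m)"
        unfolding \<mu>_eq using r0 by (subst integral_density) auto
      then show ?thesis using \<mu>.prob_space by simp
    qed
    have ie: "integrable m (\<lambda>y. exp (w y))" unfolding m_def
      by (rule integral_exp_bounded(1)[OF Y Ypos w[unfolded m_def] wB])
    define Z where "Z = (\<integral>y. exp (w y) \<partial>m)"
    have Z: "Z > 0" unfolding Z_def m_def
      by (rule integral_exp_bounded(2)[OF Y Ypos w[unfolded m_def] wB])
    have "(\<integral>y. r y * w y - r y * ln Z - r y * ln (r y) \<partial>m) \<le> (\<integral>y. exp (w y) / Z -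
        r y \<partial>m)"
    proof (intro integral_mono Bochner_Integration.integrable_diff integrable_mult_left irw irl ir)
      show "integrable m (\<lambda>y. exp (w y) / Z)" using ie by simp
      fix y
      show "r y * w y - r y * ln Z - r y * ln (r y) \<le> exp (w y) / Z - r y"
      proof (cases "r y = 0")
        case True then show ?thesis using Z by simp
      next
        case False
        then have rp: "0 < r y" using r0[of y] by simp
        have "ln (exp (w y) / Z / r y) \<le> exp (w y) / Z / r y - 1"
          using rp Z by (intro ln_le_minus_one) auto
        then have "w y - ln Z - ln (r y) \<le> exp (w y) / Z / r y - 1"
          using rp Z by (simp add: ln_div ln_mult)
        then have "r y * (w y - ln Z - ln (r y)) \<le> r y * (exp (w y) / Z / r y - 1)"
          using rp by (intro mult_left_mono) auto
        then show ?thesis using rp by (simp add: algebra_simps)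
      qed
    qed
    also have "(\<integral>y. exp (w y) / Z - r y \<partial>m) = 0"
      using ie ir Z by (simp add: rint Z_def)
    also have "(\<integral>y. r y * w y - r y * ln Z - r y * ln (r y) \<partial>m)
        = (\<integral>y. r y * w y \<partial>m) - ln Z - (\<integral>y. r y * ln (r y) \<partial>m)"
      using irw irl ir by (simp add: rint)
    also have "(\<integral>y. r y * w y \<partial>m) = (\<integral>y. w y \<partial>\<mu>)"
      unfolding \<mu>_eq using r0 by (subst integral_density) auto
    also have "(\<integral>y. r y * ln (r y) \<partial>m) = (\<integral>y. ln (r y) \<partial>\<mu>)"
      unfolding \<mu>_eq using r0 by (subst integral_density) auto
    finally have "- (\<integral>y. ln (r y) \<partial>\<mu>) \<le> ln Z - (\<integral>y. w y \<partial>\<mu>)" by simp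
    moreover have "diff_entropy Y \<mu> = ereal (- (\<integral>y. ln (r y) \<partial>\<mu>))"
      unfolding H using ereal_integral_ereal[of \<mu> "\<lambda>y. - ln (r y)"] il by simp
    ultimately show ?thesis by (simp add: Z_def)
  qed
qed

text \<open>The equality case of \<open>diff_entropy_le\<close>: the logarithm of the Gibbs density
  is exactly \<open>w y - ln Z\<close>, so its mean can be read off.\<close>

lemma diff_entropy_gibbs:
  fixes Y :: "'y::euclidean_space set"
  defines "m \<equiv> restrict_space lborel Y"
  assumes Y: "compact Y" and Ypos: "emeasure lborel Y > 0"
    and w[measurable]: "w \<in> borel_measurable m" and wB: "\<And>y. y \<in> Y \<Longrightarrow> \<bar>w y\<bar> \<le> B"
  defines "Z \<equiv> (\<integral>y. exp (w y) \<partial>m)"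
  defines "\<mu> \<equiv> density m (\<lambda>y. ennreal (exp (w y) / Z))"
  shows "Z > 0" "\<mu> \<in> probs Y" "diff_entropy Y \<mu> = ereal (ln Z - (\<integral>y. w y \<partial>\<mu>))"
proof -
  interpret m: finite_measure m unfolding m_def by (rule finite_measure_restrict_compact[OF Y])
  have sp: "space m = Y" by (simp add: m_def space_restrict_space)
  have ie: "integrable m (\<lambda>y. exp (w y))" unfolding m_def
    by (rule integral_exp_bounded(1)[OF Y Ypos w[unfolded m_def] wB])
  show Z: "Z > 0" unfolding Z_def m_def
    by (rule integral_exp_bounded(2)[OF Y Ypos w[unfolded m_def] wB])
  have "emeasure \<mu> (space \<mu>) = (\<integral>\<^sup>+y. ennreal (exp (w y) / Z) \<partial>m)"
    unfolding \<mu>_def by (subst emeasure_density) (auto intro!: nn_integral_cong)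
  also have "\<dots> = ennreal (\<integral>y. exp (w y) / Z \<partial>m)"
    using ie Z by (intro nn_integral_eq_integral) auto
  also have "\<dots> = 1" using Z by (simp add: Z_def)
  finally have ps: "prob_space \<mu>" by (rule prob_spaceI)
  interpret \<mu>: prob_space \<mu> by fact
  show "\<mu> \<in> probs Y" using ps by (simp add: probs_def \<mu>_def m_def)
  have eq: "exp (w y) / Z * ln (exp (w y) / Z) = exp (w y) / Z * (w y - ln Z)" for y
    using Z by (simp add: ln_div)
  have iw: "integrable \<mu> w"
    using wB sp by (intro \<mu>.integrable_const_bound[where B = B] AE_I2) (auto simp: \<mu>_def)
  then have "integrable \<mu> (\<lambda>y. w y - ln Z)" by simp
  then have i: "integrable m (\<lambda>y. exp (w y) / Z * (w y - ln Z))"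
    unfolding \<mu>_def using Z by (subst (asm) integrable_density) auto
  have "diff_entropy Y \<mu> = ereal (- (\<integral>y. exp (w y) / Z * ln (exp (w y) / Z) \<partial>m))"
    unfolding \<mu>_def m_def
    by (rule diff_entropy_density[OF Y]) (use i[folded eq] Z in \<open>simp_all add: m_def[symmetric]\<close>)
  also have "(\<integral>y. exp (w y) / Z * ln (exp (w y) / Z) \<partial>m) = (\<integral>y. w y - ln Z \<partial>\<mu>)"
    unfolding eq \<mu>_def using Z by (subst integral_density) auto
  also have "\<dots> = (\<integral>y. w y \<partial>\<mu>) - ln Z" using iw by (simp add: \<mu>.prob_space)
  finally show "diff_entropy Y \<mu> = ereal (ln Z - (\<integral>y. w y \<partial>\<mu>))" by simp
qed

lemma compact_continuous_bounded_measurable: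
  fixes Y :: "'y::euclidean_space set" and f :: "'y \<Rightarrow> real"
  assumes Y: "compact Y" and f: "continuous_on Y f"
  obtains B where "\<And>y. y \<in> Y \<Longrightarrow> \<bar>f y\<bar> \<le> B" "f \<in> borel_measurable
      (restrict_space lborel Y)"
proof -
  have "bounded (f ` Y)" using compact_imp_bounded[OF compact_continuous_image[OF f Y]] .
  then obtain B where "\<And>y. y \<in> Y \<Longrightarrow> \<bar>f y\<bar> \<le> B" by (auto simp: bounded_iff)
  moreover have "f \<in> borel_measurable (restrict_space borel Y)"
    by (rule borel_measurable_continuous_on_restrict[OF f])
  then have "f \<in> borel_measurable (restrict_space lborel Y)"
    by (simp cong: measurable_cong_sets add: sets_restrict_space_cong[OF sets_lborel])
  ultimately show thesis using that by blast
qed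

text \<open>Gibbs' principle for \<open>w y = (f y - c x y) / \<epsilon>\<close>, multiplied by
  \<open>\<epsilon>\<close>. The inequality bounds every member of the infimum from below, and the
  Gibbs measure attains the bound.\<close>

lemma ctrans_eq:
  fixes Y :: "'y::euclidean_space set"
  assumes Y: "compact Y" and Ypos: "emeasure lborel Y > 0" and \<epsilon>: "\<epsilon> > 0"
    and f: "continuous_on Y f" and c: "continuous_on Y (c x)"
  shows "ctrans c \<epsilon> Y f x = ereal (- \<epsilon> * ln (\<integral>y. exp ((f y - c x y) / \<epsilon>)
      \<partial>restrict_space lborel Y))"
proof -
  define m where "m = restrict_space lborel Y"
  define w where "w y = (f y - c x y) / \<epsilon>" for y
  have "continuous_on Y w" unfolding w_def by (intro continuous_intros f c) (use \<epsilon> in auto)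
  from compact_continuous_bounded_measurable[OF Y this]
  obtain B where wB: "\<And>y. y \<in> Y \<Longrightarrow> \<bar>w y\<bar> \<le> B" and wm: "w \<in>
      borel_measurable m" unfolding m_def by blast
  obtain Bf where fB: "\<And>y. y \<in> Y \<Longrightarrow> \<bar>f y\<bar> \<le> Bf" and fm: "f \<in> borel_measurable m"
    using compact_continuous_bounded_measurable[OF Y f] unfolding m_def by blast
  obtain Bc where cB: "\<And>y. y \<in> Y \<Longrightarrow> \<bar>c x y\<bar> \<le> Bc" and cm: "c x \<in>
      borel_measurable m"
    using compact_continuous_bounded_measurable[OF Y c] unfolding m_def by blast
  define Z where "Z = (\<integral>y. exp (w y) \<partial>m)"
  have W: "\<epsilon> * (\<integral>y. w y \<partial>\<mu>) = (\<integral>y. f y \<partial>\<mu>) - (\<integral>y.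
      c x y \<partial>\<mu>)" if \<mu>: "\<mu> \<in> probs Y" for \<mu>
  proof -
    interpret \<mu>: prob_space \<mu> using \<mu> by (simp add: probs_def)
    have s\<mu>[measurable_cong]: "sets \<mu> = sets m" using \<mu> by (simp add: probs_def m_def)
    have sp: "space \<mu> = Y" using sets_eq_imp_space_eq[OF s\<mu>] by (simp add: m_def space_restrict_space)
    have "integrable \<mu> f" using fm fB sp by (intro \<mu>.integrable_const_bound[where B = Bf] AE_I2) auto
    moreover have "integrable \<mu> (c x)" using cm cB sp by (intro \<mu>.integrable_const_bound[where B = Bc] AE_I2) auto
    ultimately show ?thesis unfolding w_def using \<epsilon> by simp
  qed
  have "ctrans c \<epsilon> Y f x = ereal (- \<epsilon> * ln Z)"
    unfolding ctrans_def
  proof (rule antisym)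
    define \<mu> where "\<mu> = density m (\<lambda>y. ennreal (exp (w y) / Z))"
    have G: "\<mu> \<in> probs Y" "diff_entropy Y \<mu> = ereal (ln Z - (\<integral>y. w y \<partial>\<mu>))"
      using diff_entropy_gibbs(2,3)[OF Y Ypos wm[unfolded m_def] wB] by (simp_all add: \<mu>_def Z_def m_def)
    have "(INF \<mu> \<in> probs Y. ereal (\<integral>y. c x y \<partial>\<mu>) - ereal \<epsilon> * diff_entropy
        Y \<mu> - ereal (\<integral>y. f y \<partial>\<mu>))
      \<le> ereal (\<integral>y. c x y \<partial>\<mu>) - ereal \<epsilon> * diff_entropy Y \<mu> - ereal
          (\<integral>y. f y \<partial>\<mu>)"
      by (rule INF_lower[OF G(1)])
    also have "\<dots> = ereal (- \<epsilon> * ln Z)"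
      using W[OF G(1)] by (simp add: G(2) algebra_simps)
    finally show "(INF \<mu> \<in> probs Y. ereal (\<integral>y. c x y \<partial>\<mu>) - ereal \<epsilon> *
        diff_entropy Y \<mu> - ereal (\<integral>y. f y \<partial>\<mu>))
      \<le> ereal (- \<epsilon> * ln Z)" .
    show "ereal (- \<epsilon> * ln Z) \<le> (INF \<mu> \<in> probs Y. ereal (\<integral>y. c x y \<partial>\<mu>)
        - ereal \<epsilon> * diff_entropy Y \<mu> - ereal (\<integral>y. f y \<partial>\<mu>))"
    proof (rule INF_greatest)
      fix \<mu> assume \<mu>: "\<mu> \<in> probs Y"
      have "diff_entropy Y \<mu> \<le> ereal (ln Z - (\<integral>y. w y \<partial>\<mu>))"
        using diff_entropy_le[OF Y Ypos \<mu> wm[unfolded m_def] wB] by (simp add: Z_def m_def)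
      then have "ereal \<epsilon> * diff_entropy Y \<mu> \<le> ereal (\<epsilon> * (ln Z - (\<integral>y. w y
          \<partial>\<mu>)))"
        using ereal_mult_left_mono[of _ "ereal (ln Z - (\<integral>y. w y \<partial>\<mu>))" "ereal \<epsilon>"]
            \<epsilon> by simp
      then show "ereal (- \<epsilon> * ln Z) \<le> ereal (\<integral>y. c x y \<partial>\<mu>) - ereal \<epsilon>
          * diff_entropy Y \<mu> - ereal (\<integral>y. f y \<partial>\<mu>)"
        using W[OF \<mu>] by (cases "ereal \<epsilon> * diff_entropy Y \<mu>") (auto simp: algebra_simps)
    qed
  qed
  then show ?thesis by (simp add: Z_def m_def w_def)
qed

subsection \<open>Gibbs couplings with a fixed first marginal\<close>

text \<open>In the application \<open>C\<close> and \<open>\<phi>\<close> are the cost and the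
  potential divided by \<open>\<epsilon>\<close>, so the regularisation parameter disappears from
  this part and the next.\<close>

definition partition_fun :: "'y::euclidean_space set \<Rightarrow> ('x \<Rightarrow> 'y \<Rightarrow> real)
    \<Rightarrow> ('y \<Rightarrow> real) \<Rightarrow> 'x \<Rightarrow> real" where
  "partition_fun Y C \<phi> x = (\<integral>y. exp (\<phi> y - C x y) \<partial>restrict_space lborel Y)"

definition log_partition :: "'x measure \<Rightarrow> 'y::euclidean_space set \<Rightarrow> ('x \<Rightarrow> 'y
    \<Rightarrow> real) \<Rightarrow> ('y \<Rightarrow> real) \<Rightarrow> real" where
  "log_partition P Y C \<phi> = (\<integral>x. ln (partition_fun Y C \<phi> x) \<partial>P)"

text \<open>The density of the second marginal of the Gibbs coupling with potential \<open>\<phi>\<close> is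
  \<open>exp \<phi> * marginal_factor P Y C \<phi>\<close>.\<close>

definition marginal_factor :: "'x measure \<Rightarrow> 'y::euclidean_space set \<Rightarrow> ('x \<Rightarrow> 'y
    \<Rightarrow> real) \<Rightarrow> ('y \<Rightarrow> real) \<Rightarrow> 'y \<Rightarrow> real" where
  "marginal_factor P Y C \<phi> y = (\<integral>x. exp (- C x y) / partition_fun Y C \<phi> x \<partial>P)"

text \<open>What remains of compactness of the source and continuity of the cost: a uniform bound
  and a modulus of continuity in \<open>y\<close> that is uniform in \<open>x\<close>. The source
  itself is reduced to a probability space.\<close>

locale gibbs_cost = P: prob_space P for P :: "'x measure" +
  fixes Y :: "'y::euclidean_space set" and C :: "'x \<Rightarrow> 'y \<Rightarrow> real" and B :: real
  assumes Y_compact: "compact Y" and Y_pos: "emeasure lborel Y > 0"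
    and C_meas: "case_prod C \<in> borel_measurable (P \<Otimes>\<^sub>M restrict_space lborel Y)"
    and C_bound: "x \<in> space P \<Longrightarrow> y \<in> Y \<Longrightarrow> \<bar>C x y\<bar> \<le> B"
    and C_equicont: "e > 0 \<Longrightarrow> \<exists>d>0. \<forall>x\<in>space P. \<forall>y\<in>Y.
        \<forall>y'\<in>Y. dist y y' < d \<longrightarrow> \<bar>C x y - C x y'\<bar> \<le> e"
begin

abbreviation "m \<equiv> restrict_space lborel Y"
abbreviation "Z \<equiv> partition_fun Y C"
abbreviation "a \<equiv> marginal_factor P Y C"
abbreviation "V \<equiv> measure m Y"

sublocale m: finite_measure m
  by (rule finite_measure_restrict_compact[OF Y_compact])

sublocale pair_sigma_finite P m ..

lemma space_m: "space m = Y" by (simp add: space_restrict_space)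

lemma V_pos: "V > 0"
  by (rule measure_restrict_compact_pos[OF Y_compact Y_pos])

lemma finite_pair: "finite_measure (P \<Otimes>\<^sub>M m)"
  by (rule finite_measure_pair_measure) unfold_locales

lemma C_section[measurable]: "x \<in> space P \<Longrightarrow> C x \<in> borel_measurable m"
  using measurable_compose[OF measurable_Pair1' C_meas] by simp

lemma C_section2[measurable]: "y \<in> Y \<Longrightarrow> (\<lambda>x. C x y) \<in> borel_measurable P"
  using measurable_compose[OF measurable_Pair2' C_meas] by (simp add: space_m)

lemma continuous_bounded:
  assumes "continuous_on Y \<phi>"
  obtains b where "b \<ge> 0" "\<And>y. y \<in> Y \<Longrightarrow> \<bar>\<phi> y :: real\<bar> \<le> b"
  by (rule compact_continuous_bounded_measurable[OF Y_compact assms])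
    (meson abs_ge_zero max.cobounded1 max.cobounded2 order_trans that)

lemma continuous_measurable:
  assumes "continuous_on Y \<phi>"
  shows "(\<phi> :: 'y \<Rightarrow> real) \<in> borel_measurable m"
  by (rule compact_continuous_bounded_measurable[OF Y_compact assms])

lemma integrable_exp:
  assumes "continuous_on Y \<phi>" "x \<in> space P"
  shows "integrable m (\<lambda>y. exp (\<phi> y - C x y))"
proof -
  note [measurable] = continuous_measurable[OF assms(1)]
  obtain b where b: "\<And>y. y \<in> Y \<Longrightarrow> \<bar>\<phi> y\<bar> \<le> b" using
      continuous_bounded[OF assms(1)] by blast
  show ?thesis
  proof (rule m.integrable_const_bound[where B = "exp (b + B)"])
    show "AE y in m. norm (exp (\<phi> y - C x y)) \<le> exp (b + B)"
      using b C_bound[OF assms(2)] by (intro AE_I2) (fastforce simp: space_m abs_le_iff)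
  qed (use assms in measurable)
qed

lemma Z_bounds:
  assumes \<phi>: "continuous_on Y \<phi>" and b: "\<And>y. y \<in> Y \<Longrightarrow> \<bar>\<phi> y\<bar> \<le>
      b" and x: "x \<in> space P"
  shows "exp (- b - B) * V \<le> Z \<phi> x" "Z \<phi> x \<le> exp (b + B) * V" "0 < Z \<phi> x"
proof -
  have *: "- b - B \<le> \<phi> y - C x y" "\<phi> y - C x y \<le> b + B" if "y \<in> Y" for y
    using b[OF that] C_bound[OF x that] by linarith+
  have "(\<integral>y. exp (- b - B) \<partial>m) \<le> Z \<phi> x"
    unfolding partition_fun_def using * by (intro integral_mono integrable_exp \<phi> x) (auto simp: space_m)
  then show 1: "exp (- b - B) * V \<le> Z \<phi> x" by (simp add: space_m mult.commute)
  have "Z \<phi> x \<le> (\<integral>y. exp (b + B) \<partial>m)"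
    unfolding partition_fun_def using * by (intro integral_mono integrable_exp \<phi> x) (auto simp: space_m)
  then show "Z \<phi> x \<le> exp (b + B) * V" by (simp add: space_m mult.commute)
  have "0 < exp (- b - B) * V" using V_pos by simp
  then show "0 < Z \<phi> x" using 1 by linarith
qed

lemma Z_pos:
  assumes "continuous_on Y \<phi>" "x \<in> space P"
  shows "0 < Z \<phi> x"
  by (rule continuous_bounded[OF assms(1)]) (rule Z_bounds(3)[OF assms(1) _ assms(2)])

lemma Z_measurable:
  assumes "continuous_on Y \<phi>"
  shows "Z \<phi> \<in> borel_measurable P"
proof -
  note [measurable] = continuous_measurable[OF assms] C_meas
  have "(\<lambda>(x, y). exp (\<phi> y - C x y)) \<in> borel_measurable (P \<Otimes>\<^sub>M m)"
    unfolding split_def using C_meas[unfolded split_def] by measurable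
  from m.borel_measurable_lebesgue_integral[OF this] show ?thesis
    by (simp add: partition_fun_def[abs_def])
qed

lemma ln_Z_bound:
  assumes \<phi>: "continuous_on Y \<phi>" and b: "\<And>y. y \<in> Y \<Longrightarrow> \<bar>\<phi> y\<bar> \<le>
      b" and x: "x \<in> space P"
  shows "\<bar>ln (Z \<phi> x) - ln V\<bar> \<le> b + B"
proof -
  note Zb = Z_bounds[OF \<phi> b x]
  have "ln (Z \<phi> x) \<le> ln (exp (b + B) * V)" using Zb V_pos by (subst ln_le_cancel_iff) auto
  moreover have "ln (exp (- b - B) * V) \<le> ln (Z \<phi> x)" using Zb V_pos by (subst ln_le_cancel_iff) auto
  ultimately show ?thesis using V_pos by (simp add: ln_mult abs_le_iff)
qed

lemma integrable_ln_Z: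
  assumes \<phi>: "continuous_on Y \<phi>"
  shows "integrable P (\<lambda>x. ln (Z \<phi> x))"
proof -
  obtain b where b: "\<And>y. y \<in> Y \<Longrightarrow> \<bar>\<phi> y\<bar> \<le> b" using
      continuous_bounded[OF \<phi>] by blast
  note [measurable] = Z_measurable[OF \<phi>]
  show ?thesis
  proof (rule P.integrable_const_bound[where B = "b + B + \<bar>ln V\<bar>"])
    show "AE x in P. norm (ln (Z \<phi> x)) \<le> b + B + \<bar>ln V\<bar>"
      using ln_Z_bound[OF \<phi> b] by (intro AE_I2) fastforce
  qed measurable
qed

lemma log_partition_bound:
  assumes \<phi>: "continuous_on Y \<phi>" and b: "\<And>y. y \<in> Y \<Longrightarrow> \<bar>\<phi> y\<bar> \<le> b"
  shows "ln V - b - B \<le> log_partition P Y C \<phi>"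
  unfolding log_partition_def
proof (rule P.integral_ge_const[OF integrable_ln_Z[OF \<phi>]])
  show "AE x in P. ln V - b - B \<le> ln (Z \<phi> x)"
    using ln_Z_bound[OF \<phi> b] by (intro AE_I2) (smt (verit))
qed

text \<open>The shift \<open>s\<close> has two uses: a small one expresses Lipschitz continuity in
  the uniform norm, an exact one moves additive constants of a potential out of
  \<open>log_partition\<close>.\<close>

lemma log_partition_mono:
  assumes \<phi>: "continuous_on Y \<phi>" and \<psi>: "continuous_on Y \<psi>" and le: "\<And>y. y \<in> Y
      \<Longrightarrow> \<phi> y \<le> \<psi> y + s"
  shows "log_partition P Y C \<phi> \<le> log_partition P Y C \<psi> + s"
proof -
  have "(\<integral>x. ln (Z \<phi> x) \<partial>P) \<le> (\<integral>x. ln (Z \<psi> x) + s \<partial>P)"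
  proof (intro integral_mono integrable_ln_Z \<phi> Bochner_Integration.integrable_add \<psi>)
    fix x assume x: "x \<in> space P"
    have "Z \<phi> x \<le> (\<integral>y. exp s * exp (\<psi> y - C x y) \<partial>m)"
      unfolding partition_fun_def
    proof (intro integral_mono integrable_exp \<phi> x integrable_mult_right \<psi>)
      fix y assume "y \<in> space m"
      then show "exp (\<phi> y - C x y) \<le> exp s * exp (\<psi> y - C x y)"
        using le[of y] by (simp add: exp_add[symmetric] space_m algebra_simps)
    qed
    also have "\<dots> = exp s * Z \<psi> x" by (simp add: partition_fun_def)
    finally have "ln (Z \<phi> x) \<le> ln (exp s * Z \<psi> x)"
      using Z_pos[OF \<phi> x] Z_pos[OF \<psi> x] by (subst ln_le_cancel_iff) auto
    then show "ln (Z \<phi> x) \<le> ln (Z \<psi> x) + s" using Z_pos[OF \<psi> x] by (simp add: ln_mult)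
  qed simp
  also have "\<dots> = (\<integral>x. ln (Z \<psi> x) \<partial>P) + s"
    using integrable_ln_Z[OF \<psi>] by (simp add: P.prob_space)
  finally show ?thesis by (simp add: log_partition_def)
qed

lemma factor_bounds:
  assumes \<phi>: "continuous_on Y \<phi>"
  obtains l u where "0 < l" "\<And>x y. x \<in> space P \<Longrightarrow> y \<in> Y \<Longrightarrow> l \<le> exp
      (- C x y) / Z \<phi> x"
    "\<And>x y. x \<in> space P \<Longrightarrow> y \<in> Y \<Longrightarrow> exp (- C x y) / Z \<phi> x \<le> u"
proof -
  obtain b where b: "\<And>y. y \<in> Y \<Longrightarrow> \<bar>\<phi> y\<bar> \<le> b" using
      continuous_bounded[OF \<phi>] by blast
  show thesis
  proof (rule that[of "exp (- B) / (exp (b + B) * V)" "exp B / (exp (- b - B) * V)"])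
    show "0 < exp (- B) / (exp (b + B) * V)" using V_pos by simp
    fix x y assume x: "x \<in> space P" and y: "y \<in> Y"
    show "exp (- B) / (exp (b + B) * V) \<le> exp (- C x y) / Z \<phi> x"
      using Z_bounds[OF \<phi> b x] C_bound[OF x y] V_pos by (intro frac_le) auto
    show "exp (- C x y) / Z \<phi> x \<le> exp B / (exp (- b - B) * V)"
      using Z_bounds[OF \<phi> b x] C_bound[OF x y] V_pos by (intro frac_le) auto
  qed
qed

lemma integrable_factor:
  assumes \<phi>: "continuous_on Y \<phi>" and y: "y \<in> Y"
  shows "integrable P (\<lambda>x. exp (- C x y) / Z \<phi> x)"
proof -
  obtain l u where lu: "0 < l" "\<And>x y. x \<in> space P \<Longrightarrow> y \<in> Y \<Longrightarrow> l \<le>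
      exp (- C x y) / Z \<phi> x"
    "\<And>x y. x \<in> space P \<Longrightarrow> y \<in> Y \<Longrightarrow> exp (- C x y) / Z \<phi> x \<le> u"
        by (rule factor_bounds[OF \<phi>]) blast
  note [measurable] = Z_measurable[OF \<phi>] C_section2[OF y]
  show ?thesis
  proof (rule P.integrable_const_bound[where B = u])
    show "AE x in P. norm (exp (- C x y) / Z \<phi> x) \<le> u"
      using lu(3) y Z_pos[OF \<phi>] by (intro AE_I2) (auto simp: abs_of_pos)
  qed measurable
qed

lemma factor_pos:
  assumes \<phi>: "continuous_on Y \<phi>" and y: "y \<in> Y"
  shows "0 < a \<phi> y"
proof -
  obtain l u where lu: "0 < l" "\<And>x y. x \<in> space P \<Longrightarrow> y \<in> Y \<Longrightarrow> l \<le>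
      exp (- C x y) / Z \<phi> x"
    "\<And>x y. x \<in> space P \<Longrightarrow> y \<in> Y \<Longrightarrow> exp (- C x y) / Z \<phi> x \<le> u"
        by (rule factor_bounds[OF \<phi>]) blast
  have "l \<le> a \<phi> y" unfolding marginal_factor_def
    using lu(2) y by (intro P.integral_ge_const integrable_factor \<phi> y AE_I2) auto
  then show ?thesis using lu(1) by simp
qed

text \<open>Inside \<open>marginal_factor\<close> the variable \<open>y\<close> occurs only in the
  cost, so changing the cost by at most \<open>e\<close> changes every integrand by a factor of at
  most \<open>exp e\<close>. The bound does not involve \<open>\<phi>\<close>, and this is the
  source of equicontinuity.\<close>

lemma ln_factor_diff:
  assumes \<phi>: "continuous_on Y \<phi>" and y: "y \<in> Y" "y' \<in> Y"
    and e: "\<And>x. x \<in> space P \<Longrightarrow> \<bar>C x y - C x y'\<bar> \<le> e"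
  shows "\<bar>ln (a \<phi> y) - ln (a \<phi> y')\<bar> \<le> e"
proof -
  have *: "ln (a \<phi> y) \<le> ln (a \<phi> y') + e"
    if y: "y \<in> Y" "y' \<in> Y" and e: "\<And>x. x \<in> space P \<Longrightarrow> \<bar>C x y - C x y'\<bar>
        \<le> e" for y y'
  proof -
    have "a \<phi> y \<le> (\<integral>x. exp e * (exp (- C x y') / Z \<phi> x) \<partial>P)"
      unfolding marginal_factor_def
    proof (intro integral_mono integrable_factor \<phi> integrable_mult_right y)
      fix x assume x: "x \<in> space P"
      have "exp (- C x y) \<le> exp e * exp (- C x y')"
        using e[OF x] by (simp add: exp_add[symmetric])
      then have "exp (- C x y) / Z \<phi> x \<le> exp e * exp (- C x y') / Z \<phi> x"
        using Z_pos[OF \<phi> x] by (intro divide_right_mono) auto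
      then show "exp (- C x y) / Z \<phi> x \<le> exp e * (exp (- C x y') / Z \<phi> x)" by simp
    qed
    also have "\<dots> = exp e * a \<phi> y'" by (simp only: marginal_factor_def integral_mult_right_zero)
    finally have "ln (a \<phi> y) \<le> ln (exp e * a \<phi> y')"
      using factor_pos[OF \<phi>] y by (subst ln_le_cancel_iff) auto
    then show ?thesis using factor_pos[OF \<phi> y(2)] by (simp add: ln_mult)
  qed
  from *[OF y e] *[OF y(2,1)] e show ?thesis by (force simp: abs_minus_commute abs_le_iff)
qed

lemma continuous_ln_factor:
  assumes \<phi>: "continuous_on Y \<phi>"
  shows "continuous_on Y (\<lambda>y. ln (a \<phi> y))"
  unfolding continuous_on_iff
proof (intro ballI allI impI)
  fix y and e :: real assume y: "y \<in> Y" and e: "0 < e"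
  then have "0 < e / 2" by simp
  from C_equicont[OF this] obtain d where d: "0 < d"
    "\<And>x y y'. x \<in> space P \<Longrightarrow> y \<in> Y \<Longrightarrow> y' \<in> Y \<Longrightarrow> dist
        y y' < d \<Longrightarrow> \<bar>C x y - C x y'\<bar> \<le> e / 2" by blast
  have "dist (ln (a \<phi> y')) (ln (a \<phi> y)) < e" if "y' \<in> Y" "dist y' y < d" for y'
    using ln_factor_diff[OF \<phi> that(1) y, of "e / 2"] d(2) that y e by (force simp: dist_real_def)
  then show "\<exists>d>0. \<forall>y'\<in>Y. dist y' y < d \<longrightarrow> dist (ln (a \<phi> y')) (ln (a \<phi> y)) < e"
    using d(1) by blast
qed

text \<open>Fubini for \<open>exp (\<psi> y - C x y) / Z \<phi> x\<close>: the new potential enters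
  the numerator while the normalisation is still the old one. For \<open>\<psi> = \<phi>\<close>
  this says that the second marginal of the Gibbs coupling has total mass one.\<close>

lemma factor_integral:
  assumes \<phi>: "continuous_on Y \<phi>" and \<psi>: "continuous_on Y \<psi>"
  shows "integrable P (\<lambda>x. Z \<psi> x / Z \<phi> x)"
    "(\<integral>y. exp (\<psi> y) * a \<phi> y \<partial>m) = (\<integral>x. Z \<psi> x / Z \<phi> x \<partial>P)"
proof -
  obtain l u where lu: "0 < l" "\<And>x y. x \<in> space P \<Longrightarrow> y \<in> Y \<Longrightarrow> l \<le>
      exp (- C x y) / Z \<phi> x"
    "\<And>x y. x \<in> space P \<Longrightarrow> y \<in> Y \<Longrightarrow> exp (- C x y) / Z \<phi> x \<le> u"
        by (rule factor_bounds[OF \<phi>]) blast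
  obtain b where b: "\<And>y. y \<in> Y \<Longrightarrow> \<bar>\<psi> y\<bar> \<le> b" using
      continuous_bounded[OF \<psi>] by blast
  note [measurable] = Z_measurable[OF \<phi>] continuous_measurable[OF \<psi>] C_meas[unfolded split_def]
  have I: "integrable (P \<Otimes>\<^sub>M m) (\<lambda>(x, y). exp (\<psi> y) * (exp (- C x y) / Z \<phi> x))"
  proof (rule finite_measure.integrable_const_bound[OF finite_pair, where B = "exp b * u"])
    show "AE z in P \<Otimes>\<^sub>M m. norm (case z of (x, y) \<Rightarrow> exp (\<psi> y) * (exp (- C x y) / Z
        \<phi> x)) \<le> exp b * u"
    proof (rule AE_I2, clarify)
      fix x y assume "(x, y) \<in> space (P \<Otimes>\<^sub>M m)"
      then have x: "x \<in> space P" and y: "y \<in> Y" by (auto simp: space_pair_measure space_m)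
      have "exp (\<psi> y) * (exp (- C x y) / Z \<phi> x) \<le> exp b * u"
        using b[OF y] lu(3)[OF x y] lu(1) lu(2)[OF x y] by (intro mult_mono) (auto simp: abs_le_iff)
      then show "norm (exp (\<psi> y) * (exp (- C x y) / Z \<phi> x)) \<le> exp b * u"
        using Z_pos[OF \<phi> x] by (simp add: abs_mult abs_of_pos)
    qed
    show "(\<lambda>(x, y). exp (\<psi> y) * (exp (- C x y) / Z \<phi> x)) \<in> borel_measurable (P \<Otimes>\<^sub>M m)"
      unfolding split_def by measurable
  qed
  have e: "(\<integral>y. exp (\<psi> y) * (exp (- C x y) / Z \<phi> x) \<partial>m) = Z \<psi> x / Z \<phi> x" for x
    by (simp add: partition_fun_def exp_diff exp_minus field_simps flip: integral_mult_right_zero integral_divide_zero)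
  show "integrable P (\<lambda>x. Z \<psi> x / Z \<phi> x)"
    using integrable_fst'[OF I] by (simp only: prod.case e)
  have "(\<integral>y. exp (\<psi> y) * a \<phi> y \<partial>m) = (\<integral>y. (\<integral>x. exp (\<psi> y) *
      (exp (- C x y) / Z \<phi> x) \<partial>P) \<partial>m)"
    by (simp only: marginal_factor_def integral_mult_right_zero)
  also have "\<dots> = (\<integral>x. (\<integral>y. exp (\<psi> y) * (exp (- C x y) / Z \<phi> x) \<partial>m) \<partial>P)"
    using I by (rule Fubini_integral)
  finally show "(\<integral>y. exp (\<psi> y) * a \<phi> y \<partial>m) = (\<integral>x. Z \<psi> x / Z \<phi> x
      \<partial>P)" by (simp only: e)
qed

lemma factor_integral_self:
  assumes \<phi>: "continuous_on Y \<phi>"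
  shows "(\<integral>y. exp (\<phi> y) * a \<phi> y \<partial>m) = 1"
proof -
  have "(\<integral>x. Z \<phi> x / Z \<phi> x \<partial>P) = (\<integral>x. 1 \<partial>P)"
    using Z_pos[OF \<phi>] by (intro Bochner_Integration.integral_cong) force+
  then show ?thesis using factor_integral(2)[OF \<phi> \<phi>] by (simp add: P.prob_space)
qed

text \<open>The inequality \<open>ln t \<le> t - 1\<close> at
  \<open>t = Z \<psi> x / Z \<phi> x\<close>, integrated over \<open>x\<close>. It bounds the change
  by an expression linear in \<open>exp \<psi>\<close>, which a Sinkhorn step can evaluate.\<close>

lemma log_partition_diff_le:
  assumes \<phi>: "continuous_on Y \<phi>" and \<psi>: "continuous_on Y \<psi>"
  shows "log_partition P Y C \<psi> - log_partition P Y C \<phi> \<le> (\<integral>y. exp (\<psi> y) * a \<phi> y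
      \<partial>m) - 1"
proof -
  have "(\<integral>x. ln (Z \<psi> x) - ln (Z \<phi> x) \<partial>P) \<le> (\<integral>x. Z \<psi> x / Z \<phi> x
      - 1 \<partial>P)"
  proof (intro integral_mono Bochner_Integration.integrable_diff integrable_ln_Z factor_integral \<phi> \<psi>)
    fix x assume x: "x \<in> space P"
    have "ln (Z \<psi> x / Z \<phi> x) \<le> Z \<psi> x / Z \<phi> x - 1"
      using Z_pos[OF \<phi> x] Z_pos[OF \<psi> x] by (intro ln_le_minus_one) auto
    then show "ln (Z \<psi> x) - ln (Z \<phi> x) \<le> Z \<psi> x / Z \<phi> x - 1"
      using Z_pos[OF \<phi> x] Z_pos[OF \<psi> x] by (simp add: ln_div)
  qed simp
  then show ?thesis
    using integrable_ln_Z[OF \<phi>] integrable_ln_Z[OF \<psi>] factor_integral[OF \<phi> \<psi>]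
    by (simp add: log_partition_def P.prob_space)
qed

end

subsection \<open>Sinkhorn steps and the dual minimiser\<close>

locale sinkhorn =
  fixes K :: nat and lam :: "nat \<Rightarrow> real" and P :: "nat \<Rightarrow> 'x measure"
    and Y :: "'y::euclidean_space set" and C :: "nat \<Rightarrow> 'x \<Rightarrow> 'y \<Rightarrow> real" and B :: real
  assumes cost: "\<And>k. k < K \<Longrightarrow> gibbs_cost (P k) Y (C k) B"
    and K_pos: "K \<ge> 1"
    and lam_pos: "\<And>k. k < K \<Longrightarrow> lam k > 0" and lam_sum: "(\<Sum>k<K. lam k) = 1"
begin

abbreviation "m \<equiv> restrict_space lborel Y"

definition feasible :: "(nat \<Rightarrow> 'y \<Rightarrow> real) \<Rightarrow> bool" where
  "feasible \<phi> \<longleftrightarrow> (\<forall>k<K. continuous_on Y (\<phi> k)) \<and> (\<forall>y\<in>Y.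
      (\<Sum>k<K. lam k * \<phi> k y) = 0)"

definition G :: "(nat \<Rightarrow> 'y \<Rightarrow> real) \<Rightarrow> real" where
  "G \<phi> = (\<Sum>k<K. lam k * log_partition (P k) Y (C k) (\<phi> k))"

definition L :: "(nat \<Rightarrow> 'y \<Rightarrow> real) \<Rightarrow> nat \<Rightarrow> 'y \<Rightarrow> real" where
  "L \<phi> k y = ln (marginal_factor (P k) Y (C k) (\<phi> k) y)"

definition mean_L :: "(nat \<Rightarrow> 'y \<Rightarrow> real) \<Rightarrow> 'y \<Rightarrow> real" where
  "mean_L \<phi> y = (\<Sum>j<K. lam j * L \<phi> j y)"

text \<open>The Sinkhorn update that fits the \<open>k\<close>-th marginal density to the target
  \<open>exp (mean_L \<phi>)\<close> while the partition functions stay frozen. The old potential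
  \<open>\<phi> k\<close> drops out, because the update adds the log-ratio of target and current
  density \<open>exp (\<phi> k + L \<phi> k)\<close>. Averaging with weights of sum one makes the
  new potentials feasible.\<close>

definition step :: "(nat \<Rightarrow> 'y \<Rightarrow> real) \<Rightarrow> nat \<Rightarrow> 'y \<Rightarrow> real" where
  "step \<phi> k y = mean_L \<phi> y - L \<phi> k y"

lemma gibbs0: "gibbs_cost (P 0) Y (C 0) B" using cost K_pos by simp

lemma Y_compact: "compact Y" and Y_pos: "emeasure lborel Y > 0"
  using gibbs_cost.Y_compact[OF gibbs0] gibbs_cost.Y_pos[OF gibbs0] by auto

lemma finite_m: "finite_measure m"
  by (rule finite_measure_restrict_compact[OF Y_compact])

lemma Y_nonempty: "Y \<noteq> {}" using Y_pos by auto

lemma feasibleD: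
  assumes "feasible \<phi>"
  shows "k < K \<Longrightarrow> continuous_on Y (\<phi> k)" "y \<in> Y \<Longrightarrow> (\<Sum>k<K. lam k *
      \<phi> k y) = 0"
  using assms by (auto simp: feasible_def)

lemma factor_eq_exp:
  assumes "feasible \<phi>" "k < K" "y \<in> Y"
  shows "marginal_factor (P k) Y (C k) (\<phi> k) y = exp (L \<phi> k y)"
  using gibbs_cost.factor_pos[OF cost[OF assms(2)] feasibleD(1)[OF assms(1,2)] assms(3)]
  by (simp add: L_def)

lemma continuous_L: "feasible \<phi> \<Longrightarrow> k < K \<Longrightarrow> continuous_on Y (L \<phi> k)"
  unfolding L_def using gibbs_cost.continuous_ln_factor[OF cost] feasibleD(1) by blast

lemma continuous_mean_L: "feasible \<phi> \<Longrightarrow> continuous_on Y (mean_L \<phi>)"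
  unfolding mean_L_def[abs_def] by (intro continuous_intros continuous_L) auto

lemma L_diff:
  assumes \<phi>: "feasible \<phi>" and k: "k < K" and y: "y \<in> Y" "y' \<in> Y"
    and e: "\<And>x. x \<in> space (P k) \<Longrightarrow> \<bar>C k x y - C k x y'\<bar> \<le> e"
  shows "\<bar>L \<phi> k y - L \<phi> k y'\<bar> \<le> e"
  unfolding L_def using gibbs_cost.ln_factor_diff[OF cost[OF k] feasibleD(1)[OF \<phi> k] y e] .

lemma step_feasible:
  assumes \<phi>: "feasible \<phi>"
  shows "feasible (step \<phi>)"
  unfolding feasible_def
proof (intro conjI ballI allI impI)
  show "continuous_on Y (step \<phi> k)" if "k < K" for k
    unfolding step_def[abs_def] by (intro continuous_intros continuous_mean_L continuous_L \<phi> that)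
  show "(\<Sum>k<K. lam k * step \<phi> k y) = 0" for y
    by (simp add: step_def mean_L_def right_diff_distrib sum_subtractf flip: sum_distrib_right)
      (simp add: lam_sum)
qed

text \<open>One \<open>e\<close> comes from \<open>L \<phi> k\<close>, the other from the weighted
  average \<open>mean_L \<phi>\<close>; neither depends on \<open>\<phi>\<close>.\<close>

lemma step_diff:
  assumes \<phi>: "feasible \<phi>" and k: "k < K" and y: "y \<in> Y" "y' \<in> Y"
    and e: "\<And>k x. k < K \<Longrightarrow> x \<in> space (P k) \<Longrightarrow> \<bar>C k x y - C k x y'\<bar> \<le> e"
  shows "\<bar>step \<phi> k y - step \<phi> k y'\<bar> \<le> 2 * e"
proof -
  have Le: "\<bar>L \<phi> j y - L \<phi> j y'\<bar> \<le> e" if "j < K" for j using L_diff[OF \<phi> that y] e that by blast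
  have "\<bar>mean_L \<phi> y - mean_L \<phi> y'\<bar> = \<bar>\<Sum>j<K. lam j * (L \<phi> j y - L \<phi> j y')\<bar>"
    by (simp add: mean_L_def right_diff_distrib sum_subtractf)
  also have "\<dots> \<le> (\<Sum>j<K. lam j * e)"
    using Le lam_pos by (intro order_trans[OF sum_abs] sum_mono) (auto simp: abs_mult abs_of_pos intro!: mult_left_mono)
  also have "\<dots> = e" by (simp add: lam_sum flip: sum_distrib_right)
  finally show ?thesis using Le[OF k] unfolding step_def by linarith
qed

lemma exp_step_factor:
  assumes "feasible \<phi>" "k < K" "y \<in> Y"
  shows "exp (step \<phi> k y) * marginal_factor (P k) Y (C k) (\<phi> k) y = exp (mean_L \<phi> y)"
  unfolding factor_eq_exp[OF assms] by (simp add: step_def flip: exp_add)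

text \<open>By \<open>exp_step_factor\<close> the linear bound of
  \<open>log_partition_diff_le\<close> is the same number for every \<open>k\<close>, so the weights
  sum out.\<close>

lemma G_step_le:
  assumes \<phi>: "feasible \<phi>"
  shows "G (step \<phi>) - G \<phi> \<le> (\<integral>y. exp (mean_L \<phi> y) \<partial>m) - 1"
proof -
  have "G (step \<phi>) - G \<phi> = (\<Sum>k<K. lam k * (log_partition (P k) Y (C k) (step \<phi> k) -
      log_partition (P k) Y (C k) (\<phi> k)))"
    by (simp add: G_def right_diff_distrib sum_subtractf)
  also have "\<dots> \<le> (\<Sum>k<K. lam k * ((\<integral>y. exp (mean_L \<phi> y) \<partial>m) - 1))"
  proof (intro sum_mono mult_left_mono)
    fix k assume "k \<in> {..<K}"
    then have k: "k < K" by simp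
    show "0 \<le> lam k" using lam_pos[OF k] by simp
    have "(\<integral>y. exp (step \<phi> k y) * marginal_factor (P k) Y (C k) (\<phi> k) y \<partial>m) =
        (\<integral>y. exp (mean_L \<phi> y) \<partial>m)"
      by (intro Bochner_Integration.integral_cong refl exp_step_factor \<phi> k) (simp add: space_restrict_space)
    then show "log_partition (P k) Y (C k) (step \<phi> k) - log_partition (P k) Y (C k) (\<phi> k)
        \<le> (\<integral>y. exp (mean_L \<phi> y) \<partial>m) - 1"
      using gibbs_cost.log_partition_diff_le[OF cost[OF k] feasibleD(1)[OF \<phi> k]
          feasibleD(1)[OF step_feasible[OF \<phi>] k]] by simp
  qed
  also have "\<dots> = (\<integral>y. exp (mean_L \<phi> y) \<partial>m) - 1" by (simp add: lam_sum flip: sum_distrib_right)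
  finally show ?thesis .
qed

text \<open>By feasibility, \<open>exp (mean_L \<phi>)\<close> is the weighted geometric mean of the marginal densities
  \<open>exp (\<phi> k + L \<phi> k)\<close>.\<close>

lemma geometric_mean:
  assumes \<phi>: "feasible \<phi>" and y: "y \<in> Y"
  shows "exp (mean_L \<phi> y) \<le> (\<Sum>k<K. lam k * exp (\<phi> k y + L \<phi> k y))"
    "exp (mean_L \<phi> y) = (\<Sum>k<K. lam k * exp (\<phi> k y + L \<phi> k y)) \<Longrightarrow> k < K
        \<Longrightarrow> exp (\<phi> k y + L \<phi> k y) = exp (mean_L \<phi> y)"
proof -
  \<comment> \<open>The deviation of the \<open>k\<close>-th log-density from the weighted mean;
    feasibility makes the weighted sum of deviations zero. Hence the AM-GM gap is a positive
    multiple of the weighted sum of \<open>exp (t k) - 1 - t k\<close>, whose terms are nonnegative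
    and vanish only at \<open>t k = 0\<close>.\<close>
  define t where "t k = \<phi> k y + L \<phi> k y - mean_L \<phi> y" for k
  have t0: "(\<Sum>k<K. lam k * t k) = 0"
    using feasibleD(2)[OF \<phi> y] lam_sum
    by (simp add: t_def mean_L_def distrib_left right_diff_distrib sum.distrib sum_subtractf flip: sum_distrib_right)
  have et: "exp (\<phi> k y + L \<phi> k y) = exp (mean_L \<phi> y) * exp (t k)" for k
    by (simp add: t_def flip: exp_add)
  have gap: "(\<Sum>k<K. lam k * exp (\<phi> k y + L \<phi> k y)) - exp (mean_L \<phi> y)
      = exp (mean_L \<phi> y) * (\<Sum>k<K. lam k * (exp (t k) - 1 - t k))"
    using t0 lam_sum unfolding et
    by (simp add: right_diff_distrib sum_subtractf sum_distrib_left mult.left_commute)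
  have nn: "0 \<le> lam k * (exp (t k) - 1 - t k)" if "k < K" for k
  proof (rule mult_nonneg_nonneg)
    show "0 \<le> exp (t k) - 1 - t k" using exp_ge_add_one_self[of "t k"] by linarith
  qed (use lam_pos[OF that] in simp)
  have "0 \<le> exp (mean_L \<phi> y) * (\<Sum>k<K. lam k * (exp (t k) - 1 - t k))"
    by (intro mult_nonneg_nonneg sum_nonneg nn exp_ge_zero) simp
  then show "exp (mean_L \<phi> y) \<le> (\<Sum>k<K. lam k * exp (\<phi> k y + L \<phi> k y))" using gap by simp
  assume eq: "exp (mean_L \<phi> y) = (\<Sum>k<K. lam k * exp (\<phi> k y + L \<phi> k y))" and k: "k < K"
  then have "exp (mean_L \<phi> y) * (\<Sum>k<K. lam k * (exp (t k) - 1 - t k)) = 0"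
    unfolding gap[symmetric] by simp
  then have "(\<Sum>k<K. lam k * (exp (t k) - 1 - t k)) = 0"
    by (metis exp_not_eq_zero mult_eq_0_iff)
  then have "lam k * (exp (t k) - 1 - t k) = 0"
    using nn k by (subst (asm) sum_nonneg_eq_0_iff) auto
  then have "exp (t k) = 1 + t k" using lam_pos[OF k] by simp
  then have "ln (exp (t k)) = exp (t k) - 1" unfolding ln_exp by linarith
  then have "exp (t k) = 1" by (rule ln_eq_minus_one[OF exp_gt_zero])
  then have "t k = 0" by simp
  then show "exp (\<phi> k y + L \<phi> k y) = exp (mean_L \<phi> y)" by (simp add: et)
qed

lemma integrable_continuous: "continuous_on Y f \<Longrightarrow> integrable m (f :: 'y \<Rightarrow> real)"
proof -
  assume f: "continuous_on Y f"
  interpret finite_measure m by (rule finite_m)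
  obtain b where "\<And>y. y \<in> Y \<Longrightarrow> \<bar>f y\<bar> \<le> b" "f \<in> borel_measurable m"
    by (rule compact_continuous_bounded_measurable[OF Y_compact f]) blast
  then show ?thesis by (intro integrable_const_bound[where B = b] AE_I2) (auto simp: space_restrict_space)
qed

lemma marginal_densities:
  assumes \<phi>: "feasible \<phi>"
  shows "integrable m (\<lambda>y. exp (mean_L \<phi> y))" "integrable m (\<lambda>y. \<Sum>k<K. lam k * exp
      (\<phi> k y + L \<phi> k y))"
    "(\<integral>y. (\<Sum>k<K. lam k * exp (\<phi> k y + L \<phi> k y)) \<partial>m) = 1"
proof -
  show "integrable m (\<lambda>y. exp (mean_L \<phi> y))"
    by (intro integrable_continuous continuous_intros continuous_mean_L \<phi>)
  have i: "integrable m (\<lambda>y. exp (\<phi> k y + L \<phi> k y))" if "k < K" for k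
    by (intro integrable_continuous continuous_intros continuous_L feasibleD(1)[OF \<phi>] \<phi> that)
  then show "integrable m (\<lambda>y. \<Sum>k<K. lam k * exp (\<phi> k y + L \<phi> k y))" by auto
  have one: "(\<integral>y. exp (\<phi> k y + L \<phi> k y) \<partial>m) = 1" if k: "k < K" for k
  proof -
    have "(\<integral>y. exp (\<phi> k y + L \<phi> k y) \<partial>m) = (\<integral>y. exp (\<phi> k y) *
        marginal_factor (P k) Y (C k) (\<phi> k) y \<partial>m)"
      by (intro Bochner_Integration.integral_cong refl) (simp add: factor_eq_exp[OF \<phi> k] space_restrict_space exp_add)
    then show ?thesis using gibbs_cost.factor_integral_self[OF cost[OF k] feasibleD(1)[OF \<phi> k]] by simp
  qed
  have "(\<integral>y. (\<Sum>k<K. lam k * exp (\<phi> k y + L \<phi> k y)) \<partial>m) = (\<Sum>k<K. lam k *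
      (\<integral>y. exp (\<phi> k y + L \<phi> k y) \<partial>m))"
    using i by (subst Bochner_Integration.integral_sum) auto
  then show "(\<integral>y. (\<Sum>k<K. lam k * exp (\<phi> k y + L \<phi> k y)) \<partial>m) = 1" using one lam_sum by simp
qed

lemma integral_geometric_mean_le:
  assumes \<phi>: "feasible \<phi>"
  shows "(\<integral>y. exp (mean_L \<phi> y) \<partial>m) \<le> 1"
proof -
  have "(\<integral>y. exp (mean_L \<phi> y) \<partial>m) \<le> (\<integral>y. (\<Sum>k<K. lam k * exp (\<phi> k y
      + L \<phi> k y)) \<partial>m)"
    by (intro integral_mono marginal_densities \<phi> geometric_mean(1)) (simp add: space_restrict_space)
  then show ?thesis using marginal_densities(3)[OF \<phi>] by simp
qed

text \<open>Comparing with the single competitor \<open>step \<phi>\<close> forces the geometric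
  mean to have integral at least one, while the arithmetic mean has integral exactly one. The
  nonnegative gap between them therefore vanishes almost everywhere, and the equality case of AM-GM
  applies.\<close>

lemma minimiser_equal_marginals:
  assumes \<phi>: "feasible \<phi>" and min: "\<And>\<psi>. feasible \<psi> \<Longrightarrow> G \<phi> \<le> G \<psi>"
  shows "AE y in m. \<forall>k<K. exp (\<phi> k y) * marginal_factor (P k) Y (C k) (\<phi> k) y = exp (mean_L \<phi> y)"
proof -
  let ?d = "\<lambda>y. (\<Sum>k<K. lam k * exp (\<phi> k y + L \<phi> k y)) - exp (mean_L \<phi> y)"
  have "1 \<le> (\<integral>y. exp (mean_L \<phi> y) \<partial>m)"
    using min[OF step_feasible[OF \<phi>]] G_step_le[OF \<phi>] by simp
  then have "(\<integral>y. exp (mean_L \<phi> y) \<partial>m) = 1" using integral_geometric_mean_le[OF \<phi>] by simp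
  then have "(\<integral>y. ?d y \<partial>m) = 0"
    using marginal_densities[OF \<phi>] by simp
  moreover have nn: "AE y in m. 0 \<le> ?d y"
    using geometric_mean(1)[OF \<phi>] by (intro AE_I2) (simp add: space_restrict_space)
  moreover have "integrable m ?d" using marginal_densities[OF \<phi>] by simp
  ultimately have "AE y in m. ?d y = 0"
    by (subst (asm) integral_nonneg_eq_0_iff_AE) auto
  with AE_space show ?thesis
  proof eventually_elim
    case (elim y)
    then have y: "y \<in> Y" by (simp add: space_restrict_space)
    show ?case
    proof (intro allI impI)
      fix k assume k: "k < K"
      have "exp (\<phi> k y + L \<phi> k y) = exp (mean_L \<phi> y)"
        using geometric_mean(2)[OF \<phi> y _ k] elim by simp
      then show "exp (\<phi> k y) * marginal_factor (P k) Y (C k) (\<phi> k) y = exp (mean_L \<phi> y)"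
        using factor_eq_exp[OF \<phi> k y] by (simp add: exp_add)
    qed
  qed
qed

section \<open>Compactness and existence of a dual minimiser\<close>

lemma G_mono:
  assumes "feasible \<phi>" "feasible \<psi>" and le: "\<And>k y. k < K \<Longrightarrow> y \<in> Y
      \<Longrightarrow> \<phi> k y \<le> \<psi> k y + s k"
  shows "G \<phi> \<le> G \<psi> + (\<Sum>k<K. lam k * s k)"
  unfolding G_def sum.distrib[symmetric] distrib_left[symmetric]
  using le lam_pos gibbs_cost.log_partition_mono[OF cost feasibleD(1)[OF assms(1)] feasibleD(1)[OF assms(2)]]
  by (intro sum_mono mult_left_mono) (auto intro: less_imp_le)

text \<open>Vanishing at one fixed point of \<open>Y\<close> turns the bound on the oscillation of a
  step into a bound on its size.\<close>

definition normalized_step :: "(nat \<Rightarrow> 'y \<Rightarrow> real) \<Rightarrow> nat \<Rightarrow> 'y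
    \<Rightarrow> real" where
  "normalized_step \<phi> k y = step \<phi> k y - step \<phi> k (SOME y0. y0 \<in> Y)"

text \<open>The subtracted constants are the values of a feasible family at one point, so their
  weighted sum is zero and \<open>G\<close> does not see them. Between two points of
  \<open>Y\<close> each cost varies by at most \<open>2 * B\<close>, and \<open>step_diff\<close>
  doubles this to \<open>4 * B\<close>.\<close>

lemma normalized_step:
  assumes \<phi>: "feasible \<phi>"
  shows "feasible (normalized_step \<phi>)" "G (normalized_step \<phi>) \<le> G \<phi>" "k < K \<Longrightarrow> y
      \<in> Y \<Longrightarrow> \<bar>normalized_step \<phi> k y\<bar> \<le> 4 * B"
proof -
  define y0 where "y0 = (SOME y0. y0 \<in> Y)"
  have y0: "y0 \<in> Y" unfolding y0_def using Y_nonempty by (auto intro: someI)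
  note s = step_feasible[OF \<phi>]
  show f: "feasible (normalized_step \<phi>)"
    unfolding feasible_def
  proof (intro conjI ballI allI impI)
    show "continuous_on Y (normalized_step \<phi> k)" if "k < K" for k
      unfolding normalized_step_def[abs_def] by (intro continuous_intros feasibleD(1)[OF s that])
    show "(\<Sum>k<K. lam k * normalized_step \<phi> k y) = 0" if "y \<in> Y" for y
      using feasibleD(2)[OF s that] feasibleD(2)[OF s y0]
      by (simp add: normalized_step_def right_diff_distrib sum_subtractf y0_def)
  qed
  have "G (normalized_step \<phi>) \<le> G (step \<phi>) + (\<Sum>k<K. lam k * - step \<phi> k y0)"
    by (rule G_mono[OF f s]) (simp add: normalized_step_def y0_def)
  also have "\<dots> = G (step \<phi>)" using feasibleD(2)[OF s y0] by (simp add: sum_negf)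
  also have "\<dots> \<le> G \<phi>" using G_step_le[OF \<phi>] integral_geometric_mean_le[OF \<phi>] by simp
  finally show "G (normalized_step \<phi>) \<le> G \<phi>" .
  assume k: "k < K" and y: "y \<in> Y"
  have "\<bar>C k x y - C k x y0\<bar> \<le> 2 * B" if "k < K" "x \<in> space (P k)" for k x
    using gibbs_cost.C_bound[OF cost[OF that(1)] that(2) y] gibbs_cost.C_bound[OF cost[OF that(1)] that(2) y0] by linarith
  from step_diff[OF \<phi> k y y0 this] show "\<bar>normalized_step \<phi> k y\<bar> \<le> 4 * B" by (simp add:
      normalized_step_def y0_def)
qed

lemma equicont:
  assumes e: "e > 0"
  shows "\<exists>d>0. \<forall>k<K. \<forall>x\<in>space (P k). \<forall>y\<in>Y. \<forall>y'\<in>Y. dist y y' <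
      d \<longrightarrow> \<bar>C k x y - C k x y'\<bar> \<le> e"
proof -
  have "\<forall>k. \<exists>d>0. k < K \<longrightarrow> (\<forall>x\<in>space (P k). \<forall>y\<in>Y.
      \<forall>y'\<in>Y. dist y y' < d \<longrightarrow> \<bar>C k x y - C k x y'\<bar> \<le> e)"
    using gibbs_cost.C_equicont[OF cost e] zero_less_one by blast
  then obtain d where d: "\<And>k. d k > 0"
    "\<And>k x y y'. k < K \<Longrightarrow> x \<in> space (P k) \<Longrightarrow> y \<in> Y \<Longrightarrow> y'
        \<in> Y \<Longrightarrow> dist y y' < d k \<Longrightarrow> \<bar>C k x y - C k x y'\<bar> \<le> e"
    by metis
  define dd where "dd = Min (d ` {..<K})"
  have ne: "d ` {..<K} \<noteq> {}" using K_pos by (cases K) auto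
  have "dd > 0" unfolding dd_def using d(1) ne by (subst Min_gr_iff) auto
  moreover have "dd \<le> d k" if "k < K" for k unfolding dd_def using that by (intro Min_le) auto
  ultimately show ?thesis using d(2) by (meson less_le_trans)
qed

lemma minimiser_exists:
  obtains \<phi> where "feasible \<phi>" "\<And>\<psi>. feasible \<psi> \<Longrightarrow> G \<phi> \<le> G \<psi>"
proof -
  have zero: "feasible (\<lambda>_ _. 0)" by (simp add: feasible_def)
  define V where "V = measure m Y"
  \<comment> \<open>Passing to the normalised step can only lower \<open>G\<close>, so a lower bound
    for it is enough: \<open>4 * B\<close> accounts for the potential and another \<open>B\<close>
    for the cost.\<close>
  have lower: "ln V - 5 * B \<le> G \<psi>" if \<psi>: "feasible \<psi>" for \<psi>
  proof -
    have "ln V - 4 * B - B \<le> log_partition (P k) Y (C k) (normalized_step \<psi> k)" if k: "k < K" for k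
      unfolding V_def using normalized_step(3)[OF \<psi> k]
      by (intro gibbs_cost.log_partition_bound[OF cost[OF k] feasibleD(1)[OF normalized_step(1)[OF \<psi>] k]])
    then have "(\<Sum>k<K. lam k * (ln V - 4 * B - B)) \<le> G (normalized_step \<psi>)"
      unfolding G_def using lam_pos by (intro sum_mono mult_left_mono) (auto intro: less_imp_le)
    moreover have "(\<Sum>k<K. lam k * (ln V - 4 * B - B)) = ln V - 5 * B" by (simp add: lam_sum flip: sum_distrib_right)
    ultimately show ?thesis using normalized_step(2)[OF \<psi>] by linarith
  qed
  define g where "g = (INF \<psi>\<in>Collect feasible. G \<psi>)"
  have bdd: "bdd_below (G ` Collect feasible)" using lower by (intro bdd_belowI2[where m = "ln V - 5 * B"]) auto
  have g_le: "g \<le> G \<psi>" if "feasible \<psi>" for \<psi> unfolding g_def using that by (intro cINF_lower bdd) auto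
  have "\<exists>\<psi>. feasible \<psi> \<and> G \<psi> < g + inverse (real (Suc n))" for n
  proof -
    have "g < g + inverse (real (Suc n))" by simp
    then show ?thesis unfolding g_def using cINF_less_iff[OF _ bdd] zero by (metis (lifting) empty_iff mem_Collect_eq)
  qed
  then obtain \<psi> where \<psi>: "\<And>n. feasible (\<psi> n)" "\<And>n. G (\<psi> n) < g + inverse (real (Suc
      n))" by metis
  define h where "h n = normalized_step (\<psi> n)" for n
  have h: "feasible (h n)" "G (h n) \<le> g + inverse (real (Suc n))" for n
    unfolding h_def using normalized_step(1,2)[OF \<psi>(1)[of n]] \<psi>(2)[of n] by auto
  \<comment> \<open>All \<open>K\<close> potentials are glued into one function on a compact subset of \<open>real
      \<times> 'y\<close>.\<close>
  define S where "S = (real ` {..<K}) \<times> Y"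
  define F where "F n z = h n (nat \<lfloor>fst z\<rfloor>) (snd z)" for n and z :: "real \<times> 'y"
  have F: "F n (real k, y) = h n k y" for n k y by (simp add: F_def)
  have "compact S" unfolding S_def by (rule compact_Times[OF finite_imp_compact Y_compact]) simp
  moreover have "norm (F n z) \<le> 4 * B" if "z \<in> S" for n z
    using that normalized_step(3)[OF \<psi>(1)] by (auto simp: S_def F h_def)
  moreover have "\<exists>d>0. \<forall>n w. w \<in> S \<and> norm (z - w) < d \<longrightarrow> norm (F n z - F n w) < e"
    if z: "z \<in> S" and e: "0 < e" for z e
  proof -
    have "0 < e / 4" using e by simp
    from equicont[OF this] obtain d where d: "d > 0"
      "\<And>k x y y'. k < K \<Longrightarrow> x \<in> space (P k) \<Longrightarrow> y \<in> Y \<Longrightarrow>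
          y' \<in> Y \<Longrightarrow> dist y y' < d \<Longrightarrow> \<bar>C k x y - C k x y'\<bar> \<le> e / 4"
      by blast
    \<comment> \<open>At distance below 1 the index coordinates, being integers, coincide. Only the
      variation in \<open>Y\<close> is left, and it is at most \<open>2 * (e / 4)\<close>.\<close>
    have "norm (F n z - F n w) < e" if w: "w \<in> S" "norm (z - w) < min d 1" for n w
    proof -
      obtain k y where zk: "z = (real k, y)" "k < K" "y \<in> Y" using z by (auto simp: S_def)
      obtain j y' where wj: "w = (real j, y')" "j < K" "y' \<in> Y" using w by (auto simp: S_def)
      have "norm (real k - real j) \<le> norm (z - w)" "norm (y - y') \<le> norm (z - w)"
        using norm_fst_le[of "real k - real j" "y - y'"] norm_snd_le[of "y - y'" "real k - real j"] by (auto simp: zk wj)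
      then have "\<bar>real k - real j\<bar> < 1" and yy: "dist y y' < d" using w by (auto simp: dist_norm)
      then have "k = j" by linarith
      have "\<bar>step (\<psi> n) k y - step (\<psi> n) k y'\<bar> \<le> 2 * (e / 4)"
        by (rule step_diff[OF \<psi>(1) zk(2,3) wj(3)]) (use d(2) yy zk wj in auto)
      then show ?thesis using e \<open>k = j\<close> by (simp add: zk(1) wj(1) F h_def normalized_step_def)
    qed
    then show ?thesis using d(1) by (intro exI[of _ "min d 1"]) auto
  qed
  ultimately obtain q r where q: "continuous_on S q" and r: "strict_mono (r :: nat \<Rightarrow> nat)"
    and lim: "\<And>e. 0 < e \<Longrightarrow> \<exists>N. \<forall>n z. n \<ge> N \<and> z \<in> S
        \<longrightarrow> norm (F (r n) z - q z) < e"
    by (rule Arzela_Ascoli[of S F "4 * B"]) blast+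
  define \<phi> where "\<phi> k y = q (real k, y)" for k y
  have close: "\<exists>N. \<forall>n\<ge>N. \<forall>k<K. \<forall>y\<in>Y. \<bar>h (r n) k y - \<phi> k y\<bar>
      < e" if "e > 0" for e
    using lim[OF that] by (fastforce simp: S_def \<phi>_def F[symmetric])
  have \<phi>: "feasible \<phi>"
    unfolding feasible_def
  proof (intro conjI allI impI ballI)
    show "continuous_on Y (\<phi> k)" if "k < K" for k
      unfolding \<phi>_def[abs_def] using that
      by (intro continuous_on_compose2[OF q]) (auto intro!: continuous_intros simp: S_def)
    fix y assume y: "y \<in> Y"
    have "(\<lambda>n. \<Sum>k<K. lam k * h (r n) k y) \<longlonglongrightarrow> (\<Sum>k<K. lam k * \<phi> k y)"
    proof (intro tendsto_sum tendsto_mult tendsto_const)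
      fix k assume "k \<in> {..<K}"
      then show "(\<lambda>n. h (r n) k y) \<longlonglongrightarrow> \<phi> k y"
        using close y by (simp add: LIMSEQ_iff) blast
    qed
    moreover have "(\<Sum>k<K. lam k * h (r n) k y) = 0" for n using feasibleD(2)[OF h(1) y] .
    ultimately show "(\<Sum>k<K. lam k * \<phi> k y) = 0" by (simp add: LIMSEQ_const_iff)
  qed
  \<comment> \<open>By \<open>G_mono\<close>, a uniform error of \<open>e / 2\<close> in all
    potentials costs at most \<open>e / 2\<close> in \<open>G\<close>, because the weights sum to
    one. The other half of \<open>e\<close> covers the excess of \<open>h (r n)\<close> over the
    infimum.\<close>
  have "G \<phi> \<le> g"
  proof (rule field_le_epsilon)
    fix e :: real assume e: "0 < e"
    then have "0 < e / 2" by simp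
    from close[OF this] obtain N where N: "\<And>n k y. n \<ge> N \<Longrightarrow> k < K \<Longrightarrow> y
        \<in> Y \<Longrightarrow> \<bar>h (r n) k y - \<phi> k y\<bar> < e / 2" by blast
    obtain N' where N': "inverse (real (Suc N')) < e / 2" using reals_Archimedean[OF \<open>0 < e / 2\<close>] by blast
    define n where "n = max N N'"
    have "N' \<le> r n" using seq_suble[OF r, of n] by (simp add: n_def)
    then have "inverse (real (Suc (r n))) \<le> inverse (real (Suc N'))" by (intro le_imp_inverse_le) auto
    then have "G (h (r n)) \<le> g + e / 2" using h(2)[of "r n"] N' by linarith
    moreover have "G \<phi> \<le> G (h (r n)) + (\<Sum>k<K. lam k * (e / 2))"
    proof (rule G_mono[OF \<phi> h(1)])
      fix k y assume "k < K" "y \<in> Y"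
      then have "\<bar>h (r n) k y - \<phi> k y\<bar> < e / 2" by (intro N) (simp_all add: n_def)
      then show "\<phi> k y \<le> h (r n) k y + e / 2" by linarith
    qed
    moreover have "(\<Sum>k<K. lam k * (e / 2)) = e / 2" by (simp add: lam_sum flip: sum_distrib_right sum_divide_distrib)
    ultimately show "G \<phi> \<le> g + e" by simp
  qed
  then show thesis using that[OF \<phi>] g_le by force
qed

end

subsection \<open>Duality\<close>

text \<open>After integration over \<open>P\<close>, the potential part of Gibbs' inequality depends
  on \<open>\<pi>\<close> only through its second marginal and becomes the integral of
  \<open>f\<close> against \<open>Q\<close>; the cost part cancels the cost term of the
  objective.\<close>

lemma eot_obj_ge:
  fixes Y :: "'y::euclidean_space set"
  assumes Y: "compact Y" and Ypos: "emeasure lborel Y > 0" and \<epsilon>: "\<epsilon> > 0"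
    and G: "gibbs_cost P Y (\<lambda>x y. c x y / \<epsilon>) B"
    and Q: "Q \<in> probs Y" and \<pi>: "\<pi> \<in> couplings P Q" and f: "continuous_on Y f"
  shows "ereal (- \<epsilon> * log_partition P Y (\<lambda>x y. c x y / \<epsilon>) (\<lambda>y. f y / \<epsilon>)
      + (\<integral>y. f y \<partial>Q)) \<le> eot_obj c \<epsilon> Y P Q \<pi>"
proof -
  interpret G: gibbs_cost P Y "\<lambda>x y. c x y / \<epsilon>" B by (rule G)
  define w where "w y = f y / \<epsilon>" for y
  have w: "continuous_on Y w" unfolding w_def using f \<epsilon> by (intro continuous_intros) auto
  have sQ: "sets Q = sets G.m" and pQ: "prob_space Q" using Q by (auto simp: probs_def)
  have spQ: "space Q = Y" using sets_eq_imp_space_eq[OF sQ] G.space_m by simp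
  have p\<pi>: "prob_space \<pi>" and s\<pi>: "sets \<pi> = sets (P \<Otimes>\<^sub>M Q)" and marg: "distr \<pi> Q snd = Q"
    using \<pi> by (auto simp: couplings_def)
  \<comment> \<open>The objective is evaluated at this unspecified choice. Existence of a
    disintegration makes it a genuine one, and the estimate holds for whichever is chosen.\<close>
  define \<kappa> where "\<kappa> = (SOME \<kappa>. cond_kernel P Q \<pi> \<kappa>)"
  have k: "cond_kernel P Q \<pi> \<kappa>"
    unfolding \<kappa>_def using coupling_kernel_exists[OF borel_compact[OF Y] G.P.prob_space_axioms sQ \<pi>]
    by (rule someI_ex)
  obtain b where b: "\<And>y. y \<in> Y \<Longrightarrow> \<bar>w y\<bar> \<le> b" using G.continuous_bounded[OF w] by blast
  have sPQ: "sets (P \<Otimes>\<^sub>M Q) = sets (P \<Otimes>\<^sub>M G.m)" by (intro sets_pair_measure_cong sQ refl)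
  have spPQ: "space (P \<Otimes>\<^sub>M Q) = space P \<times> Y" by (simp add: space_pair_measure spQ)
  have wQ[measurable]: "w \<in> borel_measurable Q"
    using G.continuous_measurable[OF w] unfolding measurable_cong_sets[OF sQ refl] .
  have C[measurable]: "(\<lambda>z. c (fst z) (snd z) / \<epsilon>) \<in> borel_measurable (P \<Otimes>\<^sub>M Q)"
    using G.C_meas unfolding measurable_cong_sets[OF sPQ refl] split_def .
  have "(\<lambda>z. \<epsilon> * (c (fst z) (snd z) / \<epsilon>)) \<in> borel_measurable (P \<Otimes>\<^sub>M
      Q)" by measurable
  then have C'[measurable]: "(\<lambda>z. c (fst z) (snd z)) \<in> borel_measurable (P \<Otimes>\<^sub>M Q)" using
      \<epsilon> by simp
  have cB: "\<bar>c x y / \<epsilon>\<bar> \<le> B" if "x \<in> space P" "y \<in> Y" for x y using G.C_bound that .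
  have cB': "\<bar>c x y\<bar> \<le> \<epsilon> * B" if "x \<in> space P" "y \<in> Y" for x y
    using cB[OF that] \<epsilon> by (simp add: abs_divide field_simps)
  have u_meas: "(\<lambda>z. w (snd z) - c (fst z) (snd z) / \<epsilon>) \<in> borel_measurable (P
      \<Otimes>\<^sub>M Q)" by measurable
  have u_bound: "\<bar>w (snd z) - c (fst z) (snd z) / \<epsilon>\<bar> \<le> b + B" if "z \<in> space (P
      \<Otimes>\<^sub>M Q)" for z
  proof -
    have "fst z \<in> space P" "snd z \<in> Y" using that unfolding spPQ mem_Times_iff by auto
    from b[OF this(2)] cB[OF this] show ?thesis by linarith
  qed
  note I = cond_kernel_integral[OF G.P.prob_space_axioms p\<pi> k u_meas u_bound]
  \<comment> \<open>The Gibbs upper bound for the entropy of \<open>\<kappa> x\<close>. It is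
    integrable in \<open>x\<close>, as the majorant in \<open>ereal_integral_le\<close> must be,
    whatever the regularity of the entropy itself.\<close>
  define E where "E x = ln (G.Z w x) - (\<integral>y. w y - c x y / \<epsilon> \<partial>\<kappa> x)" for x
  have iu: "integrable P (\<lambda>x. \<integral>y. w y - c x y / \<epsilon> \<partial>\<kappa> x)"
    using I(1,3) by (intro G.P.integrable_const_bound[where B = "b + B"] AE_I2) auto
  have iE: "integrable P E" unfolding E_def by (intro Bochner_Integration.integrable_diff G.integrable_ln_Z w iu)
  have "ereal_integral P (\<lambda>x. diff_entropy Y (\<kappa> x)) \<le> ereal (\<integral>x. E x \<partial>P)"
  proof (rule ereal_integral_le[OF iE])
    fix x assume x: "x \<in> space P"
    have \<kappa>x: "\<kappa> x \<in> probs Y" using cond_kernel_space[OF k x] sQ by (simp add: probs_def)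
    show "diff_entropy Y (\<kappa> x) \<le> ereal (E x)"
      unfolding E_def partition_fun_def
    proof (rule diff_entropy_le[OF Y Ypos \<kappa>x])
      show "(\<lambda>y. w y - c x y / \<epsilon>) \<in> borel_measurable G.m"
        using G.continuous_measurable[OF w] G.C_section[OF x] by measurable
      show "\<bar>w y - c x y / \<epsilon>\<bar> \<le> b + B" if "y \<in> Y" for y using b[OF that] cB[OF x that] by linarith
    qed
  qed
  then have "ereal \<epsilon> * ereal_integral P (\<lambda>x. diff_entropy Y (\<kappa> x)) \<le> ereal (\<epsilon>
      * (\<integral>x. E x \<partial>P))"
    using ereal_mult_left_mono[of _ "ereal (\<integral>x. E x \<partial>P)" "ereal \<epsilon>"] \<epsilon> by simp
  moreover have "- \<epsilon> * log_partition P Y (\<lambda>x y. c x y / \<epsilon>) w + (\<integral>y. f y \<partial>Q)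
      = (\<integral>z. c (fst z) (snd z) \<partial>\<pi>) - \<epsilon> * (\<integral>x. E x \<partial>P)"
  proof -
    interpret \<pi>: prob_space \<pi> by (rule p\<pi>)
    have sp\<pi>: "space \<pi> = space P \<times> Y" using sets_eq_imp_space_eq[OF s\<pi>] spPQ by simp
    note [measurable_cong] = s\<pi>
    have iw: "integrable \<pi> (\<lambda>z. w (snd z))"
      using b sp\<pi> by (intro \<pi>.integrable_const_bound[where B = b] AE_I2) auto
    have ic: "integrable \<pi> (\<lambda>z. c (fst z) (snd z))"
      using cB' sp\<pi> by (intro \<pi>.integrable_const_bound[where B = "\<epsilon> * B"] AE_I2) auto
    have "(\<integral>x. E x \<partial>P) = log_partition P Y (\<lambda>x y. c x y / \<epsilon>) w -
        (\<integral>x. (\<integral>y. w y - c x y / \<epsilon> \<partial>\<kappa> x) \<partial>P)"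
      unfolding E_def log_partition_def using G.integrable_ln_Z[OF w] iu by simp
    also have "(\<integral>x. (\<integral>y. w y - c x y / \<epsilon> \<partial>\<kappa> x) \<partial>P) =
        (\<integral>z. w (snd z) - c (fst z) (snd z) / \<epsilon> \<partial>\<pi>)"
      using I(2) by simp
    also have "\<dots> = (\<integral>z. w (snd z) \<partial>\<pi>) - (\<integral>z. c (fst z) (snd z)
        \<partial>\<pi>) / \<epsilon>"
      using iw ic by simp
    also have "(\<integral>z. w (snd z) \<partial>\<pi>) = (\<integral>y. w y \<partial>distr \<pi> Q snd)"
      by (subst integral_distr) auto
    also have "\<dots> = (\<integral>y. f y \<partial>Q) / \<epsilon>" unfolding marg w_def by simp
    finally show ?thesis using \<epsilon> by (simp add: field_simps)
  qed
  ultimately show ?thesis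
    unfolding eot_obj_def Let_def \<kappa>_def[symmetric] w_def[symmetric]
    by (cases "ereal \<epsilon> * ereal_integral P (\<lambda>x. diff_entropy Y (\<kappa> x))") auto
qed

text \<open>The witness has density
  \<open>p x y = exp (\<phi> y - c x y / \<epsilon>) / Z \<phi> x\<close> with respect to the
  product of \<open>P\<close> and Lebesgue measure on \<open>Y\<close>. Its conditionals are Gibbs
  measures, so the inequality behind \<open>eot_obj_ge\<close> is an equality for each of
  them.\<close>

lemma eot_obj_gibbs_coupling:
  fixes Y :: "'y::euclidean_space set"
  defines "m \<equiv> restrict_space lborel Y"
  assumes Y: "compact Y" and Ypos: "emeasure lborel Y > 0" and \<epsilon>: "\<epsilon> > 0"
    and G: "gibbs_cost P Y (\<lambda>x y. c x y / \<epsilon>) B" and \<phi>: "continuous_on Y \<phi>"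
    and q[measurable]: "q \<in> borel_measurable m"
    and marg: "AE y in m. exp (\<phi> y) * marginal_factor P Y (\<lambda>x y. c x y / \<epsilon>) \<phi> y = q y"
  defines "Q \<equiv> density m (\<lambda>y. ennreal (q y))"
  obtains \<pi> where "\<pi> \<in> couplings P Q"
    "eot_obj c \<epsilon> Y P Q \<pi> = ereal (\<epsilon> * (\<integral>y. \<phi> y \<partial>Q) - \<epsilon> *
        log_partition P Y (\<lambda>x y. c x y / \<epsilon>) \<phi>)"
    "Q \<in> probs Y"
proof -
  interpret G: gibbs_cost P Y "\<lambda>x y. c x y / \<epsilon>" B by (rule G)
  have m_eq: "m = G.m" by (simp add: m_def)
  interpret m: finite_measure m unfolding m_def by (rule G.m.finite_measure_axioms)
  have spm: "space m = Y" by (simp add: m_eq G.space_m)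
  define p where "p x y = exp (\<phi> y - c x y / \<epsilon>) / G.Z \<phi> x" for x y
  have \<phi>m[measurable]: "\<phi> \<in> borel_measurable m" unfolding m_eq by (rule G.continuous_measurable[OF \<phi>])
  note [measurable] = G.Z_measurable[OF \<phi>]
  have C[measurable]: "(\<lambda>z. c (fst z) (snd z) / \<epsilon>) \<in> borel_measurable (P \<Otimes>\<^sub>M m)"
    using G.C_meas unfolding split_def m_eq .
  have pm[measurable]: "(\<lambda>z. p (fst z) (snd z)) \<in> borel_measurable (P \<Otimes>\<^sub>M m)"
    unfolding p_def by measurable
  have p0: "0 < p x y" if "x \<in> space P" for x y
    unfolding p_def using G.Z_pos[OF \<phi> that] by simp
  have p_int: "(\<integral>\<^sup>+y. ennreal (p x y) \<partial>m) = 1" if x: "x \<in> space P" for x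
  proof -
    have "(\<integral>\<^sup>+y. ennreal (p x y) \<partial>m) = ennreal (\<integral>y. p x y \<partial>m)"
      using G.integrable_exp[OF \<phi> x] p0[OF x] unfolding m_eq
      by (intro nn_integral_eq_integral) (auto simp: p_def less_imp_le)
    also have "(\<integral>y. p x y \<partial>m) = G.Z \<phi> x / G.Z \<phi> x"
      by (simp add: p_def[abs_def] partition_fun_def m_eq)
    finally show ?thesis using G.Z_pos[OF \<phi> x] by simp
  qed
  have p_section[measurable]: "p x \<in> borel_measurable m" if "x \<in> space P" for x
    using measurable_compose[OF measurable_Pair1'[OF that] pm] by simp
  interpret PM: pair_sigma_finite P m by unfold_locales
  define \<pi> where "\<pi> = density (P \<Otimes>\<^sub>M m) (\<lambda>z. ennreal (p (fst z) (snd z)))"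
  have \<pi>e: "emeasure \<pi> (A \<times> D) = (\<integral>\<^sup>+x. (\<integral>\<^sup>+y. ennreal (p x y) *
      indicator D y \<partial>m) * indicator A x \<partial>P)"
    if [measurable]: "A \<in> sets P" "D \<in> sets m" for A D
  proof -
    have "emeasure \<pi> (A \<times> D) = (\<integral>\<^sup>+z. ennreal (p (fst z) (snd z)) * indicator (A
        \<times> D) z \<partial>(P \<Otimes>\<^sub>M m))"
      unfolding \<pi>_def by (intro emeasure_density) measurable
    also have "\<dots> = (\<integral>\<^sup>+x. (\<integral>\<^sup>+y. ennreal (p x y) * indicator (A \<times> D)
        (x, y) \<partial>m) \<partial>P)"
      by (subst m.nn_integral_fst[symmetric]) auto
    also have "\<dots> = (\<integral>\<^sup>+x. (\<integral>\<^sup>+y. ennreal (p x y) * indicator D y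
        \<partial>m) * indicator A x \<partial>P)"
      by (intro nn_integral_cong) (auto simp: indicator_def intro!: nn_integral_cong)
    finally show ?thesis .
  qed
  have sp\<pi>: "space \<pi> = space P \<times> Y" by (simp add: \<pi>_def space_pair_measure spm)
  have s\<pi>m[measurable_cong]: "sets \<pi> = sets (P \<Otimes>\<^sub>M m)" by (simp add: \<pi>_def)
  have "emeasure \<pi> (space \<pi>) = emeasure \<pi> (space P \<times> space m)" by (simp add: sp\<pi> spm)
  also have "\<dots> = (\<integral>\<^sup>+x. 1 \<partial>P)"
    unfolding \<pi>e[OF sets.top sets.top] using p_int
    by (intro nn_integral_cong) (simp cong: nn_integral_cong)
  also have "\<dots> = 1" using G.P.emeasure_space_1 by simp
  finally have p\<pi>: "prob_space \<pi>" by (rule prob_spaceI)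
  have m1: "distr \<pi> P fst = P"
  proof (rule measure_eqI)
    fix A assume "A \<in> sets (distr \<pi> P fst)"
    then have A[measurable]: "A \<in> sets P" by simp
    have "emeasure (distr \<pi> P fst) A = emeasure \<pi> (fst -` A \<inter> space \<pi>)" by (intro
        emeasure_distr) measurable
    also have "fst -` A \<inter> space \<pi> = A \<times> space m" using sets.sets_into_space[OF A] by (auto simp:
        sp\<pi> spm)
    also have "emeasure \<pi> (A \<times> space m) = (\<integral>\<^sup>+x. indicator A x \<partial>P)"
      unfolding \<pi>e[OF A sets.top] using p_int
      by (intro nn_integral_cong) (simp cong: nn_integral_cong)
    finally show "emeasure (distr \<pi> P fst) A = emeasure P A" by simp
  qed simp
  have sQ[measurable_cong]: "sets Q = sets m" by (simp add: Q_def)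
  have spQ: "space Q = Y" by (simp add: Q_def spm)
  have m2: "distr \<pi> Q snd = Q"
  proof (rule measure_eqI)
    fix D assume "D \<in> sets (distr \<pi> Q snd)"
    then have D[measurable]: "D \<in> sets m" by (simp add: sQ)
    have "emeasure (distr \<pi> Q snd) D = emeasure \<pi> (snd -` D \<inter> space \<pi>)" by (intro
        emeasure_distr) measurable
    also have "snd -` D \<inter> space \<pi> = space P \<times> D" using sets.sets_into_space[OF D] by (auto simp:
        sp\<pi> spm)
    also have "emeasure \<pi> (space P \<times> D) = (\<integral>\<^sup>+x. (\<integral>\<^sup>+y. ennreal (p x y)
        * indicator D y \<partial>m) \<partial>P)"
      unfolding \<pi>e[OF sets.top D] by (intro nn_integral_cong) simp
    also have "\<dots> = (\<integral>\<^sup>+y. (\<integral>\<^sup>+x. ennreal (p x y) * indicator D y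
        \<partial>P) \<partial>m)"
      by (rule PM.Fubini'[symmetric]) (simp add: split_def)
    also have "\<dots> = (\<integral>\<^sup>+y. ennreal (q y) * indicator D y \<partial>m)"
    proof (rule nn_integral_cong_AE)
      show "AE y in m. (\<integral>\<^sup>+x. ennreal (p x y) * indicator D y \<partial>P) = ennreal (q y) * indicator D y"
        using marg AE_space
      proof eventually_elim
        case (elim y)
        then have y: "y \<in> Y" by (simp add: spm)
        have py: "p x y = exp (\<phi> y) * (exp (- (c x y / \<epsilon>)) / G.Z \<phi> x)" for x
          by (simp add: p_def exp_diff exp_minus field_simps)
        have "(\<integral>\<^sup>+x. ennreal (p x y) \<partial>P) = ennreal (\<integral>x. p x y \<partial>P)"
          unfolding py
          by (intro nn_integral_eq_integral AE_I2 integrable_mult_right G.integrable_factor[OF \<phi> y])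
            (simp add: less_imp_le[OF G.Z_pos[OF \<phi>]])
        also have "(\<integral>x. p x y \<partial>P) = q y"
          unfolding py using elim by (simp only: integral_mult_right_zero marginal_factor_def)
        finally show ?case by (auto simp: indicator_def)
      qed
    qed
    also have "\<dots> = emeasure Q D" unfolding Q_def by (simp add: emeasure_density)
    finally show "emeasure (distr \<pi> Q snd) D = emeasure Q D" .
  qed simp
  have s\<pi>: "sets \<pi> = sets (P \<Otimes>\<^sub>M Q)"
    unfolding s\<pi>m by (intro sets_pair_measure_cong refl sQ[symmetric])
  have cpl: "\<pi> \<in> couplings P Q" using s\<pi> p\<pi> m1 m2 by (simp add: couplings_def)
  have "snd \<in> \<pi> \<rightarrow>\<^sub>M Q" by measurable
  then have "prob_space (distr \<pi> Q snd)" by (rule prob_space.prob_space_distr[OF p\<pi>])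
  then have pQ: "prob_space Q" by (simp add: m2)
  have QY: "Q \<in> probs Y" using pQ sQ by (simp add: probs_def m_def)
  define \<kappa> where "\<kappa> = (SOME \<kappa>. cond_kernel P Q \<pi> \<kappa>)"
  have k: "cond_kernel P Q \<pi> \<kappa>"
    unfolding \<kappa>_def
    using coupling_kernel_exists[OF borel_compact[OF Y] G.P.prob_space_axioms sQ[unfolded m_def] cpl]
    by (rule someI_ex)
  \<comment> \<open>The kernel selected in the objective is unknown. It agrees almost everywhere
    with this explicit Gibbs kernel by uniqueness of disintegrations, so its entropy can be
    computed.\<close>
  define \<eta> where "\<eta> x = density m (\<lambda>y. ennreal (p x y))" for x
  define u where "u x y = \<phi> y - c x y / \<epsilon>" for x y
  obtain b where b: "\<And>y. y \<in> Y \<Longrightarrow> \<bar>\<phi> y\<bar> \<le> b" using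
      G.continuous_bounded[OF \<phi>] by blast
  have um: "u x \<in> borel_measurable (restrict_space lborel Y)" if "x \<in> space P" for x
    unfolding u_def using G.continuous_measurable[OF \<phi>] G.C_section[OF that] by measurable
  have ub: "\<bar>u x y\<bar> \<le> b + B" if "x \<in> space P" "y \<in> Y" for x y
    unfolding u_def using b[OF that(2)] G.C_bound[OF that] by linarith
  have \<eta>_eq: "\<eta> x = density (restrict_space lborel Y)
      (\<lambda>y. ennreal (exp (u x y) / (\<integral>y. exp (u x y) \<partial>restrict_space lborel Y)))" for x
    by (simp add: \<eta>_def p_def u_def partition_fun_def m_def)
  have ent: "diff_entropy Y (\<eta> x) = ereal (ln (G.Z \<phi> x) - (\<integral>y. u x y \<partial>\<eta> x))"
    and \<eta>_probs: "\<eta> x \<in> probs Y" if x: "x \<in> space P" for x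
    using diff_entropy_gibbs(2,3)[OF Y Ypos um[OF x] ub[OF x]]
    unfolding \<eta>_eq[symmetric] by (simp_all add: partition_fun_def u_def)
  have \<eta>_e: "emeasure (\<eta> x) D = (\<integral>\<^sup>+y. ennreal (p x y) * indicator D y \<partial>m)"
    if "x \<in> space P" "D \<in> sets m" for x D
    unfolding \<eta>_def using that by (intro emeasure_density) auto
  have AEk: "AE x in P. \<kappa> x = \<eta> x"
  proof (rule kernel_AE_eqI[OF borel_compact[OF Y] G.P.prob_space_axioms sQ[unfolded m_def]])
    fix x assume x: "x \<in> space P"
    show "prob_space (\<kappa> x) \<and> sets (\<kappa> x) = sets Q" using cond_kernel_space[OF k x] by simp
    show "prob_space (\<eta> x) \<and> sets (\<eta> x) = sets Q" using \<eta>_probs[OF x] sQ by (simp add: probs_def m_def)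
  next
    fix D assume D[measurable]: "D \<in> sets Q"
    have "\<kappa> \<in> P \<rightarrow>\<^sub>M subprob_algebra Q" using k by (auto simp: cond_kernel_def intro:
        measurable_prob_algebraD)
    from measurable_compose[OF this measurable_emeasure_subprob_algebra[OF D]]
    show "(\<lambda>x. emeasure (\<kappa> x) D) \<in> borel_measurable P" .
    have D'[measurable]: "D \<in> sets m" using D sQ by simp
    have "(\<lambda>x. \<integral>\<^sup>+y. ennreal (p x y) * indicator D y \<partial>m) \<in> borel_measurable P"
      by (rule m.borel_measurable_nn_integral) (simp add: split_def)
    then show "(\<lambda>x. emeasure (\<eta> x) D) \<in> borel_measurable P"
      by (rule measurable_cong[THEN iffD1, rotated]) (simp add: \<eta>_e)
  next
    fix A D assume A: "A \<in> sets P" and D: "D \<in> sets Q"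
    then have D': "D \<in> sets m" using sQ by simp
    show "(\<integral>\<^sup>+x. emeasure (\<kappa> x) D * indicator A x \<partial>P) = (\<integral>\<^sup>+x.
        emeasure (\<eta> x) D * indicator A x \<partial>P)"
      unfolding cond_kernel_rectangle[OF G.P.prob_space_axioms k A D, symmetric] \<pi>e[OF A D']
      by (intro nn_integral_cong) (simp add: \<eta>_e D')
  qed
  have \<pi>u_meas: "(\<lambda>z. u (fst z) (snd z)) \<in> borel_measurable (P \<Otimes>\<^sub>M Q)"
    unfolding u_def by measurable
  have \<pi>u_bound: "\<bar>u (fst z) (snd z)\<bar> \<le> b + B" if "z \<in> space (P \<Otimes>\<^sub>M Q)" for z
    using that by (intro ub) (auto simp: space_pair_measure spQ)
  note I = cond_kernel_integral[OF G.P.prob_space_axioms p\<pi> k \<pi>u_meas \<pi>u_bound, simplified]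
  define E where "E x = ln (G.Z \<phi> x) - (\<integral>y. u x y \<partial>\<kappa> x)" for x
  have iu: "integrable P (\<lambda>x. \<integral>y. u x y \<partial>\<kappa> x)"
    using I(1,3) by (intro G.P.integrable_const_bound[where B = "b + B"] AE_I2) auto
  have iE: "integrable P E" unfolding E_def by (intro Bochner_Integration.integrable_diff G.integrable_ln_Z \<phi> iu)
  have "ereal_integral P (\<lambda>x. diff_entropy Y (\<kappa> x)) = ereal_integral P (\<lambda>x. ereal (E x))"
  proof (rule ereal_integral_cong_AE)
    show "AE x in P. diff_entropy Y (\<kappa> x) = ereal (E x)"
      using AEk AE_space by eventually_elim (simp add: E_def ent)
  qed
  also have "\<dots> = ereal (\<integral>x. E x \<partial>P)" by (rule ereal_integral_ereal[OF iE])
  finally have H: "ereal_integral P (\<lambda>x. diff_entropy Y (\<kappa> x)) = ereal (\<integral>x. E x \<partial>P)" .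
  have "(\<integral>z. c (fst z) (snd z) \<partial>\<pi>) - \<epsilon> * (\<integral>x. E x \<partial>P) =
      \<epsilon> * (\<integral>y. \<phi> y \<partial>Q) - \<epsilon> * log_partition P Y (\<lambda>x y. c x y /
          \<epsilon>) \<phi>"
  proof -
    interpret \<pi>: prob_space \<pi> by (rule p\<pi>)
    have iw: "integrable \<pi> (\<lambda>z. \<phi> (snd z))"
      using b sp\<pi> by (intro \<pi>.integrable_const_bound[where B = b] AE_I2) auto
    have ic: "integrable \<pi> (\<lambda>z. c (fst z) (snd z) / \<epsilon>)"
      using G.C_bound sp\<pi> by (intro \<pi>.integrable_const_bound[where B = B] AE_I2) auto
    have "(\<integral>x. E x \<partial>P) = log_partition P Y (\<lambda>x y. c x y / \<epsilon>) \<phi> -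
        (\<integral>x. (\<integral>y. u x y \<partial>\<kappa> x) \<partial>P)"
      unfolding E_def log_partition_def using G.integrable_ln_Z[OF \<phi>] iu by simp
    also have "(\<integral>x. (\<integral>y. u x y \<partial>\<kappa> x) \<partial>P) = (\<integral>z. u (fst z)
        (snd z) \<partial>\<pi>)" using I(2) by simp
    also have "\<dots> = (\<integral>z. \<phi> (snd z) \<partial>\<pi>) - (\<integral>z. c (fst z) (snd z) /
        \<epsilon> \<partial>\<pi>)"
      unfolding u_def using iw ic by (rule Bochner_Integration.integral_diff)
    also have "(\<integral>z. \<phi> (snd z) \<partial>\<pi>) = (\<integral>y. \<phi> y \<partial>distr \<pi> Q snd)"
      by (subst integral_distr) auto
    also have "\<dots> = (\<integral>y. \<phi> y \<partial>Q)" unfolding m2 ..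
    also have "(\<integral>z. c (fst z) (snd z) / \<epsilon> \<partial>\<pi>) = (\<integral>z. c (fst z) (snd z)
        \<partial>\<pi>) / \<epsilon>" by simp
    finally show ?thesis using \<epsilon> by (simp add: field_simps)
  qed
  then have "eot_obj c \<epsilon> Y P Q \<pi> = ereal (\<epsilon> * (\<integral>y. \<phi> y \<partial>Q) -
      \<epsilon> * log_partition P Y (\<lambda>x y. c x y / \<epsilon>) \<phi>)"
    unfolding eot_obj_def Let_def \<kappa>_def[symmetric] H by simp
  then show thesis using that cpl QY by blast
qed

text \<open>The Borel sets of \<open>nat \<Rightarrow> real\<close> involve all coordinates, those
  of \<open>leb_fin n\<close> only the first \<open>n\<close>. The remaining coordinates of an
  extensional function are constantly \<open>undefined\<close> and hence measurable.\<close>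

lemma measurable_leb_fin_borel: "(\<lambda>x. x) \<in> leb_fin n \<rightarrow>\<^sub>M borel"
proof (rule measurable_coordinatewise_then_product)
  fix i :: nat
  show "(\<lambda>x. x i) \<in> borel_measurable (leb_fin n)"
  proof (cases "i < n")
    case True
    then have "(\<lambda>x. x i) \<in> leb_fin n \<rightarrow>\<^sub>M lborel"
      unfolding leb_fin_def by (intro measurable_component_singleton) simp
    then show ?thesis by simp
  next
    case False
    have "x i = undefined" if "x \<in> space (leb_fin n)" for x
      using that False by (auto simp: leb_fin_def space_PiM PiE_def extensional_def)
    then show ?thesis by (subst measurable_cong[where g = "\<lambda>_. undefined"]) auto
  qed
qed

text \<open>Uniform continuity on the compact product makes the modulus of continuity in
  \<open>y\<close> independent of \<open>x\<close>.\<close>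

lemma gibbs_cost_compact:
  fixes X :: "(nat \<Rightarrow> real) set" and Y :: "'y::euclidean_space set"
  assumes X: "compact X" "X \<subseteq> space (leb_fin n)" and Y: "compact Y" "emeasure lborel Y > 0"
    and P: "sets P = sets (restrict_space (leb_fin n) X)" "prob_space P"
    and C: "continuous_on (X \<times> Y) (\<lambda>(x, y). C x y)"
    and B: "\<And>x y. x \<in> X \<Longrightarrow> y \<in> Y \<Longrightarrow> \<bar>C x y\<bar> \<le> B"
  shows "gibbs_cost P Y C B"
proof -
  interpret P: prob_space P by (rule P)
  have spP: "space P = X"
    using sets_eq_imp_space_eq[OF P(1)] X(2) by (auto simp: space_restrict_space)
  have "(\<lambda>x. x) \<in> restrict_space (leb_fin n) X \<rightarrow>\<^sub>M borel"
    by (intro measurable_restrict_space1 measurable_leb_fin_borel)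
  then have idP[measurable]: "(\<lambda>x. x) \<in> P \<rightarrow>\<^sub>M borel" unfolding
      measurable_cong_sets[OF P(1) refl] .
  show ?thesis
  proof
    have idm[measurable]: "(\<lambda>y. y) \<in> restrict_space lborel Y \<rightarrow>\<^sub>M borel" by (intro
        measurable_restrict_space1) simp
    have "(\<lambda>z. (fst z, snd z)) \<in> P \<Otimes>\<^sub>M restrict_space lborel Y \<rightarrow>\<^sub>M borel"
      using measurable_compose[OF measurable_fst idP] measurable_compose[OF measurable_snd idm]
      by (intro borel_measurable_Pair) simp_all
    then have "(\<lambda>z. (fst z, snd z)) \<in> P \<Otimes>\<^sub>M restrict_space lborel Y
        \<rightarrow>\<^sub>M restrict_space borel (X \<times> Y)"
      by (intro measurable_restrict_space2) (auto simp: space_pair_measure spP space_restrict_space)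
    from measurable_compose[OF this borel_measurable_continuous_on_restrict[OF C]]
    show "case_prod C \<in> borel_measurable (P \<Otimes>\<^sub>M restrict_space lborel Y)" by (simp add: split_def)
    show "\<bar>C x y\<bar> \<le> B" if "x \<in> space P" "y \<in> Y" for x y using that B by (simp add: spP)
    fix e :: real assume e: "0 < e"
    have "uniformly_continuous_on (X \<times> Y) (\<lambda>(x, y). C x y)"
      by (rule compact_uniformly_continuous[OF C compact_Times[OF X(1) Y(1)]])
    then obtain d where d: "d > 0" "\<And>z z'. z \<in> X \<times> Y \<Longrightarrow> z' \<in> X \<times> Y
        \<Longrightarrow> dist z' z < d
        \<Longrightarrow> dist (case z' of (x, y) \<Rightarrow> C x y) (case z of (x, y) \<Rightarrow> C x y) < e"
      unfolding uniformly_continuous_on_def using e by metis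
    have "\<bar>C x y - C x y'\<bar> \<le> e" if "x \<in> space P" "y \<in> Y" "y' \<in> Y" "dist y y' < d" for x y y'
      using d(2)[of "(x, y')" "(x, y)"] that by (simp add: spP dist_Pair_Pair dist_real_def)
    then show "\<exists>d>0. \<forall>x\<in>space P. \<forall>y\<in>Y. \<forall>y'\<in>Y. dist y y' < d
        \<longrightarrow> \<bar>C x y - C x y'\<bar> \<le> e"
      using d(1) by blast
  qed (use Y in auto)
qed

theorem theorem1:
  fixes K :: nat and D :: "nat \<Rightarrow> nat"
    and X :: "nat \<Rightarrow> (nat \<Rightarrow> real) set" and Y :: "'y::euclidean_space set"
    and P :: "nat \<Rightarrow> (nat \<Rightarrow> real) measure"
    and c :: "nat \<Rightarrow> (nat \<Rightarrow> real) \<Rightarrow> 'y \<Rightarrow> real"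
    and lam :: "nat \<Rightarrow> real" and \<epsilon> :: real
  assumes K: "K \<ge> 1"
    and X_sub: "\<And>k. k < K \<Longrightarrow> X k \<subseteq> space (leb_fin (D k))"
    and X_compact: "\<And>k. k < K \<Longrightarrow> compact (X k)"
    and Y_compact: "compact Y"
    and Y_pos: "emeasure lborel Y > 0"
    and P_sets: "\<And>k. k < K \<Longrightarrow> sets (P k) = sets (restrict_space (leb_fin (D k)) (X k))"
    and P_prob: "\<And>k. k < K \<Longrightarrow> prob_space (P k)"
    and P_ac: "\<And>k. k < K \<Longrightarrow> absolutely_continuous (restrict_space (leb_fin (D k)) (X k)) (P k)"
    and c_cont: "\<And>k. k < K \<Longrightarrow> continuous_on (X k \<times> Y) (\<lambda>(x, y). c k x y)"
    and lam_pos: "\<And>k. k < K \<Longrightarrow> lam k > 0"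
    and lam_sum: "(\<Sum>k<K. lam k) = 1"
    and \<epsilon>_pos: "\<epsilon> > 0"
    and finite_some: "\<exists>Q \<in> probs Y. (\<Sum>k<K. ereal (lam k) * EOT (c k) \<epsilon> Y (P k) Q) \<noteq> \<infinity> \<and>
                                    (\<Sum>k<K. ereal (lam k) * EOT (c k) \<epsilon> Y (P k) Q) \<noteq> - \<infinity>"
  shows "barycenter_value K lam c \<epsilon> Y P =
         (SUP f \<in> {f :: nat \<Rightarrow> 'y \<Rightarrow> real.
                    (\<forall>k<K. continuous_on Y (f k)) \<and> (\<forall>y\<in>Y. (\<Sum>k<K. lam k * f k y) = 0)}.
            ereal (dual_L K lam c \<epsilon> Y P f))"
proof -
  define C where "C k x y = c k x y / \<epsilon>" for k x y
  have C_cont: "continuous_on (X k \<times> Y) (\<lambda>(x, y). C k x y)" if "k < K" for k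
    using continuous_on_divide[OF c_cont[OF that] continuous_on_const[of _ \<epsilon>]] \<epsilon>_pos
    by (simp add: C_def split_def)
  have "\<exists>b\<ge>0. \<forall>x\<in>X k. \<forall>y\<in>Y. \<bar>C k x y\<bar> \<le> b" if k: "k < K" for k
  proof -
    have "bounded ((\<lambda>(x, y). C k x y) ` (X k \<times> Y))"
      by (rule compact_imp_bounded[OF compact_continuous_image[OF C_cont[OF k] compact_Times[OF X_compact[OF k] Y_compact]]])
    then obtain b where "\<And>z. z \<in> X k \<times> Y \<Longrightarrow> \<bar>case z of (x, y) \<Rightarrow> C
        k x y\<bar> \<le> b" "b > 0"
      unfolding bounded_pos by auto
    then show ?thesis by (intro exI[of _ b]) force
  qed
  then obtain b where b: "\<And>k. k < K \<Longrightarrow> 0 \<le> b k" "\<And>k x y. k < K \<Longrightarrow> x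
      \<in> X k \<Longrightarrow> y \<in> Y \<Longrightarrow> \<bar>C k x y\<bar> \<le> b k"
    by metis
  \<comment> \<open>The locale shares one bound among all costs; the sum of the nonnegative
    individual bounds dominates each of them.\<close>
  define B where "B = (\<Sum>k<K. b k)"
  have gc: "gibbs_cost (P k) Y (C k) B" if k: "k < K" for k
  proof (rule gibbs_cost_compact[OF X_compact[OF k] X_sub[OF k] Y_compact Y_pos P_sets[OF k] P_prob[OF k] C_cont[OF k]])
    fix x y assume "x \<in> X k" "y \<in> Y"
    then have "\<bar>C k x y\<bar> \<le> b k" by (rule b(2)[OF k])
    also have "\<dots> \<le> B" unfolding B_def using k b(1) by (intro member_le_sum) auto
    finally show "\<bar>C k x y\<bar> \<le> B" .
  qed
  interpret S: sinkhorn K lam P Y C B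
    by (rule sinkhorn.intro) (fact gc K lam_pos lam_sum)+
  have C_eq: "C k = (\<lambda>x y. c k x y / \<epsilon>)" for k by (simp add: C_def[abs_def])
  have spP: "space (P k) = X k" if "k < K" for k
    using sets_eq_imp_space_eq[OF P_sets[OF that]] X_sub[OF that] by (auto simp: space_restrict_space)
  have dual: "dual_L K lam c \<epsilon> Y P f = (\<Sum>k<K. lam k * (- \<epsilon> * log_partition (P k) Y (C k)
      (\<lambda>y. f k y / \<epsilon>)))"
    if f: "\<And>k. k < K \<Longrightarrow> continuous_on Y (f k)" for f
    unfolding dual_L_def
  proof (intro sum.cong refl arg_cong2[where f = "(*)"])
    fix k assume "k \<in> {..<K}"
    then have k: "k < K" by simp
    have "(\<integral>x. real_of_ereal (ctrans (c k) \<epsilon> Y (f k) x) \<partial>P k) = (\<integral>x. -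
        \<epsilon> * ln (partition_fun Y (C k) (\<lambda>y. f k y / \<epsilon>) x) \<partial>P k)"
    proof (intro Bochner_Integration.integral_cong refl)
      fix x assume x: "x \<in> space (P k)"
      have "continuous_on Y (\<lambda>y. (\<lambda>(x, y). c k x y) (x, y))"
        using x spP[OF k] by (intro continuous_on_compose2[OF c_cont[OF k]] continuous_intros) auto
      then have "continuous_on Y (c k x)" by simp
      from ctrans_eq[where c = "c k" and x = x, OF Y_compact Y_pos \<epsilon>_pos f[OF k] this]
      show "real_of_ereal (ctrans (c k) \<epsilon> Y (f k) x) = - \<epsilon> * ln (partition_fun Y (C k)
          (\<lambda>y. f k y / \<epsilon>) x)"
        by (simp add: partition_fun_def C_def diff_divide_distrib)
    qed
    then show "(\<integral>x. real_of_ereal (ctrans (c k) \<epsilon> Y (f k) x) \<partial>P k) = - \<epsilon> *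
        log_partition (P k) Y (C k) (\<lambda>y. f k y / \<epsilon>)"
      by (simp add: log_partition_def)
  qed
  \<comment> \<open>The congruence constraint removes \<open>Q\<close> from the dual side: the
    potential terms cancel in the weighted sum for any \<open>Q\<close>. This makes the lower bound
    uniform over the infimum and the two values equal at the minimiser.\<close>
  have int_sum: "(\<Sum>k<K. lam k * (\<integral>y. f k y \<partial>Q)) = 0"
    if Q: "Q \<in> probs Y" and f: "\<And>k. k < K \<Longrightarrow> continuous_on Y (f k)" "\<And>y. y \<in> Y
        \<Longrightarrow> (\<Sum>k<K. lam k * f k y) = 0"
    for Q and f :: "nat \<Rightarrow> 'y \<Rightarrow> real"
  proof -
    interpret Q: prob_space Q using Q by (simp add: probs_def)
    have sQ: "sets Q = sets (restrict_space lborel Y)" using Q by (simp add: probs_def)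
    have spQ: "space Q = Y" using sets_eq_imp_space_eq[OF sQ] by (simp add: space_restrict_space)
    have i: "integrable Q (f k)" if k: "k < K" for k
    proof -
      obtain b where "\<And>y. y \<in> Y \<Longrightarrow> \<bar>f k y\<bar> \<le> b" "f k \<in> borel_measurable
          (restrict_space lborel Y)"
        by (rule compact_continuous_bounded_measurable[OF Y_compact f(1)[OF k]]) blast
      then show ?thesis using spQ measurable_cong_sets[OF sQ refl, of borel]
        by (intro Q.integrable_const_bound[where B = b] AE_I2) auto
    qed
    have "(\<Sum>k<K. lam k * (\<integral>y. f k y \<partial>Q)) = (\<integral>y. (\<Sum>k<K. lam k * f k y) \<partial>Q)"
      using i by (subst Bochner_Integration.integral_sum) auto
    also have "\<dots> = (\<integral>y. 0 \<partial>Q)" using f(2) spQ by (intro Bochner_Integration.integral_cong) auto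
    finally show ?thesis by simp
  qed
  show ?thesis
  proof (rule antisym)
    show "(SUP f \<in> {f. (\<forall>k<K. continuous_on Y (f k)) \<and> (\<forall>y\<in>Y. (\<Sum>k<K. lam k * f k y) = 0)}.
        ereal (dual_L K lam c \<epsilon> Y P f)) \<le> barycenter_value K lam c \<epsilon> Y P"
      unfolding barycenter_value_def
    proof (intro SUP_least INF_greatest)
      fix f :: "nat \<Rightarrow> 'y \<Rightarrow> real" and Q
      assume "f \<in> {f. (\<forall>k<K. continuous_on Y (f k)) \<and> (\<forall>y\<in>Y. (\<Sum>k<K. lam k * f k
          y) = 0)}" and Q: "Q \<in> probs Y"
      then have f: "\<And>k. k < K \<Longrightarrow> continuous_on Y (f k)" "\<And>y. y \<in> Y \<Longrightarrow>
          (\<Sum>k<K. lam k * f k y) = 0" by auto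
      define v where "v k = - \<epsilon> * log_partition (P k) Y (C k) (\<lambda>y. f k y / \<epsilon>) +
          (\<integral>y. f k y \<partial>Q)" for k
      have "dual_L K lam c \<epsilon> Y P f = (\<Sum>k<K. lam k * v k)"
        using dual[of f, OF f(1)] int_sum[OF Q, of f, OF f] unfolding v_def distrib_left sum.distrib by simp
      then have "ereal (dual_L K lam c \<epsilon> Y P f) = (\<Sum>k<K. ereal (lam k) * ereal (v k))" by simp
      also have "\<dots> \<le> (\<Sum>k<K. ereal (lam k) * EOT (c k) \<epsilon> Y (P k) Q)"
      proof (intro sum_mono ereal_mult_left_mono)
        fix k assume "k \<in> {..<K}"
        then have k: "k < K" by simp
        show "0 \<le> ereal (lam k)" using lam_pos[OF k] by simp
        show "ereal (v k) \<le> EOT (c k) \<epsilon> Y (P k) Q"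
          unfolding EOT_def v_def C_eq
          by (intro INF_greatest eot_obj_ge[OF Y_compact Y_pos \<epsilon>_pos gc[OF k, unfolded C_eq] Q _ f(1)[OF k]])
      qed
      finally show "ereal (dual_L K lam c \<epsilon> Y P f) \<le> (\<Sum>k<K. ereal (lam k) * EOT (c k) \<epsilon>
          Y (P k) Q)" .
    qed
  next
    obtain \<phi> where \<phi>: "S.feasible \<phi>" and min: "\<And>\<psi>. S.feasible \<psi> \<Longrightarrow>
        S.G \<phi> \<le> S.G \<psi>"
      by (rule S.minimiser_exists) blast
    note \<phi>c = S.feasibleD(1)[OF \<phi>] and \<phi>0 = S.feasibleD(2)[OF \<phi>]
    define q where "q y = exp (S.mean_L \<phi> y)" for y
    \<comment> \<open>The common second marginal of the Gibbs couplings at the minimiser, which is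
      the candidate barycenter.\<close>
    define Q where "Q = density (restrict_space lborel Y) (\<lambda>y. ennreal (q y))"
    have qm: "q \<in> borel_measurable (restrict_space lborel Y)"
      unfolding q_def using S.marginal_densities(1)[OF \<phi>] by (rule borel_measurable_integrable)
    define v where "v k = \<epsilon> * (\<integral>y. \<phi> k y \<partial>Q) - \<epsilon> * log_partition (P k) Y
        (C k) (\<phi> k)" for k
    have ex: "\<exists>\<pi>. \<pi> \<in> couplings (P k) Q \<and> eot_obj (c k) \<epsilon> Y (P k) Q \<pi> =
        ereal (v k) \<and> Q \<in> probs Y" if k: "k < K" for k
    proof -
      have "AE y in restrict_space lborel Y. \<forall>k<K. exp (\<phi> k y) * marginal_factor (P k) Y (C k)
          (\<phi> k) y = q y"
        unfolding q_def by (rule S.minimiser_equal_marginals[OF \<phi>]) (rule min)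
      then have "AE y in restrict_space lborel Y. exp (\<phi> k y) * marginal_factor (P k) Y (\<lambda>x y. c k x
          y / \<epsilon>) (\<phi> k) y = q y"
        unfolding C_eq by eventually_elim (use k in auto)
      from eot_obj_gibbs_coupling[OF Y_compact Y_pos \<epsilon>_pos gc[OF k, unfolded C_eq] \<phi>c[OF k] qm this]
      show ?thesis unfolding Q_def v_def C_eq by blast
    qed
    have Q: "Q \<in> probs Y" using ex[of 0] K by auto
    define f where "f k y = \<epsilon> * \<phi> k y" for k y
    have fc: "continuous_on Y (f k)" if "k < K" for k
      unfolding f_def[abs_def] by (intro continuous_intros \<phi>c that)
    have f0: "(\<Sum>k<K. lam k * f k y) = 0" if "y \<in> Y" for y
      using \<phi>0[OF that] by (simp add: f_def mult.left_commute flip: sum_distrib_left)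
    have fe: "(\<lambda>y. f k y / \<epsilon>) = \<phi> k" for k using \<epsilon>_pos by (simp add: f_def)
    have "barycenter_value K lam c \<epsilon> Y P \<le> (\<Sum>k<K. ereal (lam k) * EOT (c k) \<epsilon> Y (P k) Q)"
      unfolding barycenter_value_def by (rule INF_lower[OF Q])
    also have "\<dots> \<le> (\<Sum>k<K. ereal (lam k) * ereal (v k))"
    proof (intro sum_mono ereal_mult_left_mono)
      fix k assume "k \<in> {..<K}"
      then have k: "k < K" by simp
      show "0 \<le> ereal (lam k)" using lam_pos[OF k] by simp
      obtain \<pi> where \<pi>: "\<pi> \<in> couplings (P k) Q" "eot_obj (c k) \<epsilon> Y (P k) Q \<pi> = ereal (v k)"
        using ex[OF k] by blast
      show "EOT (c k) \<epsilon> Y (P k) Q \<le> ereal (v k)"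
        unfolding EOT_def \<pi>(2)[symmetric] by (rule INF_lower[OF \<pi>(1)])
    qed
    also have "\<dots> = ereal (dual_L K lam c \<epsilon> Y P f)"
    proof -
      have "v k = - \<epsilon> * log_partition (P k) Y (C k) (\<lambda>y. f k y / \<epsilon>) + (\<integral>y. f k
          y \<partial>Q)" for k
        unfolding fe by (simp add: v_def f_def)
      then have "(\<Sum>k<K. lam k * v k) = dual_L K lam c \<epsilon> Y P f"
        using dual[of f, OF fc] int_sum[OF Q, of f, OF fc f0] by (simp only: distrib_left sum.distrib)
      then show ?thesis by simp
    qed
    also have "\<dots> \<le> (SUP f \<in> {f. (\<forall>k<K. continuous_on Y (f k)) \<and> (\<forall>y\<in>Y.
        (\<Sum>k<K. lam k * f k y) = 0)}.
        ereal (dual_L K lam c \<epsilon> Y P f))"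
      using fc f0 by (intro SUP_upper) auto
    finally show "barycenter_value K lam c \<epsilon> Y P \<le> (SUP f \<in> {f. (\<forall>k<K. continuous_on Y (f
        k)) \<and> (\<forall>y\<in>Y. (\<Sum>k<K. lam k * f k y) = 0)}.
        ereal (dual_L K lam c \<epsilon> Y P f))" .
  qed
qed

end
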